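(* Let $f\in C^1(\mathbb R)$ and let $-\infty<a_-<a_0<a_+<+\infty$ be such that $f(a_\pm)=f(a_0)=0$, $f'(a_\pm)>0$, $f>0$ in $(a_-,a_0)$ and $f<0$ in $(a_0,a_+)$. For each $\alpha\in(a_-,a_0)$ with $\int_\alpha^{a_+}f(z)\,dz<0$, the traveling wave solution $\phi_\alpha(x-c_\alpha t)$ of $\partial_tu=\big(\partial_x^2u-f(u)\big)_+$ in $\mathbb R\times(0,+\infty)$ is unstable in $L^\infty(\mathbb R)$.
   Context: $(s)_+=\max\{s,0\}$. For each $\alpha\in(a_-,a_0)$ with $\int_\alpha^{a_+}f<0$, $(c_\alpha,\phi_\alpha)$ denotes the unique pair with $c_\alpha\in\mathbb R$, $\phi_\alpha\in W^{2,\infty}(\mathbb R)$ such that $-c_\alpha\phi_\alpha'-\phi_\alpha''+\partial I_{[\alpha,+\infty)}(\phi_\alpha)+f(\phi_\alpha)\ni0$ a.e. in $\mathbb R$, $\phi_\alpha(-\infty)=\alpha$, $\phi_\alpha(+\infty)=a_+$, $\phi_\alpha'\ge0$, $\phi_\alpha'(\pm\infty)=0$, $\phi_\alpha\equiv\alpha$ on $(-\infty,0]$ and $\phi_\alpha>\alpha$ on $(0,+\infty)$; here $\partial I_{[\alpha,+\infty)}(s)=\{0\}$ if $s>\alpha$, $=(-\infty,0]$ if $s=\alpha$, $=\emptyset$ if $s<\alpha$. Then $\phi_\alpha(x-c_\alpha t)$ solves the equation $\partial_tu=(\partial_x^2u-f(u))_+$ a.e. "Unstable in $L^\infty(\mathbb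 R)$" means not stable in the sense of Lyapunov: there is $\varepsilon_0>0$ such that for every $\delta>0$ there exist a solution $u$ of $\partial_tu=(\partial_x^2u-f(u))_+$ in $\mathbb R\times(0,+\infty)$ and some $t>0$ with $\|u(\cdot,0)-\phi_\alpha\|_{L^\infty(\mathbb R)}<\delta$ and $\|u(\cdot,t)-\phi_\alpha(\cdot-c_\alpha t)\|_{L^\infty(\mathbb R)}\ge\varepsilon_0$. Solutions are understood in the $L^2_{\rm loc}$ sense: for every $T>0$ and bounded interval $I$, $u\in L^2(0,T;H^2(I))\cap C_w([0,T];H^1(I))\cap W^{1,2}(0,T;L^2(I))$ and the equation holds a.e. *)

theory Defs
  imports "HOL-Analysis.Analysis" "HOL-Probability.Essential_Supremum"
begin

section \<open>Sobolev spaces on open subsets of the real line\<close>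

text \<open>Elements of function spaces are represented by functions on all of the real line; only their
  restriction to the set \<open>S\<close> in question, up to null sets, matters. Accordingly the ``norms'' below
  are seminorms on representatives.\<close>

definition L2 :: "real set \<Rightarrow> (real \<Rightarrow> real) set" where
  "L2 S = {v. v \<in> borel_measurable (lebesgue_on S) \<and> integrable (lebesgue_on S) (\<lambda>x. (v x)\<^sup>2)}"

definition Linf :: "real set \<Rightarrow> (real \<Rightarrow> real) set" where
  "Linf S = {v. v \<in> borel_measurable (lebesgue_on S) \<and> (\<exists>C. AE x in lebesgue_on S. \<bar>v x\<bar> \<le> C)}"

definition Linf_norm :: "(real \<Rightarrow> real) \<Rightarrow> ereal" where
  "Linf_norm v = esssup lebesgue (\<lambda>x. ereal \<bar>v x\<bar>)"

text \<open>As usual in one dimension, test functions for weak derivatives are taken in $C^1_c$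
  (equivalently, $C^\infty_c$).\<close>

definition test_function :: "real set \<Rightarrow> (real \<Rightarrow> real) \<Rightarrow> bool" where
  "test_function S \<psi> \<longleftrightarrow> \<psi> C1_differentiable_on UNIV \<and>
     compact (closure {x. \<psi> x \<noteq> 0}) \<and> closure {x. \<psi> x \<noteq> 0} \<subseteq> S"

definition locally_integrable :: "real set \<Rightarrow> (real \<Rightarrow> real) \<Rightarrow> bool" where
  "locally_integrable S v \<longleftrightarrow> (\<forall>K. compact K \<longrightarrow> K \<subseteq> S \<longrightarrow> set_integrable lebesgue K v)"

definition has_weak_deriv :: "real set \<Rightarrow> (real \<Rightarrow> real) \<Rightarrow> (real \<Rightarrow> real) \<Rightarrow> bool" where
  "has_weak_deriv S v w \<longleftrightarrow> locally_integrable S v \<and> locally_integrable S w \<and>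
     (\<forall>\<psi>. test_function S \<psi> \<longrightarrow>
        integral\<^sup>L (lebesgue_on S) (\<lambda>x. v x * deriv \<psi> x) =
        - integral\<^sup>L (lebesgue_on S) (\<lambda>x. w x * \<psi> x))"

text \<open>A representative of the weak derivative, which is unique up to null subsets of \<open>S\<close>.\<close>

definition weak_deriv :: "real set \<Rightarrow> (real \<Rightarrow> real) \<Rightarrow> real \<Rightarrow> real" where
  "weak_deriv S v = (SOME w. has_weak_deriv S v w)"

text \<open>\<open>sobolev E S k\<close> consists of the functions whose weak derivatives on \<open>S\<close> of order \<open>0, \<dots>, k\<close>
  lie in \<open>E\<close>; so $H^k(S)$ arises from $E = L^2(S)$ and $W^{k,\infty}(S)$ from $E = L^\infty(S)$.\<close>

primrec sobolev :: "(real \<Rightarrow> real) set \<Rightarrow> real set \<Rightarrow> nat \<Rightarrow> (real \<Rightarrow> real) set" where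
  "sobolev E S 0 = E"
| "sobolev E S (Suc k) = {v \<in> E. \<exists>w \<in> sobolev E S k. has_weak_deriv S v w}"

definition H :: "nat \<Rightarrow> real set \<Rightarrow> (real \<Rightarrow> real) set" where
  "H k S = sobolev (L2 S) S k"

definition W_inf :: "nat \<Rightarrow> real set \<Rightarrow> (real \<Rightarrow> real) set" where
  "W_inf k S = sobolev (Linf S) S k"

definition H_norm :: "nat \<Rightarrow> real set \<Rightarrow> (real \<Rightarrow> real) \<Rightarrow> real" where
  "H_norm k S v = sqrt (\<Sum>j\<le>k. integral\<^sup>L (lebesgue_on S) (\<lambda>x. ((weak_deriv S ^^ j) v x)\<^sup>2))"


section \<open>Spaces of vector-valued functions of time\<close>

text \<open>Here a Banach space of functions is given by its carrier \<open>X\<close> and its norm \<open>N\<close>, and \<open>u t\<close> is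
  the value at time \<open>t\<close>.\<close>

definition dual_space ::
  "(real \<Rightarrow> real) set \<Rightarrow> ((real \<Rightarrow> real) \<Rightarrow> real) \<Rightarrow> ((real \<Rightarrow> real) \<Rightarrow> real) set" where
  "dual_space X N = {l.
     (\<forall>v\<in>X. \<forall>w\<in>X. l (\<lambda>x. v x + w x) = l v + l w) \<and>
     (\<forall>r. \<forall>v\<in>X. l (\<lambda>x. r * v x) = r * l v) \<and>
     (\<exists>C. \<forall>v\<in>X. \<bar>l v\<bar> \<le> C * N v)}"

definition strongly_measurable ::
  "real \<Rightarrow> (real \<Rightarrow> real) set \<Rightarrow> ((real \<Rightarrow> real) \<Rightarrow> real) \<Rightarrow> (real \<Rightarrow> real \<Rightarrow> real) \<Rightarrow> bool" where
  "strongly_measurable T X N u \<longleftrightarrow> (\<exists>s. 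
     (\<forall>n::nat. simple_function (lebesgue_on {0<..<T}) (s n) \<and> (\<forall>t\<in>{0<..<T}. s n t \<in> X)) \<and>
     (AE t in lebesgue_on {0<..<T}. (\<lambda>n. N (\<lambda>x. u t x - s n t x)) \<longlonglongrightarrow> 0))"

definition bochner_L2 ::
  "real \<Rightarrow> (real \<Rightarrow> real) set \<Rightarrow> ((real \<Rightarrow> real) \<Rightarrow> real) \<Rightarrow> (real \<Rightarrow> real \<Rightarrow> real) set" where
  "bochner_L2 T X N = {u.
     (AE t in lebesgue_on {0<..<T}. u t \<in> X) \<and> strongly_measurable T X N u \<and>
     (\<integral>\<^sup>+ t. ennreal ((N (u t))\<^sup>2) \<partial>(lebesgue_on {0<..<T})) < \<infinity>}"

definition weakly_continuous ::
  "real \<Rightarrow> (real \<Rightarrow> real) set \<Rightarrow> ((real \<Rightarrow> real) \<Rightarrow> real) \<Rightarrow> (real \<Rightarrow> real \<Rightarrow> real) set" where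
  "weakly_continuous T X N = {u.
     (\<forall>t\<in>{0..T}. u t \<in> X) \<and> (\<forall>l\<in>dual_space X N. continuous_on {0..T} (\<lambda>t. l (u t)))}"

text \<open>The identity $\int_0^T \psi' u = - \int_0^T \psi v$ of Bochner integrals in \<open>X\<close>, tested with all
  continuous linear functionals.\<close>

definition has_weak_time_deriv ::
  "real \<Rightarrow> (real \<Rightarrow> real) set \<Rightarrow> ((real \<Rightarrow> real) \<Rightarrow> real) \<Rightarrow>
   (real \<Rightarrow> real \<Rightarrow> real) \<Rightarrow> (real \<Rightarrow> real \<Rightarrow> real) \<Rightarrow> bool" where
  "has_weak_time_deriv T X N u v \<longleftrightarrow>
     (\<forall>\<psi>. test_function {0<..<T} \<psi> \<longrightarrow> (\<forall>l\<in>dual_space X N.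
        integral\<^sup>L (lebesgue_on {0<..<T}) (\<lambda>t. deriv \<psi> t * l (u t)) =
        - integral\<^sup>L (lebesgue_on {0<..<T}) (\<lambda>t. \<psi> t * l (v t))))"


section \<open>The evolution equation\<close>

text \<open>Here \<open>v\<close> is the time derivative of \<open>u\<close>, so that its existence in $L^2(0,T;L^2(I))$ is the
  condition $u \in W^{1,2}(0,T;L^2(I))$. As \<open>u\<close> is a function of time with values in function
  spaces, the equation ``a.e.'' means: for a.e. time, a.e. in space.\<close>

definition solution :: "(real \<Rightarrow> real) \<Rightarrow> (real \<Rightarrow> real \<Rightarrow> real) \<Rightarrow> bool" where
  "solution f u \<longleftrightarrow> (\<forall>T>0. \<forall>a b. a < b \<longrightarrow> (let I = {a<..<b} in
     u \<in> bochner_L2 T (H 2 I) (H_norm 2 I) \<and>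
     u \<in> weakly_continuous T (H 1 I) (H_norm 1 I) \<and>
     u \<in> bochner_L2 T (H 0 I) (H_norm 0 I) \<and>
     (\<exists>v \<in> bochner_L2 T (H 0 I) (H_norm 0 I).
        has_weak_time_deriv T (H 0 I) (H_norm 0 I) u v \<and>
        (AE t in lebesgue_on {0<..<T}. AE x in lebesgue_on I.
           v t x = max (weak_deriv I (weak_deriv I (u t)) x - f (u t x)) 0))))"

definition unstable_Linf :: "(real \<Rightarrow> real) \<Rightarrow> (real \<Rightarrow> real \<Rightarrow> real) \<Rightarrow> bool" where
  "unstable_Linf f U \<longleftrightarrow> (\<exists>\<epsilon>>0. \<forall>\<delta>>0. \<exists>u. solution f u \<and> (\<exists>t>0.
     Linf_norm (\<lambda>x. u 0 x - U 0 x) < ereal \<delta> \<and>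
     Linf_norm (\<lambda>x. u t x - U t x) \<ge> ereal \<epsilon>))"


section \<open>Traveling waves\<close>

definition subdiff_indicator :: "real \<Rightarrow> real \<Rightarrow> real set" where
  "subdiff_indicator \<alpha> s = (if s > \<alpha> then {0} else if s = \<alpha> then {..0} else {})"

text \<open>The profile \<open>\<phi>\<close> is the $C^1$ representative of its class in $W^{2,\infty}$, so that the
  pointwise conditions on \<open>\<phi>\<close> and \<open>\<phi>'\<close> make sense; \<open>\<phi>''\<close> is a weak derivative.\<close>

definition traveling_wave ::
  "(real \<Rightarrow> real) \<Rightarrow> real \<Rightarrow> real \<Rightarrow> real \<Rightarrow> (real \<Rightarrow> real) \<Rightarrow> bool" where
  "traveling_wave f a\<^sub>p \<alpha> c \<phi> \<longleftrightarrow>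
     \<phi> \<in> W_inf 2 UNIV \<and> \<phi> C1_differentiable_on UNIV \<and>
     (AE x in lebesgue. 0 \<in> {- c * deriv \<phi> x - weak_deriv UNIV (deriv \<phi>) x + \<xi> + f (\<phi> x) |\<xi>.
                                \<xi> \<in> subdiff_indicator \<alpha> (\<phi> x)}) \<and>
     (\<phi> \<longlongrightarrow> \<alpha>) at_bot \<and> (\<phi> \<longlongrightarrow> a\<^sub>p) at_top \<and>
     (\<forall>x. deriv \<phi> x \<ge> 0) \<and>
     (deriv \<phi> \<longlongrightarrow> 0) at_bot \<and> (deriv \<phi> \<longlongrightarrow> 0) at_top \<and>
     (\<forall>x\<le>0. \<phi> x = \<alpha>) \<and> (\<forall>x>0. \<phi> x > \<alpha>)"

end

theory Submission
  imports Defs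
begin

text \<open>The idea is to find, arbitrarily close to \<open>\<phi>\<close> in the supremum norm, the profile of another
  travelling wave which is faster. The two waves drift apart: where the original wave is still at
  \<open>\<alpha>\<close>, the other one approaches \<open>a\<^sub>p\<close>.

  With \<open>k = - c > 0\<close>, profiles solve \<open>\<psi>'' = k * \<psi>' + f \<psi>\<close>, \<open>\<psi> 0 = \<beta>\<close>, \<open>\<psi>' 0 = 0\<close> on the half-line, and
  the faster wave is found by shooting in \<open>\<beta>\<close>. Orbits of equal speed separate in the phase plane, so
  with the speed of \<open>\<phi>\<close> the orbits starting below \<open>\<alpha>\<close> overshoot \<open>a\<^sub>p\<close> and those starting above \<open>\<alpha>\<close>
  turn back before reaching it. Both properties are open, so they persist for slightly larger \<open>k\<close>, and
  by connectedness some \<open>\<beta>\<close> near \<open>\<alpha>\<close> has neither; its orbit increases to \<open>a\<^sub>p\<close>. Since the tails are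
  monotone with the same limit, closeness on a compact interval gives closeness everywhere.\<close>

section \<open>Weak derivatives on the line\<close>

text \<open>Every level \<beta> with \<open>f \<beta>\<close> nonnegative is held fixed by the
  positive part: where the profile equals \<beta>, the equation reads
  \<open>0 = max (- f \<beta>) 0\<close>. So the contact level is a free parameter beside the speed,
  and the competing wave is an exact solution of the evolution equation. The speed \<open>c\<close>
  is negative because the integral of \<open>f\<close> over \<open>[\<alpha>, ap]\<close> is
  negative. Then \<open>k\<close> is positive, and this is what drives equal-speed orbits apart: at
  equal height the difference of the squared slopes grows at the rate \<open>2 * k\<close> times the
  difference of the slopes. Orbits live on a half-line, but depend continuously on their data only
  over compact intervals. Both shooting alternatives are therefore strict inequalities on a compact
  interval. The gap finally reached is half of \<open>ap - \<alpha>\<close>, whatever \<delta> is;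
  \<delta> influences only the waiting time. The other half of the work is the solution concept:
  curves with values in Sobolev spaces, weak derivatives known only up to null sets, and a profile
  whose second derivative may jump at the contact point.\<close>

lemma integral_lebesgue_on_eq:
  fixes F :: "real \<Rightarrow> real"
  assumes "S \<in> sets lebesgue" "\<And>x. x \<notin> S \<Longrightarrow> F x = 0"
  shows "integral\<^sup>L (lebesgue_on S) F = integral\<^sup>L lebesgue F"
proof -
  have "(\<lambda>x. if x \<in> S then F x else 0) = F" using assms by auto
  then show ?thesis using Lebesgue_Measure.integral_restrict_UNIV[OF assms(1), of F] by simp
qed

lemma continuous_imp_absolutely_integrable_compact:
  fixes v :: "real \<Rightarrow> real"
  assumes "continuous_on K v" "compact K"
  shows "v absolutely_integrable_on K"
proof -
  have "integrable lborel (\<lambda>x. indicator K x *\<^sub>R v x)"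
    by (rule borel_integrable_compact[OF assms(2,1)])
  then show ?thesis unfolding set_integrable_def
    by (simp add: integrable_completion)
qed

lemma DERIV_zero_if_locally_constant:
  fixes v :: "real \<Rightarrow> real"
  assumes "open S" "x \<in> S" "\<And>y. y \<in> S \<Longrightarrow> v y = z"
  shows "(v has_real_derivative 0) (at x)"
proof -
  have "((\<lambda>_. z) has_real_derivative 0) (at x)" by simp
  then show ?thesis
    by (rule has_field_derivative_transform_within_open[OF _ assms(1,2)]) (simp add: assms(3))
qed

text \<open>The factor \<eta> is bounded on the compact set \<open>K\<close> and vanishes off it, so
  the product is dominated by a multiple of \<open>w\<close> restricted to \<open>K\<close>.\<close>

lemma locally_integrable_mult:
  fixes w \<eta> :: "real \<Rightarrow> real"
  assumes w: "locally_integrable S w" and K: "compact K" "K \<subseteq> S"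
    and \<eta>: "continuous_on UNIV \<eta>" "\<And>x. x \<notin> K \<Longrightarrow> \<eta> x = 0"
  shows "integrable lebesgue (\<lambda>x. w x * \<eta> x)"
proof -
  have 1: "integrable lebesgue (\<lambda>x. indicator K x *\<^sub>R w x)"
    using w K unfolding locally_integrable_def set_integrable_def by blast
  have "bounded (\<eta> ` K)"
    using \<eta>(1) K(1) by (meson compact_continuous_image compact_imp_bounded continuous_on_subset subset_UNIV)
  then obtain B where B: "\<And>x. x \<in> K \<Longrightarrow> \<bar>\<eta> x\<bar> \<le> B"
    unfolding bounded_iff by auto
  have 2: "integrable lebesgue (\<lambda>x. B * (indicator K x *\<^sub>R w x))" using 1 by simp
  have m: "\<eta> \<in> borel_measurable lebesgue"
    using \<eta>(1) by (simp add: borel_measurable_continuous_onI measurable_completion)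
  have eq: "(\<lambda>x. w x * \<eta> x) = (\<lambda>x. (indicator K x *\<^sub>R w x) * \<eta> x)"
    using \<eta>(2) by (auto simp: indicator_def fun_eq_iff)
  show ?thesis unfolding eq
  proof (rule Bochner_Integration.integrable_bound[OF 2])
    show "(\<lambda>x. (indicator K x *\<^sub>R w x) * \<eta> x) \<in> borel_measurable lebesgue"
      using 1 m by (intro borel_measurable_times) auto
    show "AE x in lebesgue. norm ((indicator K x *\<^sub>R w x) * \<eta> x) \<le> norm (B * (indicator K x *\<^sub>R w x))"
    proof (rule AE_I2)
      fix x
      show "norm ((indicator K x *\<^sub>R w x) * \<eta> x) \<le> norm (B * (indicator K x *\<^sub>R w x))"
        using mult_right_mono[OF order_trans[OF B[of x] abs_ge_self[of B]], of "\<bar>w x\<bar>"]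
        by (auto simp: indicator_def abs_mult mult.commute)
    qed
  qed
qed

lemma test_functionD:
  assumes "test_function S \<psi>"
  defines "K \<equiv> closure {x. \<psi> x \<noteq> 0}"
  shows "compact K" "K \<subseteq> S" "\<And>x. (\<psi> has_real_derivative deriv \<psi> x) (at x)"
    "continuous_on UNIV (deriv \<psi>)" "continuous_on UNIV \<psi>"
    "\<And>x. x \<notin> K \<Longrightarrow> \<psi> x = 0" "\<And>x. x \<notin> K \<Longrightarrow> deriv \<psi> x = 0"
proof -
  show "compact K" "K \<subseteq> S" using assms by (auto simp: test_function_def)
  obtain D where D: "\<And>x. (\<psi> has_vector_derivative D x) (at x)" "continuous_on UNIV D"
    using assms unfolding test_function_def C1_differentiable_on_def by auto
  then have d: "(\<psi> has_real_derivative D x) (at x)" for x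
    by (simp add: has_real_derivative_iff_has_vector_derivative)
  then have e: "deriv \<psi> = D" by (auto intro: DERIV_imp_deriv)
  show "\<And>x. (\<psi> has_real_derivative deriv \<psi> x) (at x)" using d e by simp
  show "continuous_on UNIV (deriv \<psi>)" using D e by simp
  show "continuous_on UNIV \<psi>"
    using d by (meson DERIV_isCont continuous_at_imp_continuous_on)
  show z: "\<psi> x = 0" if "x \<notin> K" for x
    using that closure_subset[of "{x. \<psi> x \<noteq> 0}"] by (auto simp: K_def)
  show "deriv \<psi> x = 0" if "x \<notin> K" for x
  proof -
    have "open (- K)" unfolding K_def by (intro open_Compl closed_closure)
    have "(\<psi> has_real_derivative 0) (at x)"
      by (rule DERIV_zero_if_locally_constant[OF \<open>open (- K)\<close>]) (use that z in auto)
    then show ?thesis by (rule DERIV_imp_deriv)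
  qed
qed

lemma locally_integrable_continuous:
  "continuous_on S v \<Longrightarrow> locally_integrable S v"
  unfolding locally_integrable_def
  using continuous_imp_absolutely_integrable_compact continuous_on_subset by blast

lemma has_weak_deriv_integral_iff:
  assumes "open S" "test_function S \<psi>"
  shows "(LINT x|lebesgue_on S. v x * deriv \<psi> x) = (LINT x|lebesgue. v x * deriv \<psi> x)"
    and "(LINT x|lebesgue_on S. w x * \<psi> x) = (LINT x|lebesgue. w x * \<psi> x)"
proof -
  have S: "S \<in> sets lebesgue" using assms(1) by simp
  have "\<psi> x = 0" "deriv \<psi> x = 0" if "x \<notin> S" for x
    using test_functionD(2,6,7)[OF assms(2)] that by blast+
  then show "(LINT x|lebesgue_on S. v x * deriv \<psi> x) = (LINT x|lebesgue. v x * deriv \<psi> x)"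
    and "(LINT x|lebesgue_on S. w x * \<psi> x) = (LINT x|lebesgue. w x * \<psi> x)"
    by (simp_all add: integral_lebesgue_on_eq[OF S])
qed

text \<open>The product of \<open>v\<close> with a test function extends by zero to a continuous
  function on the whole line that is differentiable off \<open>F\<close>; its derivative integrates
  to zero over an interval around the support. The exceptional set \<open>F\<close> is there for
  second derivatives of profiles, which may jump at the contact point.\<close>

lemma has_weak_derivI:
  assumes S: "open S" and F: "finite F" and v: "continuous_on S v"
    and d: "\<And>x. x \<in> S \<Longrightarrow> x \<notin> F \<Longrightarrow> (v has_real_derivative w x) (at x)"
    and w: "locally_integrable S w"
  shows "has_weak_deriv S v w"
  unfolding has_weak_deriv_def
proof (intro conjI allI impI)
  show lv: "locally_integrable S v" by (rule locally_integrable_continuous[OF v])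
  show "locally_integrable S w" by fact
  fix \<psi> assume t: "test_function S \<psi>"
  define K where "K = closure {x. \<psi> x \<noteq> 0}"
  note T = test_functionD[OF t, folded K_def]
  obtain a b where ab: "K \<subseteq> {a<..<b}"
  proof -
    obtain B where "\<forall>x\<in>K. \<bar>x\<bar> \<le> B" using T(1) compact_imp_bounded bounded_iff by (metis real_norm_def)
    have "K \<subseteq> {-(B+1)<..<B+1}"
    proof
      fix x assume "x \<in> K"
      then have "\<bar>x\<bar> \<le> B" using \<open>\<forall>x\<in>K. \<bar>x\<bar> \<le> B\<close> by blast
      then have "-(B+1) < x" "x < B+1" by linarith+
      then show "x \<in> {-(B+1)<..<B+1}" by simp
    qed
    then show ?thesis using that by blast
  qed
  have i1: "integrable lebesgue (\<lambda>x. v x * deriv \<psi> x)"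
    using locally_integrable_mult[OF lv T(1,2,4,7)] .
  have i2: "integrable lebesgue (\<lambda>x. w x * \<psi> x)"
    using locally_integrable_mult[OF w T(1,2,5,6)] .
  have ok: "open (- K)" unfolding K_def by (intro open_Compl closed_closure)
  have dV: "((\<lambda>x. v x * \<psi> x) has_real_derivative (v x * deriv \<psi> x + w x * \<psi> x)) (at x)" if "x \<notin> F" for x
  proof (cases "x \<in> K")
    case True
    then have "x \<in> S" using T(2) by auto
    then show ?thesis using DERIV_mult[OF d[OF _ that] T(3)[of x]] by (simp add: algebra_simps)
  next
    case False
    have "((\<lambda>x. v x * \<psi> x) has_real_derivative 0) (at x)"
      by (rule DERIV_zero_if_locally_constant[OF ok]) (use False T(6) in auto)
    then show ?thesis using False T(6,7) by simp
  qed
  have cV: "isCont (\<lambda>x. v x * \<psi> x) x" for x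
  proof (cases "x \<in> K")
    case True
    then have "x \<in> S" using T(2) by auto
    then have "isCont v x" using v S by (simp add: continuous_on_eq_continuous_at)
    moreover have "isCont \<psi> x" using T(3) DERIV_isCont by blast
    ultimately show ?thesis by simp
  next
    case False
    have "((\<lambda>x. v x * \<psi> x) has_real_derivative 0) (at x)"
      by (rule DERIV_zero_if_locally_constant[OF ok]) (use False T(6) in auto)
    then show ?thesis by (rule DERIV_isCont)
  qed
  \<comment> \<open>If \<open>K\<close> is empty, nothing forces the endpoints to be ordered; in
    that case the integrand is zero everywhere.\<close>
  have "((\<lambda>x. v x * deriv \<psi> x + w x * \<psi> x) has_integral 0) {a..b} \<or> \<not> a \<le> b"
  proof (cases "a \<le> b")
    case True
    have "((\<lambda>x. v x * deriv \<psi> x + w x * \<psi> x) has_integral (v b * \<psi> b - v a * \<psi> a)) {a..b}"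
    proof (rule fundamental_theorem_of_calculus_interior_strong[OF F True])
      show "continuous_on {a..b} (\<lambda>x. v x * \<psi> x)"
        using cV by (simp add: continuous_at_imp_continuous_on)
      fix x assume "x \<in> {a<..<b} - F"
      then show "((\<lambda>x. v x * \<psi> x) has_vector_derivative v x * deriv \<psi> x + w x * \<psi> x) (at x)"
        using dV[of x] by (simp add: has_real_derivative_iff_has_vector_derivative)
    qed
    moreover have "a \<notin> K" "b \<notin> K" using ab by auto
    ultimately show ?thesis using T(6) by simp
  qed simp
  then have h: "((\<lambda>x. v x * deriv \<psi> x + w x * \<psi> x) has_integral 0) UNIV"
  proof
    assume "((\<lambda>x. v x * deriv \<psi> x + w x * \<psi> x) has_integral 0) {a..b}"
    then show ?thesis
    proof (rule has_integral_on_superset)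
      fix x assume "x \<notin> {a..b}"
      then have "x \<notin> K" using ab by auto
      then show "v x * deriv \<psi> x + w x * \<psi> x = 0" using T(6,7) by simp
    qed simp
  next
    assume "\<not> a \<le> b"
    then have "K = {}" using ab by auto
    then have "(\<lambda>x. v x * deriv \<psi> x + w x * \<psi> x) = (\<lambda>_. 0)" using T(6,7) by (intro ext) simp
    then show ?thesis by simp
  qed
  have "(LINT x|lebesgue. v x * deriv \<psi> x + w x * \<psi> x) = 0"
    using integral_lebesgue[OF Bochner_Integration.integrable_add[OF i1 i2]] h by (simp add: integral_unique)
  then have "(LINT x|lebesgue. v x * deriv \<psi> x) = - (LINT x|lebesgue. w x * \<psi> x)"
    using i1 i2 by simp
  then show "(LINT x|lebesgue_on S. v x * deriv \<psi> x) = - (LINT x|lebesgue_on S. w x * \<psi> x)"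
    using has_weak_deriv_integral_iff[OF S t] by simp
qed

section \<open>Continuously differentiable approximations of indicators\<close>

definition hat :: "real \<Rightarrow> real" where
  "hat s = max 0 s - 2 * max 0 (s - 1) + max 0 (s - 2)"

text \<open>A primitive of the triangle \<open>hat\<close>, which has unit mass on
  \<open>[0, 2]\<close>: a C1 step from 0 to 1. Writing both through positive parts reduces
  differentiation to the single function \<open>(max 0 x)\<^sup>2\<close>.\<close>

definition ramp :: "real \<Rightarrow> real" where
  "ramp s = ((max 0 s)\<^sup>2 - 2 * (max 0 (s - 1))\<^sup>2 + (max 0 (s - 2))\<^sup>2) / 2"

lemma hat_eq: "hat s = (if s \<le> 0 \<or> s \<ge> 2 then 0 else if s \<le> 1 then s else 2 - s)"
  by (auto simp: hat_def)

lemma hat_nonneg: "hat s \<ge> 0"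
  by (auto simp: hat_eq)

lemma ramp_eq_0: "s \<le> 0 \<Longrightarrow> ramp s = 0"
  by (simp add: ramp_def max_absorb1)

lemma ramp_eq_1: "s \<ge> 2 \<Longrightarrow> ramp s = 1"
  by (simp add: ramp_def max_absorb2) (simp add: power2_eq_square algebra_simps)

lemma DERIV_max0_sq: "((\<lambda>x::real. (max 0 x)\<^sup>2) has_real_derivative 2 * max 0 x) (at x)"
proof -
  consider "x < 0" | "x = 0" | "x > 0" by linarith
  then show ?thesis
  proof cases
    case 1
    have "((\<lambda>x::real. (max 0 x)\<^sup>2) has_real_derivative 0) (at x)"
      by (rule DERIV_zero_if_locally_constant[of "{..<0}"]) (use 1 in auto)
    then show ?thesis using 1 by simp
  next
    case 2
    have "isCont (\<lambda>x::real. max 0 x) 0" by (intro continuous_intros)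
    \<comment> \<open>Since \<open>(max 0 z)\<^sup>2 = max 0 z * z\<close>, the Caratheodory factor
      at 0 is \<open>max 0 z\<close> itself.\<close>
    then show ?thesis unfolding CARAT_DERIV
      by (intro exI[of _ "\<lambda>z. max 0 z"]) (auto simp: 2 power2_eq_square max_def)
  next
    case 3
    have "((\<lambda>x. x\<^sup>2) has_real_derivative 2 * x) (at x)" by (auto intro!: derivative_eq_intros)
    then have "((\<lambda>x::real. (max 0 x)\<^sup>2) has_real_derivative 2 * x) (at x)"
      by (rule has_field_derivative_transform_within_open[of _ _ _ "{0<..}"]) (use 3 in auto)
    then show ?thesis using 3 by simp
  qed
qed

lemma DERIV_ramp: "(ramp has_real_derivative hat s) (at s)"
proof -
  have sh: "((\<lambda>x::real. (max 0 (x - c))\<^sup>2) has_real_derivative 2 * max 0 (s - c)) (at s)" for c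
  proof -
    have "((\<lambda>x. x - c) has_real_derivative 1) (at s)" by (auto intro!: derivative_eq_intros)
    then show ?thesis
      using DERIV_chain2[where f = "\<lambda>x. (max 0 x)\<^sup>2" and g = "\<lambda>x. x - c" and s = UNIV and x = s,
        OF DERIV_max0_sq, of 1] by simp
  qed
  show ?thesis
    unfolding ramp_def[abs_def] hat_def
    using DERIV_cdivide[OF DERIV_add[OF DERIV_diff[OF sh[of 0] DERIV_cmult[OF sh[of 1], of 2]] sh[of 2]], of 2]
    by (simp add: diff_divide_distrib add_divide_distrib)
qed

lemma continuous_hat: "continuous_on X hat"
  unfolding hat_def by (intro continuous_intros)

lemma ramp_bounds: "0 \<le> ramp s" "ramp s \<le> 1"
proof -
  have m: "s \<le> t \<Longrightarrow> ramp s \<le> ramp t" for s t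
    by (rule DERIV_nonneg_imp_nondecreasing) (use DERIV_ramp hat_nonneg in blast)+
  show "0 \<le> ramp s" using m[of 0 s] ramp_eq_0[of s] ramp_eq_0[of 0] by (cases "s \<le> 0") auto
  show "ramp s \<le> 1" using m[of s 2] ramp_eq_1[of s] ramp_eq_1[of 2] by (cases "s \<ge> 2") auto
qed

text \<open>\<open>plateau c d m\<close> is a test function that tends to the indicator of \<open>{c<..<d}\<close> as \<open>m\<close> grows, while its
  derivative tends to the difference of the Dirac masses at \<open>c\<close> and \<open>d\<close>.\<close>

definition plateau :: "real \<Rightarrow> real \<Rightarrow> real \<Rightarrow> real \<Rightarrow> real" where
  "plateau c d m x = ramp (m * (x - c)) - ramp (m * (x - d) + 2)"

definition plateau' :: "real \<Rightarrow> real \<Rightarrow> real \<Rightarrow> real \<Rightarrow> real" where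
  "plateau' c d m x = m * hat (m * (x - c)) - m * hat (m * (x - d) + 2)"

lemma DERIV_plateau: "(plateau c d m has_real_derivative plateau' c d m x) (at x)"
proof -
  have 1: "((\<lambda>x. ramp (m * (x - c))) has_real_derivative hat (m * (x - c)) * m) (at x)"
    by (rule DERIV_chain2[OF DERIV_ramp]) (auto intro!: derivative_eq_intros)
  have 2: "((\<lambda>x. ramp (m * (x - d) + 2)) has_real_derivative hat (m * (x - d) + 2) * m) (at x)"
    by (rule DERIV_chain2[OF DERIV_ramp]) (auto intro!: derivative_eq_intros)
  show ?thesis unfolding plateau_def[abs_def] plateau'_def
    using DERIV_diff[OF 1 2] by (simp add: mult.commute)
qed

lemma plateau_eq_0:
  assumes "c < d" "m * (d - c) \<ge> 2" "x \<notin> {c<..<d}"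
  shows "plateau c d m x = 0"
proof -
  have m: "m > 0" using zero_less_mult_pos2[of m "d - c"] assms(1,2) by simp
  show ?thesis
  proof (cases "x \<le> c")
    case True
    have "m * (x - c) \<le> 0" using True m by (simp add: mult_le_0_iff)
    moreover have "m * (x - d) + 2 = m * (x - c) - m * (d - c) + 2" by (simp add: algebra_simps)
    ultimately show ?thesis using assms(2) by (simp add: plateau_def ramp_eq_0)
  next
    case False
    then have "x \<ge> d" using assms by auto
    then have "m * (x - d) \<ge> 0" using m by simp
    moreover have "m * (x - c) = m * (x - d) + m * (d - c)" by (simp add: algebra_simps)
    ultimately show ?thesis using assms(2) by (simp add: plateau_def ramp_eq_1)
  qed
qed

lemma continuous_plateau': "continuous_on X (plateau' c d m)"
  unfolding plateau'_def
  by (intro continuous_intros continuous_on_compose2[OF continuous_hat[of UNIV]]) auto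

lemma test_function_plateau:
  assumes "c < d" "{c..d} \<subseteq> S" "m * (d - c) \<ge> 2"
  shows "test_function S (plateau c d m)"
  unfolding test_function_def
proof (intro conjI)
  show "plateau c d m C1_differentiable_on UNIV"
    unfolding C1_differentiable_on_def
    using DERIV_plateau continuous_plateau'
    by (intro exI[of _ "plateau' c d m"]) (simp add: has_real_derivative_iff_has_vector_derivative[symmetric])
  have "x \<in> {c..d}" if "plateau c d m x \<noteq> 0" for x
    using plateau_eq_0[OF assms(1,3), of x] that by fastforce
  then have s: "closure {x. plateau c d m x \<noteq> 0} \<subseteq> {c..d}"
    by (intro closure_minimal subsetI) simp_all
  then show "compact (closure {x. plateau c d m x \<noteq> 0})"
    using compact_Int_closed[OF compact_Icc closed_closure] by (metis inf.absorb_iff2)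
  show "closure {x. plateau c d m x \<noteq> 0} \<subseteq> S" using s assms(2) by blast
qed

lemma deriv_plateau: "deriv (plateau c d m) = plateau' c d m"
  by (rule ext, rule DERIV_imp_deriv, rule DERIV_plateau)

text \<open>The derivative of the plateau is a difference of two triangles of unit mass, supported
  within \<open>2 / m\<close> of \<open>c\<close> and of \<open>d\<close>. Replacing
  \<open>v\<close> by its endpoint value on each support costs at most \<open>e\<close>.\<close>

lemma plateau'_integral:
  assumes "c < d" "m * (d - c) \<ge> 2" and v: "continuous_on {c..d} v"
    and e: "\<And>x. x \<in> {c..d} \<Longrightarrow> m * (x - c) \<le> 2 \<Longrightarrow> \<bar>v x - v c\<bar> \<le> e"
           "\<And>x. x \<in> {c..d} \<Longrightarrow> m * (d - x) \<le> 2 \<Longrightarrow> \<bar>v x - v d\<bar> \<le> e"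
  shows "\<bar>integral {c..d} (\<lambda>x. v x * plateau' c d m x) - (v c - v d)\<bar> \<le> 2 * e"
proof -
  have m: "m > 0" using zero_less_mult_pos2[of m "d - c"] assms(1,2) by simp
  \<comment> \<open>One estimate for both triangles: the shift \<open>b = - m * c\<close> places the
    bump at the left end and \<open>b = 2 - m * d\<close> at the right end.\<close>
  have est: "\<bar>integral {c..d} (\<lambda>x. v x * (m * hat (m * x + b))) - z\<bar> \<le> e"
    if b: "m * c + b \<le> 0" "m * d + b \<ge> 2" and z: "\<And>x. x \<in> {c..d} \<Longrightarrow> m * x + b \<in> {0..2} \<Longrightarrow> \<bar>v x - z\<bar> \<le> e" for b z
  proof -
    have ch: "continuous_on {c..d} (\<lambda>x. m * hat (m * x + b))"
      by (intro continuous_intros continuous_on_compose2[OF continuous_hat[of UNIV]]) auto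
    have D: "((\<lambda>x. ramp (m * x + b)) has_real_derivative m * hat (m * x + b)) (at x)" for x
    proof -
      have "((\<lambda>x. m * x + b) has_real_derivative m) (at x)" by (auto intro!: derivative_eq_intros)
      from DERIV_chain2[OF DERIV_ramp this] show ?thesis by (simp add: mult.commute)
    qed
    have I1: "((\<lambda>x. m * hat (m * x + b)) has_integral (ramp (m * d + b) - ramp (m * c + b))) {c..d}"
      by (rule fundamental_theorem_of_calculus)
        (use D assms(1) in \<open>auto simp: has_real_derivative_iff_has_vector_derivative[symmetric] intro: has_field_derivative_at_within\<close>)
    then have I1: "((\<lambda>x. m * hat (m * x + b)) has_integral 1) {c..d}"
      using b by (simp add: ramp_eq_0 ramp_eq_1)
    have I2: "(\<lambda>x. (v x - z) * (m * hat (m * x + b))) integrable_on {c..d}"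
      by (intro integrable_continuous_real continuous_intros ch v)
    have eq: "integral {c..d} (\<lambda>x. v x * (m * hat (m * x + b))) - z = integral {c..d} (\<lambda>x. (v x - z) * (m * hat (m * x + b)))"
    proof -
      have "((\<lambda>x. v x * (m * hat (m * x + b)) - z * (m * hat (m * x + b))) has_integral
        (integral {c..d} (\<lambda>x. v x * (m * hat (m * x + b))) - z * 1)) {c..d}"
        by (intro has_integral_diff integrable_integral integrable_continuous_real continuous_intros ch v
            has_integral_mult_right I1)
      then show ?thesis by (simp add: algebra_simps integral_unique)
    qed
    have "norm (integral {c..d} (\<lambda>x. (v x - z) * (m * hat (m * x + b)))) \<le> integral {c..d} (\<lambda>x. e * (m * hat (m * x + b)))"
    proof (rule integral_norm_bound_integral[OF I2])
      show "(\<lambda>x. e * (m * hat (m * x + b))) integrable_on {c..d}"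
        by (intro integrable_continuous_real continuous_intros ch)
      fix x assume x: "x \<in> {c..d}"
      show "norm ((v x - z) * (m * hat (m * x + b))) \<le> e * (m * hat (m * x + b))"
      proof (cases "m * x + b \<in> {0..2}")
        case True
        then show ?thesis using z[OF x True] m hat_nonneg[of "m * x + b"] by (simp add: abs_mult mult_right_mono)
      next
        case False
        then have "hat (m * x + b) = 0" by (auto simp: hat_eq)
        then show ?thesis by simp
      qed
    qed
    also have "\<dots> = e * 1"
      by (rule integral_unique[OF has_integral_mult_right[OF I1]])
    finally show ?thesis using eq by simp
  qed
  have E1: "\<bar>integral {c..d} (\<lambda>x. v x * (m * hat (m * x + (- m * c)))) - v c\<bar> \<le> e"
    using assms(2) by (intro est) (auto simp: algebra_simps intro!: e)
  have E2: "\<bar>integral {c..d} (\<lambda>x. v x * (m * hat (m * x + (2 - m * d)))) - v d\<bar> \<le> e"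
    using assms(2) by (intro est) (auto simp: algebra_simps intro!: e)
  have "integral {c..d} (\<lambda>x. v x * plateau' c d m x) =
     integral {c..d} (\<lambda>x. v x * (m * hat (m * x + (- m * c))) - v x * (m * hat (m * x + (2 - m * d))))"
    by (rule integral_cong) (simp add: plateau'_def algebra_simps)
  also have "\<dots> = integral {c..d} (\<lambda>x. v x * (m * hat (m * x + (- m * c)))) - integral {c..d} (\<lambda>x. v x * (m * hat (m * x + (2 - m * d))))"
    by (intro integral_diff integrable_continuous_real continuous_intros v
          continuous_on_compose2[OF continuous_hat[of UNIV]]) auto
  finally show ?thesis using E1 E2 by linarith
qed

lemma plateau_tendsto:
  assumes "c < d"
  shows "(\<lambda>n. plateau c d (real n) x) \<longlonglongrightarrow> indicator {c<..<d} x"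
proof -
  have *: "\<exists>N. \<forall>n\<ge>N. real n * a \<ge> 2" if "a > 0" for a :: real
  proof -
    obtain N where "real N > 2 / a" using reals_Archimedean2 by blast
    then have "real N * a \<ge> 2" using that by (simp add: field_simps)
    have "real n * a \<ge> 2" if "n \<ge> N" for n
    proof -
      have "real N * a \<le> real n * a" by (rule mult_right_mono) (use that \<open>a > 0\<close> in auto)
      with \<open>real N * a \<ge> 2\<close> show ?thesis by linarith
    qed
    then show ?thesis by blast
  qed
  have "eventually (\<lambda>n. plateau c d (real n) x = indicator {c<..<d} x) sequentially"
  proof (cases "x \<in> {c<..<d}")
    case True
    obtain N1 where N1: "\<forall>n\<ge>N1. real n * (x - c) \<ge> 2" using *[of "x - c"] True by auto
    obtain N2 where N2: "\<forall>n\<ge>N2. real n * (d - x) \<ge> 2" using *[of "d - x"] True by auto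
    have "plateau c d (real n) x = 1" if "n \<ge> max N1 N2" for n
    proof -
      have "real n * (x - d) + 2 \<le> 0" using N2 that by (auto simp: algebra_simps)
      moreover have "real n * (x - c) \<ge> 2" using N1 that by auto
      ultimately show ?thesis by (simp add: plateau_def ramp_eq_0 ramp_eq_1)
    qed
    then show ?thesis using True unfolding eventually_sequentially by (intro exI[of _ "max N1 N2"]) simp
  next
    case False
    obtain N where N: "\<forall>n\<ge>N. real n * (d - c) \<ge> 2" using *[of "d - c"] assms by auto
    then show ?thesis unfolding eventually_sequentially
      by (intro exI[of _ N]) (use False plateau_eq_0[OF assms _ False] in simp)
  qed
  then show ?thesis by (rule tendsto_eventually)
qed

text \<open>The weak identity is tested with plateaus of increasing steepness. On the side of
  \<open>w\<close> dominated convergence yields the integral over \<open>{c..d}\<close>; on the side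
  of \<open>v\<close> uniform continuity yields the difference of the endpoint values.\<close>

lemma weak_deriv_FTC:
  assumes S: "open S" and w: "has_weak_deriv S v w" and v: "continuous_on S v"
    and cd: "c < d" "{c..d} \<subseteq> S"
  shows "(LINT x:{c..d}|lebesgue. w x) = v d - v c"
proof -
  obtain N where "real N > 2 / (d - c)" using reals_Archimedean2 by blast
  \<comment> \<open>From this index on, the ramps at the two ends fit into \<open>{c..d}\<close>, so
    the plateaus are admissible test functions.\<close>
  then have N0: "real N * (d - c) \<ge> 2" using cd by (simp add: field_simps)
  have N: "real n * (d - c) \<ge> 2" if "n \<ge> N" for n
  proof -
    have "real N * (d - c) \<le> real n * (d - c)" by (rule mult_right_mono) (use that cd in auto)
    with N0 show ?thesis by linarith
  qed
  have v': "continuous_on {c..d} v" using v cd continuous_on_subset by blast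
  have lw: "locally_integrable S w" and lv: "locally_integrable S v"
    using w by (auto simp: has_weak_deriv_def)
  let ?\<psi> = "\<lambda>n. plateau c d (real n)" and ?\<psi>' = "\<lambda>n. plateau' c d (real n)"
  let ?w = "\<lambda>x. indicator {c..d} x * w x"
  have wi: "integrable lebesgue (\<lambda>x. ?w x)"
    using lw cd unfolding locally_integrable_def set_integrable_def by fastforce
  have lim1: "(\<lambda>n. (LINT x|lebesgue. ?w x * ?\<psi> n x))
     \<longlonglongrightarrow> (LINT x|lebesgue. ?w x * indicator {c<..<d} x)"
  proof (rule integral_dominated_convergence)
    show "(\<lambda>x. ?w x * indicator {c<..<d} x) \<in> borel_measurable lebesgue"
      by (intro borel_measurable_times[OF borel_measurable_integrable[OF wi]] borel_measurable_indicator) simp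
    show "(\<lambda>x. ?w x * ?\<psi> n x) \<in> borel_measurable lebesgue" for n
    proof -
      have "continuous_on UNIV (plateau c d (real n))"
        using DERIV_plateau by (meson DERIV_isCont continuous_at_imp_continuous_on)
      then have "plateau c d (real n) \<in> borel_measurable lebesgue"
        by (simp add: borel_measurable_continuous_onI measurable_completion)
      then show ?thesis by (intro borel_measurable_times[OF borel_measurable_integrable[OF wi]])
    qed
    show "integrable lebesgue (\<lambda>x. norm (?w x))" using wi by (rule integrable_norm)
    show "AE x in lebesgue. (\<lambda>n. ?w x * ?\<psi> n x) \<longlonglongrightarrow> ?w x * indicator {c<..<d} x"
      by (intro AE_I2 tendsto_mult tendsto_const plateau_tendsto cd)
    show "AE x in lebesgue. norm (?w x * ?\<psi> n x) \<le> norm (?w x)" for n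
    proof (intro AE_I2)
      fix x
      have "\<bar>?\<psi> n x\<bar> \<le> 1"
        using ramp_bounds[of "real n * (x - c)"] ramp_bounds[of "real n * (x - d) + 2"] by (auto simp: plateau_def)
      then show "norm (?w x * ?\<psi> n x) \<le> norm (?w x)"
        using mult_left_mono[of _ 1 "\<bar>?w x\<bar>"] by (simp add: abs_mult)
    qed
  qed
  have lim1': "(LINT x|lebesgue. ?w x * indicator {c<..<d} x) = (LINT x:{c..d}|lebesgue. w x)"
    unfolding set_lebesgue_integral_def real_scaleR_def
  proof (rule integral_cong_AE)
    show "AE x in lebesgue. ?w x * indicator {c<..<d} x = ?w x"
    proof (rule AE_I'[of "{c,d}"])
      show "{c,d} \<in> null_sets lebesgue" by (simp add: negligible_iff_null_sets[symmetric])
    qed (auto simp: indicator_def)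
    show "(\<lambda>x. ?w x * indicator {c<..<d} x) \<in> borel_measurable lebesgue"
      by (intro borel_measurable_times[OF borel_measurable_integrable[OF wi]] borel_measurable_indicator) simp
  qed (rule borel_measurable_integrable[OF wi])
  have eq: "integral {c..d} (\<lambda>x. v x * ?\<psi>' n x) = - (LINT x|lebesgue. ?w x * ?\<psi> n x)"
    if "n \<ge> N" for n
  proof -
    have t: "test_function S (plateau c d (real n))" by (rule test_function_plateau[OF cd N[OF that]])
    have pz: "?\<psi> n x = 0" if "x \<notin> {c..d}" for x
    proof (rule plateau_eq_0[OF cd(1) N[OF \<open>n \<ge> N\<close>]])
      show "x \<notin> {c<..<d}" using that by auto
    qed
    note hi = has_weak_deriv_integral_iff[OF S t, unfolded deriv_plateau]
    have "(LINT x|lebesgue_on S. v x * ?\<psi>' n x) = - (LINT x|lebesgue_on S. w x * ?\<psi> n x)"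
      using w t unfolding has_weak_deriv_def by (metis deriv_plateau)
    then have "(LINT x|lebesgue. v x * ?\<psi>' n x) = - (LINT x|lebesgue. w x * ?\<psi> n x)"
      using hi by simp
    also have "(\<lambda>x. w x * ?\<psi> n x) = (\<lambda>x. ?w x * ?\<psi> n x)"
      using pz by (auto simp: indicator_def fun_eq_iff)
    also have "(LINT x|lebesgue. v x * ?\<psi>' n x) = integral {c..d} (\<lambda>x. v x * ?\<psi>' n x)"
    proof -
      have z: "?\<psi>' n x = 0" if "x \<notin> {c..d}" for x
      proof -
        have "(plateau c d (real n) has_real_derivative 0) (at x)"
          by (rule DERIV_zero_if_locally_constant[of "- {c..d}"]) (use that pz in auto)
        then show ?thesis using DERIV_unique[OF DERIV_plateau] by blast
      qed
      have ai: "(\<lambda>x. v x * ?\<psi>' n x) absolutely_integrable_on {c..d}"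
        by (intro continuous_imp_absolutely_integrable_compact continuous_intros v' continuous_plateau') auto
      have "(\<lambda>x. v x * ?\<psi>' n x) = (\<lambda>x. indicator {c..d} x *\<^sub>R (v x * ?\<psi>' n x))"
        using z by (auto simp: indicator_def fun_eq_iff)
      then show ?thesis
        using set_lebesgue_integral_eq_integral(2)[OF ai] unfolding set_lebesgue_integral_def by metis
    qed
    finally show ?thesis .
  qed
  have lim2: "(\<lambda>n. integral {c..d} (\<lambda>x. v x * ?\<psi>' n x)) \<longlonglongrightarrow> v c - v d"
  proof (rule LIMSEQ_I)
    fix r :: real assume "r > 0"
    then have r: "r/4 > 0" by simp
    have uc: "uniformly_continuous_on {c..d} v" by (rule compact_uniformly_continuous[OF v']) simp
    obtain \<delta> where \<delta>: "\<delta> > 0" "\<And>x y. x \<in> {c..d} \<Longrightarrow> y \<in> {c..d} \<Longrightarrow> dist y x < \<delta> \<Longrightarrow> dist (v y) (v x) < r/4"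
      using uc r unfolding uniformly_continuous_on_def by metis
    obtain M where "real M > 2 / \<delta>" using reals_Archimedean2 by blast
    then have M: "real M * \<delta> > 2" using \<delta>(1) by (simp add: field_simps)
    have "norm (integral {c..d} (\<lambda>x. v x * ?\<psi>' n x) - (v c - v d)) < r" if n: "n \<ge> max N M" for n
    proof -
      have "real M * \<delta> \<le> real n * \<delta>" by (rule mult_right_mono) (use n \<delta>(1) in auto)
      with M have n\<delta>: "real n * \<delta> > 2" by linarith
      have small: "a < \<delta>" if "real n * a \<le> 2" for a
      proof (rule ccontr)
        assume "\<not> a < \<delta>"
        then have "real n * \<delta> \<le> real n * a" by (intro mult_left_mono) auto
        then show False using that n\<delta> by simp
      qed
      have "\<bar>integral {c..d} (\<lambda>x. v x * ?\<psi>' n x) - (v c - v d)\<bar> \<le> 2 * (r/4)"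
      proof (rule plateau'_integral[OF cd(1) _ v'])
        show "2 \<le> real n * (d - c)" using N n by simp
        fix x assume x: "x \<in> {c..d}"
        show "\<bar>v x - v c\<bar> \<le> r/4" if "real n * (x - c) \<le> 2"
          using \<delta>(2)[of c x] small[OF that] x cd by (auto simp: dist_real_def)
        show "\<bar>v x - v d\<bar> \<le> r/4" if "real n * (d - x) \<le> 2"
          using \<delta>(2)[of d x] small[OF that] x cd by (auto simp: dist_real_def)
      qed
      then show ?thesis using \<open>r > 0\<close> by simp
    qed
    then show "\<exists>no. \<forall>n\<ge>no. norm (integral {c..d} (\<lambda>x. v x * ?\<psi>' n x) - (v c - v d)) < r" by blast
  qed
  have "(\<lambda>n. integral {c..d} (\<lambda>x. v x * ?\<psi>' n x)) \<longlonglongrightarrow> - (LINT x:{c..d}|lebesgue. w x)"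
  proof (rule Lim_transform_eventually)
    show "(\<lambda>n. - (LINT x|lebesgue. ?w x * ?\<psi> n x)) \<longlonglongrightarrow> - (LINT x:{c..d}|lebesgue. w x)"
      using tendsto_minus[OF lim1[unfolded lim1']] .
    show "\<forall>\<^sub>F n in sequentially. - (LINT x|lebesgue. ?w x * ?\<psi> n x) = integral {c..d} (\<lambda>x. v x * ?\<psi>' n x)"
      unfolding eventually_sequentially using eq by (intro exI[of _ N]) auto
  qed
  from LIMSEQ_unique[OF this lim2] show ?thesis by simp
qed

section \<open>Functions whose integrals over intervals vanish\<close>

lemma AE_eq_0_if_interval_integrals_eq_0:
  fixes h :: "real \<Rightarrow> real"
  assumes h: "integrable lebesgue h" and z: "\<And>a b. a \<le> b \<Longrightarrow> (LINT x:{a..b}|lebesgue. h x) = 0"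
  shows "AE x in lebesgue. h x = 0"
proof (rule density_unique_real[OF h integrable_zero])
  let ?G = "range (\<lambda>(a, b). {a .. b :: real})"
  \<comment> \<open>A Dynkin argument: compact intervals form an intersection-stable generator, and
    the sets with zero integral are closed under complements because the total integral is zero as
    well.\<close>
  have bor: "(LINT x:A|lebesgue. h x) = 0" if "A \<in> sets borel" for A :: "real set"
  proof -
    have si: "set_integrable lebesgue A h" if "A \<in> sets borel" for A
      unfolding set_integrable_def by (rule integrable_mult_indicator[OF _ h]) (use that in simp)
    have "A \<in> sigma_sets UNIV ?G"
      using that unfolding borel_eq_atLeastAtMost by (simp add: sets_measure_of)
    moreover have bs: "sigma_sets UNIV ?G = sets borel"
      unfolding borel_eq_atLeastAtMost by (simp add: sets_measure_of)
    have "Int_stable ?G"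
    proof (rule Int_stableI_image)
      fix x y :: "real \<times> real"
      show "\<exists>z\<in>UNIV. (case x of (a,b) \<Rightarrow> {a..b}) \<inter> (case y of (a,b) \<Rightarrow> {a..b}) = (case z of (a,b) \<Rightarrow> {a..b})"
        by (intro bexI[of _ "(max (fst x) (fst y), min (snd x) (snd y))"]) (auto split: prod.splits)
    qed
    have U: "(LINT x:UNIV|lebesgue. h x) = 0"
    proof -
      have un: "(\<Union>i. {- real i..real i}) = UNIV"
      proof (safe)
        fix x :: real
        obtain n where "\<bar>x\<bar> \<le> real n" using real_arch_simple by blast
        then show "x \<in> (\<Union>i. {- real i..real i})" by (auto intro!: exI[of _ n])
      qed simp
      have "(\<lambda>i. LINT x:{- real i..real i}|lebesgue. h x) \<longlonglongrightarrow> (LINT x:(\<Union>i. {- real i..real i})|lebesgue. h x)"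
        by (rule set_integral_cont_up) (use si[of UNIV] un in \<open>auto simp: incseq_def\<close>)
      moreover have "(\<lambda>i. LINT x:{- real i..real i}|lebesgue. h x) = (\<lambda>i. 0)"
        using z by (intro ext) simp
      ultimately show ?thesis using un LIMSEQ_const_iff by metis
    qed
    have "?G \<subseteq> Pow UNIV" by simp
    from \<open>Int_stable ?G\<close> this \<open>A \<in> sigma_sets UNIV ?G\<close> show ?thesis
    proof (induction rule: sigma_sets_induct_disjoint)
      case (basic A)
      then obtain a b where "A = {a..b}" by auto
      then show ?case using z[of a b] by (cases "a \<le> b") (auto simp: set_lebesgue_integral_def)
    next
      case empty then show ?case by (simp add: set_lebesgue_integral_def)
    next
      case (compl A)
      then have A: "A \<in> sets borel" using bs by simp
      have "(LINT x:A \<union> (UNIV - A)|lebesgue. h x) = (LINT x:A|lebesgue. h x) + (LINT x:(UNIV - A)|lebesgue. h x)"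
        by (rule set_integral_Un) (use si A in auto)
      then show ?case using U compl by simp
    next
      case (union A)
      have A: "A i \<in> sets borel" for i using union bs by auto
      have "(LINT x:(\<Union>i. A i)|lebesgue. h x) = (\<Sum>i. (LINT x:(A i)|lebesgue. h x))"
        by (rule lebesgue_integral_countable_add)
          (use A si[of "\<Union>i. A i"] union in \<open>auto simp: disjoint_family_on_def\<close>)
      then show ?case using union by simp
    qed
  qed
  fix A :: "real set" assume "A \<in> sets lebesgue"
  \<comment> \<open>A Lebesgue set differs from a Borel set only by a null set, which the integral
    does not see.\<close>
  then obtain B N N' where B: "A = B \<union> N" "N \<subseteq> N'" "N' \<in> null_sets lborel" "B \<in> sets lborel"
    by (rule sets_completionE)
  have "(LINT x:A|lebesgue. h x) = (LINT x:B|lebesgue. h x)"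
  proof (rule set_integral_null_delta)
    show "integrable lebesgue h" by fact
    show "A \<in> sets lebesgue" by fact
    show "B \<in> sets lebesgue" using B(4) by simp
    show "(A - B) \<union> (B - A) \<in> null_sets lebesgue"
      by (rule null_sets_completion_subset[of _ N']) (use B null_sets_completionI in auto)
  qed
  then show "(LINT x:A|lebesgue. h x) = (LINT x:A|lebesgue. 0)" using bor[of B] B(4) by simp
qed

lemma AE_eq_0_on_if_interval_integrals_eq_0:
  fixes h :: "real \<Rightarrow> real"
  assumes S: "open S" and h: "locally_integrable S h"
    and z: "\<And>c d. c < d \<Longrightarrow> {c..d} \<subseteq> S \<Longrightarrow> (LINT x:{c..d}|lebesgue. h x) = 0"
  shows "AE x in lebesgue. x \<in> S \<longrightarrow> h x = 0"
proof -
  have 1: "AE x in lebesgue. x \<in> {c..d} \<longrightarrow> h x = 0" if "{c..d} \<subseteq> S" for c d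
  proof -
    have i: "integrable lebesgue (\<lambda>x. indicator {c..d} x *\<^sub>R h x)"
      using h that unfolding locally_integrable_def set_integrable_def by auto
    have "AE x in lebesgue. indicator {c..d} x *\<^sub>R h x = 0"
    proof (rule AE_eq_0_if_interval_integrals_eq_0[OF i])
      fix a b :: real assume "a \<le> b"
      have "(LINT x:{a..b}|lebesgue. indicator {c..d} x *\<^sub>R h x) = (LINT x:{max a c..min b d}|lebesgue. h x)"
        unfolding set_lebesgue_integral_def
        by (rule Bochner_Integration.integral_cong) (auto simp: indicator_def)
      also have "\<dots> = 0"
      proof (cases "max a c < min b d")
        case True
        then show ?thesis by (intro z) (use that in auto)
      next
        case False
        then have "{max a c..min b d} \<subseteq> {max a c}" by auto
        moreover have "{max a c} \<in> null_sets lebesgue" by (simp add: negligible_iff_null_sets[symmetric])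
        ultimately have "{max a c..min b d} \<in> null_sets lebesgue"
          using null_sets_completion_subset by blast
        then show ?thesis unfolding set_lebesgue_integral_def
          by (intro integral_eq_zero_AE AE_I'[where N = "{max a c..min b d}"]) (auto simp: indicator_def)
      qed
      finally show "(LINT x:{a..b}|lebesgue. indicator {c..d} x *\<^sub>R h x) = 0" .
    qed
    then show ?thesis by (auto simp: indicator_def elim!: eventually_mono split: if_splits)
  qed
  \<comment> \<open>Intervals with rational endpoints cover the open set \<open>S\<close>, and there
    are only countably many null sets to discard.\<close>
  let ?R = "{p. fst p \<in> \<rat> \<and> snd p \<in> \<rat> \<and> {fst p..snd p} \<subseteq> S}"
  have "AE x in lebesgue. \<forall>p\<in>?R. x \<in> {fst p..snd p} \<longrightarrow> h x = 0"
  proof (rule AE_ball_countable')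
    have "?R \<subseteq> \<rat> \<times> (\<rat> :: real set)"
      by (auto simp: mem_Times_iff)
    moreover have "countable (\<rat> \<times> (\<rat> :: real set))" by (intro countable_SIGMA countable_rat)
    ultimately show "countable ?R"
      by (rule countable_subset)
  qed (use 1 in auto)
  then show ?thesis
  proof (rule eventually_mono, intro impI)
    fix x assume a: "\<forall>p\<in>?R. x \<in> {fst p..snd p} \<longrightarrow> h x = 0"
      and x: "x \<in> S"
    obtain e where e: "e > 0" "ball x e \<subseteq> S" using S x openE by blast
    obtain q where q: "q \<in> \<rat>" "x - e < q" "q < x" using Rats_dense_in_real[of "x - e" x] e by auto
    obtain r where r: "r \<in> \<rat>" "x < r" "r < x + e" using Rats_dense_in_real[of x "x + e"] e by auto
    have "{q..r} \<subseteq> S" using q r e(2) by (auto simp: ball_def dist_real_def subset_iff)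
    then show "h x = 0" using bspec[OF a, of "(q,r)"] q r by auto
  qed
qed

text \<open>Continuity of \<open>v\<close> gives its point values a meaning, so both candidates have
  the same integral over each compact interval in \<open>S\<close>.\<close>

lemma weak_deriv_unique:
  assumes S: "open S" and v: "continuous_on S v"
    and w: "has_weak_deriv S v w" "has_weak_deriv S v w'"
  shows "AE x in lebesgue. x \<in> S \<longrightarrow> w x = w' x"
proof -
  have l: "locally_integrable S w" "locally_integrable S w'" using w by (auto simp: has_weak_deriv_def)
  have "AE x in lebesgue. x \<in> S \<longrightarrow> w x - w' x = 0"
  proof (rule AE_eq_0_on_if_interval_integrals_eq_0[OF S])
    show "locally_integrable S (\<lambda>x. w x - w' x)" using l by (auto simp: locally_integrable_def)
    fix c d :: real assume cd: "c < d" "{c..d} \<subseteq> S"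
    have "set_integrable lebesgue {c..d} w" "set_integrable lebesgue {c..d} w'"
      using l cd by (auto simp: locally_integrable_def)
    then show "(LINT x:{c..d}|lebesgue. w x - w' x) = 0"
      using weak_deriv_FTC[OF S w(1) v cd] weak_deriv_FTC[OF S w(2) v cd] by simp
  qed
  then show ?thesis by simp
qed

text \<open>The operator \<open>weak_deriv\<close> returns an unspecified representative. This lemma
  is the means of exchanging it for a classical derivative, both as the function being
  differentiated and as its derivative.\<close>

lemma has_weak_deriv_cong_AE:
  assumes S: "open S" and w: "has_weak_deriv S v w"
    and m: "locally_integrable S v'" "locally_integrable S w'"
    and e: "AE x in lebesgue. x \<in> S \<longrightarrow> v x = v' x" "AE x in lebesgue. x \<in> S \<longrightarrow> w x = w' x"
  shows "has_weak_deriv S v' w'"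
  unfolding has_weak_deriv_def
proof (intro conjI m allI impI)
  fix \<psi> assume t: "test_function S \<psi>"
  note T = test_functionD[OF t] and I = has_weak_deriv_integral_iff[OF S t]
  have lv: "locally_integrable S v" and lw: "locally_integrable S w" using w by (auto simp: has_weak_deriv_def)
  have zo: "x \<notin> S \<Longrightarrow> \<psi> x = 0" "x \<notin> S \<Longrightarrow> deriv \<psi> x = 0" for x using T(2,6,7) by blast+
  have "(LINT x|lebesgue. v x * deriv \<psi> x) = (LINT x|lebesgue. v' x * deriv \<psi> x)"
    using locally_integrable_mult[OF lv T(1,2,4,7)] locally_integrable_mult[OF m(1) T(1,2,4,7)] e(1) zo
    by (intro integral_cong_AE) (auto elim!: eventually_mono)
  moreover have "(LINT x|lebesgue. w x * \<psi> x) = (LINT x|lebesgue. w' x * \<psi> x)"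
    using locally_integrable_mult[OF lw T(1,2,5,6)] locally_integrable_mult[OF m(2) T(1,2,5,6)] e(2) zo
    by (intro integral_cong_AE) (auto elim!: eventually_mono)
  ultimately show "(LINT x|lebesgue_on S. v' x * deriv \<psi> x) = - (LINT x|lebesgue_on S. w' x * \<psi> x)"
    using w t I by (auto simp: has_weak_deriv_def)
qed

section \<open>Moving profiles are solutions\<close>

lemma AE_lebesgue_on_open_iff:
  fixes S :: "real set"
  assumes "open S"
  shows "(AE x in lebesgue_on S. P x) \<longleftrightarrow> (AE x in lebesgue. x \<in> S \<longrightarrow> P x)"
  using assms by (simp add: AE_restrict_space_iff)

lemma AE_notin_finite:
  fixes F :: "real set"
  assumes "finite F" "open S"
  shows "AE x in lebesgue_on S. x \<notin> F"
proof -
  have "F \<in> null_sets lebesgue" using assms(1) by (simp add: negligible_iff_null_sets[symmetric] negligible_finite)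
  then have "AE x in lebesgue. x \<notin> F" by (rule AE_not_in)
  then show ?thesis unfolding AE_lebesgue_on_open_iff[OF assms(2)] by (rule eventually_mono) simp
qed

lemma measure_lebesgue_on_interval:
  assumes "a < (b::real)"
  shows "finite_measure (lebesgue_on {a<..<b})" "measure (lebesgue_on {a<..<b}) (space (lebesgue_on {a<..<b})) = b - a"
proof -
  show "finite_measure (lebesgue_on {a<..<b})"
    by (rule finite_measure_lebesgue_on) (simp add: lmeasurable_interval)
  show "measure (lebesgue_on {a<..<b}) (space (lebesgue_on {a<..<b})) = b - a"
    using assms by (simp add: measure_restrict_space space_restrict_space)
qed

section \<open>Bounded measurable functions on bounded intervals\<close>

definition bdd_meas :: "real set \<Rightarrow> (real \<Rightarrow> real) \<Rightarrow> bool" where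
  "bdd_meas S v \<longleftrightarrow> v \<in> borel_measurable (lebesgue_on S) \<and> (\<exists>B. \<forall>x\<in>S. \<bar>v x\<bar> \<le> B)"

lemma bdd_meas_diff: "bdd_meas S v \<Longrightarrow> bdd_meas S w \<Longrightarrow> bdd_meas S (\<lambda>x. v x - w x)"
  unfolding bdd_meas_def
proof (elim conjE exE, intro conjI)
  fix B C assume "\<forall>x\<in>S. \<bar>v x\<bar> \<le> B" "\<forall>x\<in>S. \<bar>w x\<bar> \<le> C"
  then have "\<forall>x\<in>S. \<bar>v x - w x\<bar> \<le> B + C"
    by (auto intro!: order_trans[OF abs_triangle_ineq4] add_mono)
  then show "\<exists>B. \<forall>x\<in>S. \<bar>v x - w x\<bar> \<le> B" by blast
qed (rule borel_measurable_diff)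

lemma square_le_if_abs_le: "\<bar>x :: real\<bar> \<le> B \<Longrightarrow> x\<^sup>2 \<le> B\<^sup>2"
  using power_mono[of "\<bar>x\<bar>" B 2] by simp

lemma bdd_meas_integrable_sq:
  assumes "a < b" "bdd_meas {a<..<b} v"
  shows "integrable (lebesgue_on {a<..<b}) (\<lambda>x. (v x)\<^sup>2)"
proof -
  interpret finite_measure "lebesgue_on {a<..<b}" using measure_lebesgue_on_interval[OF assms(1)] by simp
  obtain B where B: "\<forall>x\<in>{a<..<b}. \<bar>v x\<bar> \<le> B" using assms by (auto simp: bdd_meas_def)
  show ?thesis
  proof (rule integrable_const_bound[of _ "B\<^sup>2"])
    show "AE x in lebesgue_on {a<..<b}. norm ((v x)\<^sup>2) \<le> B\<^sup>2"
    proof (rule AE_I2)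
      fix x assume "x \<in> space (lebesgue_on {a<..<b})"
      then show "norm ((v x)\<^sup>2) \<le> B\<^sup>2" using B by (simp add: space_restrict_space square_le_if_abs_le)
    qed
    show "(\<lambda>x. (v x)\<^sup>2) \<in> borel_measurable (lebesgue_on {a<..<b})"
      using assms by (auto simp: bdd_meas_def intro!: borel_measurable_power)
  qed
qed

lemma bdd_meas_L2:
  assumes "a < b" "bdd_meas {a<..<b} v"
  shows "v \<in> L2 {a<..<b}"
  using bdd_meas_integrable_sq[OF assms] assms(2) by (simp add: L2_def bdd_meas_def)

lemma bdd_meas_locally_integrable:
  assumes "a < b" "bdd_meas {a<..<b} v"
  shows "locally_integrable {a<..<b} v"
  unfolding locally_integrable_def
proof (intro allI impI)
  fix K :: "real set" assume K: "compact K" "K \<subseteq> {a<..<b}"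
  interpret finite_measure "lebesgue_on {a<..<b}" using measure_lebesgue_on_interval[OF assms(1)] by simp
  obtain B where B: "\<forall>x\<in>{a<..<b}. \<bar>v x\<bar> \<le> B" using assms by (auto simp: bdd_meas_def)
  have "integrable (lebesgue_on {a<..<b}) v"
    by (rule integrable_const_bound[of _ "B"]) (use B assms in \<open>auto simp: space_restrict_space bdd_meas_def\<close>)
  then have "v absolutely_integrable_on {a<..<b}"
    using integrable_restrict_space[of "{a<..<b}" lebesgue v] by (simp add: set_integrable_def)
  then show "v absolutely_integrable_on K"
    by (rule set_integrable_subset) (use K in \<open>auto simp: compact_imp_closed\<close>)
qed

lemma integral_sq_le:
  fixes a b :: real
  assumes "a < b" "v \<in> borel_measurable (lebesgue_on {a<..<b})" "\<And>x. x \<in> {a<..<b} \<Longrightarrow> \<bar>v x\<bar> \<le> B"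
  shows "(LINT x|lebesgue_on {a<..<b}. (v x)\<^sup>2) \<le> (b - a) * B\<^sup>2"
proof -
  interpret finite_measure "lebesgue_on {a<..<b}" using measure_lebesgue_on_interval[OF assms(1)] by simp
  have bm: "bdd_meas {a<..<b} v" unfolding bdd_meas_def using assms(2,3) by blast
  have "(LINT x|lebesgue_on {a<..<b}. (v x)\<^sup>2) \<le> (LINT x|lebesgue_on {a<..<b}. B\<^sup>2)"
  proof (rule integral_mono[OF bdd_meas_integrable_sq[OF assms(1) bm]])
    fix x assume "x \<in> space (lebesgue_on {a<..<b})"
    then show "(v x)\<^sup>2 \<le> B\<^sup>2" using assms by (simp add: space_restrict_space square_le_if_abs_le)
  qed simp
  also have "\<dots> = (b - a) * B\<^sup>2" using measure_lebesgue_on_interval(2)[OF assms(1)] by simp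
  finally show ?thesis .
qed

lemma L2_tendsto_0:
  fixes a b :: real and w :: "nat \<Rightarrow> real \<Rightarrow> real"
  assumes ab: "a < b" and m: "\<And>n. w n \<in> borel_measurable (lebesgue_on {a<..<b})"
    and B: "\<And>n x. x \<in> {a<..<b} \<Longrightarrow> \<bar>w n x\<bar> \<le> B"
    and l: "AE x in lebesgue_on {a<..<b}. (\<lambda>n. w n x) \<longlonglongrightarrow> 0"
  shows "(\<lambda>n::nat. (LINT x|lebesgue_on {a<..<b}. (w n x)\<^sup>2)) \<longlonglongrightarrow> 0"
proof -
  interpret finite_measure "lebesgue_on {a<..<b}" using measure_lebesgue_on_interval[OF ab] by simp
  have "(\<lambda>n. (LINT x|lebesgue_on {a<..<b}. (w n x)\<^sup>2)) \<longlonglongrightarrow> (LINT x|lebesgue_on {a<..<b}. 0)"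
  proof (rule Bochner_Integration.integral_dominated_convergence[where s = "\<lambda>n x. (w n x)\<^sup>2" and f = "\<lambda>x. 0" and w = "\<lambda>x. B\<^sup>2"])
    show "integrable (lebesgue_on {a<..<b}) (\<lambda>x. B\<^sup>2)" by simp
    show "(\<lambda>x. (w n x)\<^sup>2) \<in> borel_measurable (lebesgue_on {a<..<b})" for n
      using m by (intro borel_measurable_power)
    show "AE x in lebesgue_on {a<..<b}. norm ((w n x)\<^sup>2) \<le> B\<^sup>2" for n
    proof (rule AE_I2)
      fix x assume "x \<in> space (lebesgue_on {a<..<b})"
      then show "norm ((w n x)\<^sup>2) \<le> B\<^sup>2" using B by (simp add: space_restrict_space square_le_if_abs_le)
    qed
    show "AE x in lebesgue_on {a<..<b}. (\<lambda>n. (w n x)\<^sup>2) \<longlonglongrightarrow> 0"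
      using l by (rule eventually_mono) (auto intro: tendsto_eq_intros)
  qed simp
  then show ?thesis by simp
qed

lemma has_weak_deriv_weak_deriv: "has_weak_deriv S v w \<Longrightarrow> has_weak_deriv S v (weak_deriv S v)"
  unfolding weak_deriv_def by (rule someI[of "has_weak_deriv S v"])

lemma borel_measurable_lebesgue_on_AE:
  fixes v w :: "real \<Rightarrow> real"
  assumes "open S" "v \<in> borel_measurable (lebesgue_on S)" "AE x in lebesgue_on S. v x = w x"
  shows "w \<in> borel_measurable (lebesgue_on S)"
proof -
  have S: "S \<in> sets lebesgue" using assms(1) by simp
  have "(\<lambda>x. if x \<in> S then w x else 0) \<in> borel_measurable lebesgue"
  proof (rule borel_measurable_AE)
    show "(\<lambda>x. if x \<in> S then v x else 0) \<in> borel_measurable lebesgue"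
      by (rule borel_measurable_if_I[OF assms(2) S])
    show "AE x in lebesgue. (if x \<in> S then v x else 0) = (if x \<in> S then w x else 0)"
      using assms(3) unfolding AE_lebesgue_on_open_iff[OF assms(1)] by (rule eventually_mono) simp
  qed
  then show ?thesis by (rule borel_measurable_if_D)
qed

text \<open>A working substitute for membership in the second Sobolev space that carries explicit
  derivatives along: boundedness puts all three functions into \<open>L2\<close> of a bounded
  interval, and the finite exceptional set admits jumps of the second derivative.\<close>

definition W2 :: "real set \<Rightarrow> (real \<Rightarrow> real) \<Rightarrow> (real \<Rightarrow> real) \<Rightarrow> (real \<Rightarrow> real) \<Rightarrow> bool" where
  "W2 I v v1 v2 \<longleftrightarrow> continuous_on I v \<and> continuous_on I v1 \<and>
     bdd_meas I v \<and> bdd_meas I v1 \<and> bdd_meas I v2 \<and>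
     (\<forall>x\<in>I. (v has_real_derivative v1 x) (at x)) \<and>
     (\<exists>F. finite F \<and> (\<forall>x\<in>I - F. (v1 has_real_derivative v2 x) (at x)))"

lemma W2_diff:
  assumes "W2 I v v1 v2" "W2 I w w1 w2"
  shows "W2 I (\<lambda>x. v x - w x) (\<lambda>x. v1 x - w1 x) (\<lambda>x. v2 x - w2 x)"
proof -
  obtain F where F: "finite F" "\<forall>x\<in>I - F. (v1 has_real_derivative v2 x) (at x)"
    using assms unfolding W2_def by blast
  obtain G where G: "finite G" "\<forall>x\<in>I - G. (w1 has_real_derivative w2 x) (at x)"
    using assms unfolding W2_def by blast
  have "\<forall>x\<in>I - (F \<union> G). ((\<lambda>x. v1 x - w1 x) has_real_derivative (v2 x - w2 x)) (at x)"
    using F G by (auto intro!: DERIV_diff)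
  then have "\<exists>F. finite F \<and> (\<forall>x\<in>I - F. ((\<lambda>x. v1 x - w1 x) has_real_derivative (v2 x - w2 x)) (at x))"
    using F(1) G(1) by (intro exI[of _ "F \<union> G"]) simp
  then show ?thesis
    using assms unfolding W2_def
    by (auto intro!: continuous_on_diff bdd_meas_diff DERIV_diff)
qed

context
  fixes a b :: real and I v v1 v2
  assumes ab: "a < b" and I_def: "I = {a<..<b}" and W: "W2 I v v1 v2"
begin

lemma W2_open: "open I" by (simp add: I_def)

lemma W2_bdd: "bdd_meas I v" "bdd_meas I v1" "bdd_meas I v2"
  using W by (auto simp: W2_def)

lemma W2_locint: "locally_integrable I v" "locally_integrable I v1" "locally_integrable I v2"
  using W2_bdd bdd_meas_locally_integrable[OF ab] by (auto simp: I_def)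

lemma W2_cont: "continuous_on I v" "continuous_on I v1"
  using W by (auto simp: W2_def)

lemma W2_weak: "has_weak_deriv I v v1" "has_weak_deriv I v1 v2"
proof -
  show "has_weak_deriv I v v1"
    by (rule has_weak_derivI[OF W2_open, of "{}"]) (use W W2_locint in \<open>auto simp: W2_def\<close>)
  obtain F where F: "finite F" "\<forall>x\<in>I - F. (v1 has_real_derivative v2 x) (at x)"
    using W unfolding W2_def by blast
  show "has_weak_deriv I v1 v2"
    by (rule has_weak_derivI[OF W2_open F(1)]) (use F W W2_locint in \<open>auto simp: W2_def\<close>)
qed

lemma W2_weak_deriv1:
  "has_weak_deriv I v (weak_deriv I v)" "AE x in lebesgue. x \<in> I \<longrightarrow> weak_deriv I v x = v1 x"
proof -
  show 1: "has_weak_deriv I v (weak_deriv I v)"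
    by (rule has_weak_deriv_weak_deriv[OF W2_weak(1)])
  show "AE x in lebesgue. x \<in> I \<longrightarrow> weak_deriv I v x = v1 x"
    by (rule weak_deriv_unique[OF W2_open W2_cont(1) 1 W2_weak(1)])
qed

text \<open>The inner \<open>weak_deriv\<close> need not be continuous, whereas uniqueness is
  available only for continuous functions. The a.e. equality with \<open>v1\<close> is therefore
  used in both directions: to see that a second weak derivative exists, so that the choice is
  meaningful, and to transfer the chosen one to \<open>v1\<close>.\<close>

lemma W2_weak_deriv2: "AE x in lebesgue. x \<in> I \<longrightarrow> weak_deriv I (weak_deriv I v) x = v2 x"
proof -
  have l: "locally_integrable I (weak_deriv I v)" using W2_weak_deriv1(1) by (simp add: has_weak_deriv_def)
  have e: "AE x in lebesgue. x \<in> I \<longrightarrow> v1 x = weak_deriv I v x"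
    using W2_weak_deriv1(2) by (rule eventually_mono) simp
  have "has_weak_deriv I (weak_deriv I v) v2"
    by (rule has_weak_deriv_cong_AE[OF W2_open W2_weak(2) l W2_locint(3) e]) simp
  then have h: "has_weak_deriv I (weak_deriv I v) (weak_deriv I (weak_deriv I v))"
    by (rule has_weak_deriv_weak_deriv)
  then have l2: "locally_integrable I (weak_deriv I (weak_deriv I v))" by (simp add: has_weak_deriv_def)
  have "has_weak_deriv I v1 (weak_deriv I (weak_deriv I v))"
    by (rule has_weak_deriv_cong_AE[OF W2_open h W2_locint(2) l2 W2_weak_deriv1(2)]) simp
  from weak_deriv_unique[OF W2_open W2_cont(2) this W2_weak(2)] show ?thesis .
qed

lemma W2_H: "v \<in> H 0 I" "v \<in> H 1 I" "v \<in> H 2 I"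
proof -
  have L: "v \<in> L2 I" "v1 \<in> L2 I" "v2 \<in> L2 I" using W2_bdd bdd_meas_L2[OF ab] by (auto simp: I_def)
  show "v \<in> H 0 I" using L by (simp add: H_def)
  show "v \<in> H 1 I" using L W2_weak by (auto simp: H_def)
  show "v \<in> H 2 I" using L W2_weak by (auto simp: H_def numeral_2_eq_2)
qed

lemma integral_weak_deriv_sq:
  "(LINT x|lebesgue_on I. (weak_deriv I v x)\<^sup>2) = (LINT x|lebesgue_on I. (v1 x)\<^sup>2)"
  "(LINT x|lebesgue_on I. (weak_deriv I (weak_deriv I v) x)\<^sup>2) = (LINT x|lebesgue_on I. (v2 x)\<^sup>2)"
proof -
  have eq: "(LINT x|lebesgue_on I. (w x)\<^sup>2) = (LINT x|lebesgue_on I. (r x)\<^sup>2)"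
    if ae: "AE x in lebesgue. x \<in> I \<longrightarrow> w x = r x" and r: "bdd_meas I r" for w r :: "real \<Rightarrow> real"
  proof (rule integral_cong_AE)
    have e: "AE x in lebesgue_on I. r x = w x"
      unfolding AE_lebesgue_on_open_iff[OF W2_open] using ae by (rule eventually_mono) simp
    have m: "r \<in> borel_measurable (lebesgue_on I)" using r by (simp add: bdd_meas_def)
    then show "(\<lambda>x. (r x)\<^sup>2) \<in> borel_measurable (lebesgue_on I)" by (rule borel_measurable_power)
    show "(\<lambda>x. (w x)\<^sup>2) \<in> borel_measurable (lebesgue_on I)"
      by (rule borel_measurable_power[OF borel_measurable_lebesgue_on_AE[OF W2_open m e]])
    show "AE x in lebesgue_on I. (w x)\<^sup>2 = (r x)\<^sup>2" using e by (rule eventually_mono) simp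
  qed
  show "(LINT x|lebesgue_on I. (weak_deriv I v x)\<^sup>2) = (LINT x|lebesgue_on I. (v1 x)\<^sup>2)"
    "(LINT x|lebesgue_on I. (weak_deriv I (weak_deriv I v) x)\<^sup>2) = (LINT x|lebesgue_on I. (v2 x)\<^sup>2)"
    using eq W2_weak_deriv1(2) W2_weak_deriv2 W2_bdd by auto
qed

lemma W2_H_norm:
  "H_norm 1 I v = sqrt ((LINT x|lebesgue_on I. (v x)\<^sup>2) + (LINT x|lebesgue_on I. (v1 x)\<^sup>2))"
  "H_norm 2 I v = sqrt ((LINT x|lebesgue_on I. (v x)\<^sup>2) + (LINT x|lebesgue_on I. (v1 x)\<^sup>2) + (LINT x|lebesgue_on I. (v2 x)\<^sup>2))"
  using integral_weak_deriv_sq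
  by (simp_all add: H_norm_def numeral_2_eq_2 atMost_Suc)

end

lemma H_norm_0: "H_norm 0 I v = sqrt ((LINT x|lebesgue_on I. (v x)\<^sup>2))"
  by (simp add: H_norm_def)


section \<open>Translates of locally bounded functions\<close>

definition loc_bdd :: "(real \<Rightarrow> real) \<Rightarrow> bool" where
  "loc_bdd r \<longleftrightarrow> r \<in> borel_measurable borel \<and> (\<forall>a b. bounded (r ` {a..b}))"

lemma continuous_loc_bdd: "continuous_on UNIV r \<Longrightarrow> loc_bdd r"
  unfolding loc_bdd_def
  by (meson borel_measurable_continuous_onI compact_Icc compact_continuous_image compact_imp_bounded
      continuous_on_subset subset_UNIV)

lemma loc_bdd_translate_measurable:
  assumes "loc_bdd r"
  shows "(\<lambda>x. r (x + s)) \<in> borel_measurable (lebesgue_on S)"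
proof -
  have "r \<in> borel_measurable borel" using assms by (simp add: loc_bdd_def)
  then have "(\<lambda>x. r (x + s)) \<in> borel_measurable borel"
    by (rule measurable_compose[rotated]) measurable
  then show ?thesis by (simp add: measurable_completion measurable_restrict_space1)
qed

text \<open>For \<open>x\<close> in a bounded interval and \<open>t\<close> up to \<open>T\<close>,
  the arguments \<open>x + k * t\<close> stay in a window enlarged by
  \<open>\<bar>k\<bar> * T\<close> on each side.\<close>

lemma loc_bdd_translate_bound:
  assumes "loc_bdd r"
  shows "\<exists>B\<ge>0. \<forall>x\<in>{a<..<b}. \<forall>t\<in>{0..T}. \<bar>r (x + k * t)\<bar> \<le> B"
proof -
  obtain B where B: "\<forall>y\<in>{a - \<bar>k\<bar> * T..b + \<bar>k\<bar> * T}. \<bar>r y\<bar> \<le> B"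
    using assms unfolding loc_bdd_def bounded_iff by (metis imageI real_norm_def)
  have "\<bar>r (x + k * t)\<bar> \<le> \<bar>B\<bar>" if "x \<in> {a<..<b}" "t \<in> {0..T}" for x t
  proof -
    have "\<bar>k * t\<bar> \<le> \<bar>k\<bar> * T" using that by (simp add: abs_mult mult_left_mono)
    then have "x + k * t \<in> {a - \<bar>k\<bar> * T..b + \<bar>k\<bar> * T}" using that by auto
    then show ?thesis using B by fastforce
  qed
  then show ?thesis by (intro exI[of _ "\<bar>B\<bar>"]) auto
qed

lemma loc_bdd_translate_bdd_meas:
  assumes "loc_bdd r"
  shows "bdd_meas {a<..<b} (\<lambda>x. r (x + s))"
proof -
  obtain B where "\<forall>x\<in>{a<..<b}. \<forall>t\<in>{0..1}. \<bar>r (x + s * t)\<bar> \<le> B"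
    using loc_bdd_translate_bound[OF assms, of a b 1 s] by blast
  then have "\<forall>x\<in>{a<..<b}. \<bar>r (x + s)\<bar> \<le> B" by (metis atLeastAtMost_iff le_numeral_extra(4) mult.right_neutral zero_less_one_class.zero_le_one)
  then show ?thesis using loc_bdd_translate_measurable[OF assms] by (auto simp: bdd_meas_def)
qed

text \<open>Dominated convergence: pointwise convergence fails at most where
  \<open>x + k * t\<close> is a discontinuity of \<open>r\<close>, which concerns finitely many
  \<open>x\<close>. This makes even the jumping second derivative continuous in time with values in
  \<open>L2\<close>.\<close>

lemma loc_bdd_translate_tendsto:
  assumes ab: "a < b" and r: "loc_bdd r" and F: "finite F" "\<And>x. x \<notin> F \<Longrightarrow> isCont r x"
    and \<tau>: "\<And>n. \<tau> n \<in> {0..T}" "t \<in> {0..T}" "\<tau> \<longlonglongrightarrow> t"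
  shows "(\<lambda>n. (LINT x|lebesgue_on {a<..<b}. (r (x + k * t) - r (x + k * \<tau> n))\<^sup>2)) \<longlonglongrightarrow> 0"
proof -
  obtain B where B: "\<And>x t. x \<in> {a<..<b} \<Longrightarrow> t \<in> {0..T} \<Longrightarrow> \<bar>r (x + k * t)\<bar> \<le> B"
    using loc_bdd_translate_bound[OF r, of a b T k] by blast
  show ?thesis
  proof (rule L2_tendsto_0[OF ab])
    show "(\<lambda>x. r (x + k * t) - r (x + k * \<tau> n)) \<in> borel_measurable (lebesgue_on {a<..<b})" for n
      by (intro borel_measurable_diff loc_bdd_translate_measurable r)
    show "\<bar>r (x + k * t) - r (x + k * \<tau> n)\<bar> \<le> B + B" if "x \<in> {a<..<b}" for n x
      by (rule order_trans[OF abs_triangle_ineq4 add_mono[OF B[OF that \<tau>(2)] B[OF that \<tau>(1)]]])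
    have "finite ((\<lambda>y. y - k * t) ` F)" using F(1) by simp
    then have "AE x in lebesgue_on {a<..<b}. x \<notin> (\<lambda>y. y - k * t) ` F"
      by (rule AE_notin_finite) simp
    then show "AE x in lebesgue_on {a<..<b}. (\<lambda>n. r (x + k * t) - r (x + k * \<tau> n)) \<longlonglongrightarrow> 0"
    proof (rule eventually_mono)
      fix x assume "x \<notin> (\<lambda>y. y - k * t) ` F"
      then have "x + k * t \<notin> F" by (auto simp: image_iff)
      then have "isCont r (x + k * t)" by (rule F(2))
      moreover have "(\<lambda>n. x + k * \<tau> n) \<longlonglongrightarrow> x + k * t" by (intro tendsto_intros \<tau>)
      ultimately have "(\<lambda>n. r (x + k * \<tau> n)) \<longlonglongrightarrow> r (x + k * t)" by (rule isCont_tendsto_compose)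
      then show "(\<lambda>n. r (x + k * t) - r (x + k * \<tau> n)) \<longlonglongrightarrow> 0"
        using tendsto_diff[OF tendsto_const[of "r (x + k * t)"]] by fastforce
    qed
  qed
qed

section \<open>Curves that are continuous in norm as elements of Bochner spaces\<close>

lemma strongly_measurable_if_continuous:
  assumes T: "T > 0" and X: "\<And>t. t \<in> {0<..<T} \<Longrightarrow> u t \<in> X"
    and c: "\<And>t \<tau>. t \<in> {0<..<T} \<Longrightarrow> (\<And>n. \<tau> n \<in> {0<..<T}) \<Longrightarrow> \<tau> \<longlonglongrightarrow> t \<Longrightarrow>
        (\<lambda>n. N (\<lambda>x. u t x - u (\<tau> n) x)) \<longlonglongrightarrow> 0"
  shows "strongly_measurable T X N u"
proof -
  \<comment> \<open>The midpoint of the cell containing \<open>t\<close> in a partition of the time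
    interval into \<open>Suc n\<close> equal cells. Sampling the curve there gives the simple
    functions; the offset \<open>1/2\<close> keeps all samples inside the open interval, where the
    hypotheses apply.\<close>
  define \<tau> where "\<tau> n t = T * (real_of_int \<lfloor>real (Suc n) * t / T\<rfloor> + 1/2) / real (Suc n)" for n t
  have fl: "0 \<le> \<lfloor>real (Suc n) * t / T\<rfloor>" "\<lfloor>real (Suc n) * t / T\<rfloor> \<le> int n" if "t \<in> {0<..<T}" for n t
  proof -
    show "0 \<le> \<lfloor>real (Suc n) * t / T\<rfloor>" using that T by simp
    have "real (Suc n) * t / T < real (Suc n)" using that T by (simp add: divide_less_eq)
    then have "real_of_int \<lfloor>real (Suc n) * t / T\<rfloor> < real_of_int (int (Suc n))" by linarith
    then show "\<lfloor>real (Suc n) * t / T\<rfloor> \<le> int n" by linarith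
  qed
  have r: "\<tau> n t \<in> {0<..<T}" if t: "t \<in> {0<..<T}" for n t
  proof -
    have "0 \<le> real_of_int \<lfloor>real (Suc n) * t / T\<rfloor>" "real_of_int \<lfloor>real (Suc n) * t / T\<rfloor> \<le> real n"
      using fl[OF t, of n] by linarith+
    then have "0 < real_of_int \<lfloor>real (Suc n) * t / T\<rfloor> + 1/2" "real_of_int \<lfloor>real (Suc n) * t / T\<rfloor> + 1/2 < real (Suc n)"
      by linarith+
    then show ?thesis using T unfolding \<tau>_def greaterThanLessThan_iff
      by (intro conjI divide_pos_pos mult_pos_pos) (auto simp: divide_less_eq)
  qed
  have lim: "(\<lambda>n. \<tau> n t) \<longlonglongrightarrow> t" for t
  proof (rule LIMSEQ_I)
    fix e :: real assume e: "e > 0"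
    obtain M where M: "real M > T / e" using reals_Archimedean2 by blast
    have "norm (\<tau> n t - t) < e" if "n \<ge> M" for n
    proof -
      define z where "z = real (Suc n) * t / T"
      have z: "T / real (Suc n) * z = t" using T by (simp add: z_def)
      have "\<tau> n t - t = T / real (Suc n) * (real_of_int \<lfloor>z\<rfloor> + 1/2) - T / real (Suc n) * z"
        unfolding z \<tau>_def z_def[symmetric] by simp
      then have "\<tau> n t - t = T / real (Suc n) * (real_of_int \<lfloor>z\<rfloor> + 1/2 - z)"
        by (simp only: right_diff_distrib)
      moreover have "\<bar>real_of_int \<lfloor>z\<rfloor> + 1/2 - z\<bar> \<le> 1" by linarith
      ultimately have "\<bar>\<tau> n t - t\<bar> \<le> T / real (Suc n) * 1"
        using T by (simp only: abs_mult) (intro mult_mono, auto)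
      also have "\<dots> < e"
      proof -
        have "T / e < real (Suc n)" using M that by linarith
        then show ?thesis using e T by (simp add: field_simps)
      qed
      finally show ?thesis by simp
    qed
    then show "\<exists>no. \<forall>n\<ge>no. norm (\<tau> n t - t) < e" by blast
  qed
  have sf: "simple_function (lebesgue_on {0<..<T}) (\<tau> n)" for n
  proof (rule simple_function_borel_measurable)
    have "\<tau> n \<in> borel_measurable borel" unfolding \<tau>_def by measurable
    then show "\<tau> n \<in> borel_measurable (lebesgue_on {0<..<T})"
      by (simp add: measurable_completion measurable_restrict_space1)
    have "\<tau> n ` space (lebesgue_on {0<..<T}) \<subseteq> (\<lambda>j. T * (real_of_int j + 1/2) / real (Suc n)) ` {0..int n}"
      using fl unfolding \<tau>_def by (auto simp: space_restrict_space intro!: imageI simp del: of_nat_Suc)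
    then show "finite (\<tau> n ` space (lebesgue_on {0<..<T}))" by (rule finite_subset) simp
  qed
  show ?thesis unfolding strongly_measurable_def
  proof (intro exI[of _ "\<lambda>n t. u (\<tau> n t)"] conjI allI ballI)
    show "simple_function (lebesgue_on {0<..<T}) (\<lambda>t. u (\<tau> n t))" for n
      using simple_function_compose[OF sf[of n], of u] by (simp add: comp_def)
    show "u (\<tau> n t) \<in> X" if "t \<in> {0<..<T}" for n t using X r that by blast
    show "AE t in lebesgue_on {0<..<T}. (\<lambda>n. N (\<lambda>x. u t x - u (\<tau> n t) x)) \<longlonglongrightarrow> 0"
      by (rule AE_I2) (use c r lim in \<open>auto simp: space_restrict_space\<close>)
  qed
qed

lemma bochner_L2_if_continuous:
  assumes T: "T > 0" and X: "\<And>t. t \<in> {0<..<T} \<Longrightarrow> u t \<in> X"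
    and c: "\<And>t \<tau>. t \<in> {0<..<T} \<Longrightarrow> (\<And>n. \<tau> n \<in> {0<..<T}) \<Longrightarrow> \<tau> \<longlonglongrightarrow> t \<Longrightarrow>
        (\<lambda>n. N (\<lambda>x. u t x - u (\<tau> n) x)) \<longlonglongrightarrow> 0"
    and B: "\<And>t. t \<in> {0<..<T} \<Longrightarrow> (N (u t))\<^sup>2 \<le> B"
  shows "u \<in> bochner_L2 T X N"
  unfolding bochner_L2_def mem_Collect_eq
proof (intro conjI)
  show "AE t in lebesgue_on {0<..<T}. u t \<in> X" by (rule AE_I2) (use X in \<open>simp add: space_restrict_space\<close>)
  show "strongly_measurable T X N u" by (rule strongly_measurable_if_continuous[where u = u and X = X and N = N, OF T X c])
  have "(\<integral>\<^sup>+ t. ennreal ((N (u t))\<^sup>2) \<partial>(lebesgue_on {0<..<T})) \<le> (\<integral>\<^sup>+ t. ennreal B \<partial>(lebesgue_on {0<..<T}))"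
    by (rule nn_integral_mono) (use B in \<open>auto simp: space_restrict_space intro: ennreal_leI\<close>)
  also have "\<dots> = ennreal B * emeasure (lebesgue_on {0<..<T}) (space (lebesgue_on {0<..<T}))" by simp
  also have "\<dots> < \<infinity>"
    using finite_measure.finite_emeasure_space[OF measure_lebesgue_on_interval(1)[OF T]]
    by (simp add: ennreal_mult_less_top top.not_eq_extremum)
  finally show "(\<integral>\<^sup>+ t. ennreal ((N (u t))\<^sup>2) \<partial>(lebesgue_on {0<..<T})) < \<infinity>" .
qed


section \<open>Sobolev norms of a moving profile\<close>

context
  fixes \<Phi> \<Phi>' q f :: "real \<Rightarrow> real" and k :: real and F :: "real set"
  assumes d1: "\<And>x. (\<Phi> has_real_derivative \<Phi>' x) (at x)"
    and c1: "continuous_on UNIV \<Phi>'" and F: "finite F"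
    and d2: "\<forall>x. x \<notin> F \<longrightarrow> (\<Phi>' has_real_derivative q x) (at x)"
    and q: "loc_bdd q" "\<forall>x. x \<notin> F \<longrightarrow> isCont q x"
begin

lemma profile_isCont: "isCont \<Phi> x" "isCont \<Phi>' x"
  using d1 DERIV_isCont c1 by (auto simp: continuous_on_eq_continuous_at)

lemma profile_loc_bdd: "loc_bdd \<Phi>" "loc_bdd \<Phi>'"
  using continuous_loc_bdd c1 profile_isCont by (auto simp: continuous_on_eq_continuous_at)

lemma profile_translate_W2:
  "W2 {a<..<b} (\<lambda>x. \<Phi> (x + s)) (\<lambda>x. \<Phi>' (x + s)) (\<lambda>x. q (x + s))"
proof -
  have t: "((\<lambda>x. r (x + s)) has_real_derivative D) (at x)" if "(r has_real_derivative D) (at (x + s))" for r D x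
    using that by (simp add: DERIV_shift)
  have "finite ((\<lambda>y. y - s) ` F)" using F by simp
  moreover have "\<forall>x\<in>{a<..<b} - (\<lambda>y. y - s) ` F. ((\<lambda>x. \<Phi>' (x + s)) has_real_derivative q (x + s)) (at x)"
  proof (intro ballI t d2[rule_format])
    fix x assume "x \<in> {a<..<b} - (\<lambda>y. y - s) ` F"
    then show "x + s \<notin> F" by (auto simp: image_iff)
  qed
  ultimately have "\<exists>G. finite G \<and> (\<forall>x\<in>{a<..<b} - G. ((\<lambda>x. \<Phi>' (x + s)) has_real_derivative q (x + s)) (at x))" by blast
  moreover have "continuous_on {a<..<b} (\<lambda>x. \<Phi> (x + s))" "continuous_on {a<..<b} (\<lambda>x. \<Phi>' (x + s))"
    by (auto intro!: continuous_at_imp_continuous_on isCont_o2[where g = \<Phi>] isCont_o2[where g = \<Phi>'] profile_isCont)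
  ultimately show ?thesis unfolding W2_def
    using loc_bdd_translate_bdd_meas profile_loc_bdd q(1) t d1 by blast
qed

lemma profile_sq_le:
  assumes "a < b" "loc_bdd r"
  shows "\<exists>B. \<forall>t\<in>{0..T}. (LINT x|lebesgue_on {a<..<b}. (r (x + k * t))\<^sup>2) \<le> B"
proof -
  obtain B where "\<forall>x\<in>{a<..<b}. \<forall>t\<in>{0..T}. \<bar>r (x + k * t)\<bar> \<le> B"
    using loc_bdd_translate_bound[OF assms(2), of a b T k] by blast
  then show ?thesis
    by (intro exI[of _ "(b - a) * B\<^sup>2"] ballI integral_sq_le[OF assms(1)] loc_bdd_translate_measurable assms) blast
qed

text \<open>For differences of translates the Sobolev norms are square roots of sums of squared
  \<open>L2\<close> norms of explicit derivatives, and each summand tends to zero by continuity of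
  translation. The last claim serves the time derivative.\<close>

lemma profile_H_norm_tendsto:
  assumes ab: "a < b" and \<tau>: "\<And>n. \<tau> n \<in> {0..T}" "t \<in> {0..T}" "\<tau> \<longlonglongrightarrow> t"
  shows "(\<lambda>n. H_norm 0 {a<..<b} (\<lambda>x. \<Phi> (x + k * t) - \<Phi> (x + k * \<tau> n))) \<longlonglongrightarrow> 0"
    and "(\<lambda>n. H_norm 1 {a<..<b} (\<lambda>x. \<Phi> (x + k * t) - \<Phi> (x + k * \<tau> n))) \<longlonglongrightarrow> 0"
    and "(\<lambda>n. H_norm 2 {a<..<b} (\<lambda>x. \<Phi> (x + k * t) - \<Phi> (x + k * \<tau> n))) \<longlonglongrightarrow> 0"
    and "(\<lambda>n. H_norm 0 {a<..<b} (\<lambda>x. k * \<Phi>' (x + k * t) - k * \<Phi>' (x + k * \<tau> n))) \<longlonglongrightarrow> 0"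
proof -
  let ?D = "\<lambda>n x. \<Phi> (x + k * t) - \<Phi> (x + k * \<tau> n)" and ?D' = "\<lambda>n x. k * \<Phi>' (x + k * t) - k * \<Phi>' (x + k * \<tau> n)"
  note T = loc_bdd_translate_tendsto[OF ab _ F _ \<tau>, of _ k]
  have 0: "(\<lambda>n. (LINT x|lebesgue_on {a<..<b}. (\<Phi> (x + k * t) - \<Phi> (x + k * \<tau> n))\<^sup>2)) \<longlonglongrightarrow> 0"
    by (rule T) (use profile_loc_bdd profile_isCont in auto)
  have 1: "(\<lambda>n. (LINT x|lebesgue_on {a<..<b}. (\<Phi>' (x + k * t) - \<Phi>' (x + k * \<tau> n))\<^sup>2)) \<longlonglongrightarrow> 0"
    by (rule T) (use profile_loc_bdd profile_isCont in auto)
  have 2: "(\<lambda>n. (LINT x|lebesgue_on {a<..<b}. (q (x + k * t) - q (x + k * \<tau> n))\<^sup>2)) \<longlonglongrightarrow> 0"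
    by (rule T) (use q in auto)
  have 3: "(\<lambda>n. (LINT x|lebesgue_on {a<..<b}. (k * \<Phi>' (x + k * t) - k * \<Phi>' (x + k * \<tau> n))\<^sup>2)) \<longlonglongrightarrow> 0"
  proof (rule T[of "\<lambda>x. k * \<Phi>' x"])
    show "loc_bdd (\<lambda>x. k * \<Phi>' x)" by (intro continuous_loc_bdd continuous_intros c1)
  qed (use profile_isCont in auto)
  note W = W2_diff[OF profile_translate_W2 profile_translate_W2]
  note s = tendsto_real_sqrt[where x = 0, simplified]
  show "(\<lambda>n. H_norm 0 {a<..<b} (?D n)) \<longlonglongrightarrow> 0"
    unfolding H_norm_0 using s[OF 0] .
  show "(\<lambda>n. H_norm 0 {a<..<b} (?D' n)) \<longlonglongrightarrow> 0"
    unfolding H_norm_0 using s[OF 3] .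
  show "(\<lambda>n. H_norm 1 {a<..<b} (?D n)) \<longlonglongrightarrow> 0"
    unfolding W2_H_norm(1)[OF ab refl W] using s[OF tendsto_add_zero[OF 0 1]] .
  show "(\<lambda>n. H_norm 2 {a<..<b} (?D n)) \<longlonglongrightarrow> 0"
    unfolding W2_H_norm(2)[OF ab refl W] using s[OF tendsto_add_zero[OF tendsto_add_zero[OF 0 1] 2]] .
qed

lemma profile_H: "a < b \<Longrightarrow> (\<lambda>x. \<Phi> (x + s)) \<in> H 0 {a<..<b}"
  "a < b \<Longrightarrow> (\<lambda>x. \<Phi> (x + s)) \<in> H 1 {a<..<b}"
  "a < b \<Longrightarrow> (\<lambda>x. \<Phi> (x + s)) \<in> H 2 {a<..<b}"
  using W2_H[OF _ refl profile_translate_W2] by blast+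

lemma profile_H_bochner:
  assumes T: "T > 0" and ab: "a < b"
  shows "(\<lambda>t x. \<Phi> (x + k * t)) \<in> bochner_L2 T (H 0 {a<..<b}) (H_norm 0 {a<..<b})"
    and "(\<lambda>t x. \<Phi> (x + k * t)) \<in> bochner_L2 T (H 2 {a<..<b}) (H_norm 2 {a<..<b})"
    and "(\<lambda>t x. k * \<Phi>' (x + k * t)) \<in> bochner_L2 T (H 0 {a<..<b}) (H_norm 0 {a<..<b})"
proof -
  have k1: "loc_bdd (\<lambda>x. k * \<Phi>' x)" by (intro continuous_loc_bdd continuous_intros c1)
  obtain B0 where B0: "\<forall>t\<in>{0..T}. (LINT x|lebesgue_on {a<..<b}. (\<Phi> (x + k * t))\<^sup>2) \<le> B0"
    using profile_sq_le[OF ab profile_loc_bdd(1)] by blast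
  obtain B1 where B1: "\<forall>t\<in>{0..T}. (LINT x|lebesgue_on {a<..<b}. (\<Phi>' (x + k * t))\<^sup>2) \<le> B1"
    using profile_sq_le[OF ab profile_loc_bdd(2)] by blast
  obtain B2 where B2: "\<forall>t\<in>{0..T}. (LINT x|lebesgue_on {a<..<b}. (q (x + k * t))\<^sup>2) \<le> B2"
    using profile_sq_le[OF ab q(1)] by blast
  obtain B3 where B3: "\<forall>t\<in>{0..T}. (LINT x|lebesgue_on {a<..<b}. (k * \<Phi>' (x + k * t))\<^sup>2) \<le> B3"
    using profile_sq_le[OF ab k1] by blast
  have sq: "(sqrt x)\<^sup>2 = x" if "x \<ge> 0" for x using that by simp
  have nn: "(LINT x|lebesgue_on {a<..<b}. (r x)\<^sup>2) \<ge> 0" for r :: "real \<Rightarrow> real" by simp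
  show "(\<lambda>t x. \<Phi> (x + k * t)) \<in> bochner_L2 T (H 0 {a<..<b}) (H_norm 0 {a<..<b})"
  proof (rule bochner_L2_if_continuous[OF T profile_H(1)[OF ab]])
    show "(\<lambda>n. H_norm 0 {a<..<b} (\<lambda>x. \<Phi> (x + k * t) - \<Phi> (x + k * \<tau> n))) \<longlonglongrightarrow> 0"
      if "t \<in> {0<..<T}" "\<And>n. \<tau> n \<in> {0<..<T}" "\<tau> \<longlonglongrightarrow> t" for t \<tau>
      by (rule profile_H_norm_tendsto[where T = T, OF ab]) (use that in \<open>auto simp: less_imp_le\<close>)
    show "(H_norm 0 {a<..<b} (\<lambda>x. \<Phi> (x + k * t)))\<^sup>2 \<le> B0" if "t \<in> {0<..<T}" for t
      unfolding H_norm_0 sq[OF nn] using B0 that by simp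
  qed
  show "(\<lambda>t x. \<Phi> (x + k * t)) \<in> bochner_L2 T (H 2 {a<..<b}) (H_norm 2 {a<..<b})"
  proof (rule bochner_L2_if_continuous[OF T profile_H(3)[OF ab]])
    show "(\<lambda>n. H_norm 2 {a<..<b} (\<lambda>x. \<Phi> (x + k * t) - \<Phi> (x + k * \<tau> n))) \<longlonglongrightarrow> 0"
      if "t \<in> {0<..<T}" "\<And>n. \<tau> n \<in> {0<..<T}" "\<tau> \<longlonglongrightarrow> t" for t \<tau>
      by (rule profile_H_norm_tendsto[where T = T, OF ab]) (use that in \<open>auto simp: less_imp_le\<close>)
    show "(H_norm 2 {a<..<b} (\<lambda>x. \<Phi> (x + k * t)))\<^sup>2 \<le> B0 + B1 + B2" if "t \<in> {0<..<T}" for t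
      unfolding W2_H_norm(2)[OF ab refl profile_translate_W2] sq[OF add_nonneg_nonneg[OF add_nonneg_nonneg[OF nn nn] nn]]
      using B0 B1 B2 that by (intro add_mono) simp_all
  qed
  show "(\<lambda>t x. k * \<Phi>' (x + k * t)) \<in> bochner_L2 T (H 0 {a<..<b}) (H_norm 0 {a<..<b})"
  proof (rule bochner_L2_if_continuous[OF T])
    show "(\<lambda>x. k * \<Phi>' (x + k * t)) \<in> H 0 {a<..<b}" for t
      using bdd_meas_L2[OF ab loc_bdd_translate_bdd_meas[OF k1]] by (simp add: H_def)
    show "(\<lambda>n. H_norm 0 {a<..<b} (\<lambda>x. k * \<Phi>' (x + k * t) - k * \<Phi>' (x + k * \<tau> n))) \<longlonglongrightarrow> 0"
      if "t \<in> {0<..<T}" "\<And>n. \<tau> n \<in> {0<..<T}" "\<tau> \<longlonglongrightarrow> t" for t \<tau>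
      by (rule profile_H_norm_tendsto[where T = T, OF ab]) (use that in \<open>auto simp: less_imp_le\<close>)
    show "(H_norm 0 {a<..<b} (\<lambda>x. k * \<Phi>' (x + k * t)))\<^sup>2 \<le> B3" if "t \<in> {0<..<T}" for t
      unfolding H_norm_0 sq[OF nn] using B3 that by simp
  qed
qed

end

section \<open>Bounded linear functionals on function spaces\<close>

lemma dual_space_add: "l \<in> dual_space X N \<Longrightarrow> v \<in> X \<Longrightarrow> w \<in> X \<Longrightarrow> l (\<lambda>x. v x + w x) = l v + l w"
  by (simp add: dual_space_def)

lemma dual_space_scale: "l \<in> dual_space X N \<Longrightarrow> v \<in> X \<Longrightarrow> l (\<lambda>x. r * v x) = r * l v"
  by (simp add: dual_space_def)

lemma dual_space_diff:
  assumes "l \<in> dual_space X N" "w \<in> X" "(\<lambda>x. v x - w x) \<in> X"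
  shows "l v - l w = l (\<lambda>x. v x - w x)"
  using dual_space_add[OF assms(1,3,2)] by simp

lemma dual_space_tendsto:
  assumes l: "l \<in> dual_space X N" and X: "\<And>n. w n \<in> X" and lim: "(\<lambda>n. N (w n)) \<longlonglongrightarrow> 0"
  shows "(\<lambda>n. l (w n)) \<longlonglongrightarrow> 0"
proof -
  obtain C where C: "\<forall>v\<in>X. \<bar>l v\<bar> \<le> C * N v" using l by (auto simp: dual_space_def)
  have "(\<lambda>n. C * N (w n)) \<longlonglongrightarrow> 0" using tendsto_mult_right_zero[OF lim] by simp
  then show ?thesis by (rule Lim_null_comparison[rotated]) (use C X in simp)
qed


lemma continuous_onI_sequentially_real:
  fixes h :: "real \<Rightarrow> real"
  assumes "\<And>t \<tau>. t \<in> S \<Longrightarrow> (\<And>n. \<tau> n \<in> S) \<Longrightarrow> \<tau> \<longlonglongrightarrow> t \<Longrightarrow> (\<lambda>n. h t - h (\<tau> n)) \<longlonglongrightarrow> 0"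
  shows "continuous_on S h"
  unfolding continuous_on_sequentially comp_def
proof (intro ballI allI impI, elim conjE)
  fix \<tau> t assume "t \<in> S" "\<forall>n. \<tau> n \<in> S" "\<tau> \<longlonglongrightarrow> t"
  then have "(\<lambda>n. h t - h (\<tau> n)) \<longlonglongrightarrow> 0" using assms by blast
  from tendsto_diff[OF tendsto_const[of "h t"] this] show "(\<lambda>n. h (\<tau> n)) \<longlonglongrightarrow> h t" by simp
qed

text \<open>For a moving profile the time derivative is \<open>k * \<Phi>' (x + k * t)\<close>, so
  the evolution equation reduces to the profile equation \<open>eq\<close>. In the weak time
  derivative each functional \<open>l\<close> turns the curve into a scalar function of
  \<open>t\<close> that is differentiable in the classical sense; the one-dimensional criterion for
  weak derivatives then applies in time.\<close>

lemma solution_translate: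
  fixes \<Phi> \<Phi>' q f :: "real \<Rightarrow> real" and k :: real
  assumes d1: "\<And>x. (\<Phi> has_real_derivative \<Phi>' x) (at x)"
    and c1: "continuous_on UNIV \<Phi>'" and F: "finite F"
    and d2: "\<forall>x. x \<notin> F \<longrightarrow> (\<Phi>' has_real_derivative q x) (at x)"
    and q: "loc_bdd q" "\<forall>x. x \<notin> F \<longrightarrow> isCont q x"
    and eq: "\<And>x. x \<notin> F \<Longrightarrow> k * \<Phi>' x = max (q x - f (\<Phi> x)) 0"
  shows "solution f (\<lambda>t x. \<Phi> (x + k * t))"
  unfolding solution_def Let_def
proof (intro allI impI conjI)
  fix T a b :: real assume T: "T > 0" and ab: "a < b"
  let ?I = "{a<..<b}" and ?u = "\<lambda>t x. \<Phi> (x + k * t)" and ?v = "\<lambda>t x. k * \<Phi>' (x + k * t)"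
  note D = d1 c1 F d2 q
  note W = profile_translate_W2[OF D]
  note tt = profile_H_norm_tendsto[OF D]
  show "?u \<in> bochner_L2 T (H 2 ?I) (H_norm 2 ?I)" "?u \<in> bochner_L2 T (H 0 ?I) (H_norm 0 ?I)"
    using profile_H_bochner[OF D T ab] by auto
  show "?u \<in> weakly_continuous T (H 1 ?I) (H_norm 1 ?I)"
    unfolding weakly_continuous_def mem_Collect_eq
  proof (intro conjI ballI continuous_onI_sequentially_real)
    show "?u t \<in> H 1 ?I" for t by (rule profile_H(2)[OF D ab])
    fix l t \<tau> assume l: "l \<in> dual_space (H 1 ?I) (H_norm 1 ?I)"
      and t: "t \<in> {0..T}" "\<And>n. \<tau> n \<in> {0..T}" "\<tau> \<longlonglongrightarrow> t"
    have X: "(\<lambda>x. \<Phi> (x + k * t) - \<Phi> (x + k * \<tau> n)) \<in> H 1 ?I" for n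
      by (rule W2_H(2)[OF ab refl W2_diff[OF W W]])
    have "l (?u t) - l (?u (\<tau> n)) = l (\<lambda>x. \<Phi> (x + k * t) - \<Phi> (x + k * \<tau> n))" for n
      by (rule dual_space_diff[OF l profile_H(2)[OF D ab] X])
    moreover have "(\<lambda>n. l (\<lambda>x. \<Phi> (x + k * t) - \<Phi> (x + k * \<tau> n))) \<longlonglongrightarrow> 0"
      by (rule dual_space_tendsto[where w = "\<lambda>n x. \<Phi> (x + k * t) - \<Phi> (x + k * \<tau> n)", OF l X])
        (rule tt(2)[OF ab t(2,1,3)])
    ultimately show "(\<lambda>n. l (?u t) - l (?u (\<tau> n))) \<longlonglongrightarrow> 0" by simp
  qed
  have k1: "loc_bdd (\<lambda>x. k * \<Phi>' x)" by (intro continuous_loc_bdd continuous_intros c1)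
  have bu: "bdd_meas ?I (?u t)" and bv: "bdd_meas ?I (?v t)" for t
    using loc_bdd_translate_bdd_meas profile_loc_bdd[OF D] k1 by auto
  have H0: "w \<in> H 0 ?I" if "bdd_meas ?I w" for w
    using bdd_meas_L2[OF ab that] by (simp add: H_def)
  show "\<exists>v\<in>bochner_L2 T (H 0 ?I) (H_norm 0 ?I). has_weak_time_deriv T (H 0 ?I) (H_norm 0 ?I) ?u v \<and>
      (AE t in lebesgue_on {0<..<T}. AE x in lebesgue_on ?I.
         v t x = max (weak_deriv ?I (weak_deriv ?I (?u t)) x - f (?u t x)) 0)"
  proof (intro bexI[of _ ?v] conjI)
    show "?v \<in> bochner_L2 T (H 0 ?I) (H_norm 0 ?I)" using profile_H_bochner[OF D T ab] by auto
    show "AE t in lebesgue_on {0<..<T}. AE x in lebesgue_on ?I.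
         ?v t x = max (weak_deriv ?I (weak_deriv ?I (?u t)) x - f (?u t x)) 0"
    proof (rule AE_I2)
      fix t
      have "AE x in lebesgue_on ?I. weak_deriv ?I (weak_deriv ?I (?u t)) x = q (x + k * t)"
        using W2_weak_deriv2[OF ab refl W] by (subst AE_lebesgue_on_open_iff) auto
      moreover have "AE x in lebesgue_on ?I. x \<notin> (\<lambda>y. y - k * t) ` F"
        by (rule AE_notin_finite) (use F in auto)
      ultimately show "AE x in lebesgue_on ?I. ?v t x = max (weak_deriv ?I (weak_deriv ?I (?u t)) x - f (?u t x)) 0"
      proof eventually_elim
        case (elim x)
        then have "x + k * t \<notin> F" by (auto simp: image_iff)
        from eq[OF this] elim show ?case by simp
      qed
    qed
    show "has_weak_time_deriv T (H 0 ?I) (H_norm 0 ?I) ?u ?v"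
      unfolding has_weak_time_deriv_def
    proof (intro allI impI ballI)
      fix \<psi> l assume t: "test_function {0<..<T} \<psi>" and l: "l \<in> dual_space (H 0 ?I) (H_norm 0 ?I)"
      have "has_weak_deriv {0<..<T} (\<lambda>t. l (?u t)) (\<lambda>t. l (?v t))"
      proof (rule has_weak_derivI[of _ "{}"])
        have d: "((\<lambda>t. l (?u t)) has_real_derivative l (?v t)) (at t)" if t: "t \<in> {0<..<T}" for t
          unfolding DERIV_def tendsto_at_iff_sequentially comp_def
        proof (intro allI impI)
          fix h assume h: "\<forall>i. h i \<in> UNIV - {0::real}" "h \<longlonglongrightarrow> 0"
          let ?d = "\<lambda>n x. \<Phi> (x + k * (t + h n)) - \<Phi> (x + k * t)"
          \<comment> \<open>The error of the difference quotient in time. It tends to zero pointwise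
            and is bounded uniformly in \<open>n\<close>, hence it tends to zero in
            \<open>L2\<close>, where \<open>l\<close> is continuous.\<close>
          define w where "w n x = inverse (h n) * ?d n x - k * \<Phi>' (x + k * t)" for n x
          have bw1: "bdd_meas ?I (\<lambda>x. inverse (h n) * ?d n x)" for n
          proof -
            have "bdd_meas ?I (\<lambda>x. inverse (h n) * \<Phi> (x + k * (t + h n)))" for n t
              by (rule loc_bdd_translate_bdd_meas[of "\<lambda>x. inverse (h n) * \<Phi> x"])
                (intro continuous_loc_bdd continuous_intros continuous_at_imp_continuous_on ballI profile_isCont[OF D])
            moreover have "bdd_meas ?I (\<lambda>x. inverse (h n) * \<Phi> (x + k * t))" for n t
              by (rule loc_bdd_translate_bdd_meas[of "\<lambda>x. inverse (h n) * \<Phi> x"])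
                (intro continuous_loc_bdd continuous_intros continuous_at_imp_continuous_on ballI profile_isCont[OF D])
            ultimately show ?thesis unfolding right_diff_distrib by (rule bdd_meas_diff)
          qed
          have bw: "bdd_meas ?I (w n)" for n unfolding w_def by (rule bdd_meas_diff[OF bw1 bv])
          have "(l (?u (t + h n)) - l (?u t)) / h n - l (?v t) = l (w n)" for n
          proof -
            have "l (?u (t + h n)) - l (?u t) = l (?d n)"
              by (rule dual_space_diff[OF l H0[OF bu] H0[OF bdd_meas_diff[OF bu bu]]])
            then have "(l (?u (t + h n)) - l (?u t)) / h n = l (\<lambda>x. inverse (h n) * ?d n x)"
              using dual_space_scale[OF l H0[OF bdd_meas_diff[OF bu[of "t + h n"] bu[of t]]], of "inverse (h n)"]
              by (simp add: field_simps)
            then show ?thesis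
              using dual_space_diff[OF l H0[OF bv[of t]], of "\<lambda>x. inverse (h n) * ?d n x"]
                H0[OF bw[of n]] by (simp add: w_def[abs_def])
          qed
          moreover have "(\<lambda>n. l (w n)) \<longlonglongrightarrow> 0"
          proof (rule dual_space_tendsto[where w = w, OF l H0[OF bw]])
            have "bounded (range h)" using h(2) convergent_imp_bounded by blast
            then obtain R where R: "\<And>n. \<bar>h n\<bar> \<le> R" unfolding bounded_iff by auto
            obtain B where B: "\<forall>y\<in>{a + k * t - \<bar>k\<bar> * R..b + k * t + \<bar>k\<bar> * R}. \<bar>\<Phi>' y\<bar> \<le> B"
              using profile_loc_bdd(2)[OF D] unfolding loc_bdd_def bounded_iff by (metis imageI real_norm_def)
            \<comment> \<open>By the mean value inequality the quotient is at most
              \<open>\<bar>k\<bar> * B\<close>, where \<open>B\<close> bounds \<Phi>' on a window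
              containing all arguments reached by steps of size at most \<open>R\<close>.\<close>
            have wb: "\<bar>w n x\<bar> \<le> \<bar>k\<bar> * B + \<bar>k\<bar> * B" if x: "x \<in> ?I" for n x
            proof -
              have hn: "h n \<noteq> 0" using h(1) by auto
              have kR: "\<bar>k * h n\<bar> \<le> \<bar>k\<bar> * R" using R by (simp add: abs_mult mult_left_mono)
              have R0: "0 \<le> \<bar>k\<bar> * R" using kR by linarith
              have in1: "y \<in> {a + k * t - \<bar>k\<bar> * R..b + k * t + \<bar>k\<bar> * R}" if "\<bar>y - (x + k * t)\<bar> \<le> \<bar>k * h n\<bar>" for y
                using that kR x by auto
              have "norm (\<Phi> (x + k * t + k * h n) - \<Phi> (x + k * t)) \<le> B * norm (x + k * t + k * h n - (x + k * t))"
              proof (rule field_differentiable_bound[of "closed_segment (x + k * t) (x + k * t + k * h n)"])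
                show "(\<Phi> has_real_derivative \<Phi>' y) (at y within closed_segment (x + k * t) (x + k * t + k * h n))" for y
                  using d1 by (rule has_field_derivative_at_within)
                show "norm (\<Phi>' y) \<le> B" if "y \<in> closed_segment (x + k * t) (x + k * t + k * h n)" for y
                proof -
                  have "\<bar>y - (x + k * t)\<bar> \<le> \<bar>k * h n\<bar>" using that by (auto simp: closed_segment_eq_real_ivl split: if_splits)
                  then show ?thesis using B in1 by simp
                qed
              qed auto
              then have "\<bar>\<Phi> (x + k * (t + h n)) - \<Phi> (x + k * t)\<bar> \<le> B * \<bar>k * h n\<bar>"
                by (simp add: algebra_simps)
              then have "\<bar>inverse (h n) * ?d n x\<bar> \<le> \<bar>inverse (h n)\<bar> * (B * \<bar>k * h n\<bar>)"
                unfolding abs_mult[of "inverse (h n)"] by (intro mult_left_mono) auto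
              also have "\<dots> = \<bar>k\<bar> * B" using hn by (simp add: abs_mult field_simps)
              finally have 1: "\<bar>inverse (h n) * ?d n x\<bar> \<le> \<bar>k\<bar> * B" .
              have "\<bar>\<Phi>' (x + k * t)\<bar> \<le> B" using B in1[of "x + k * t"] by simp
              then have 2: "\<bar>k * \<Phi>' (x + k * t)\<bar> \<le> \<bar>k\<bar> * B" by (simp add: abs_mult mult_left_mono)
              show ?thesis unfolding w_def by (rule order_trans[OF abs_triangle_ineq4 add_mono[OF 1 2]])
            qed
            have wl: "(\<lambda>n. w n x) \<longlonglongrightarrow> 0" for x
            proof -
              have "((\<lambda>s. x + k * s) has_real_derivative k) (at t)" by (auto intro!: derivative_eq_intros)
              from DERIV_chain2[OF d1 this]
              have "((\<lambda>s. \<Phi> (x + k * s)) has_real_derivative \<Phi>' (x + k * t) * k) (at t)" .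
              then have "(\<lambda>n. ?d n x / h n) \<longlonglongrightarrow> \<Phi>' (x + k * t) * k"
                unfolding DERIV_def tendsto_at_iff_sequentially comp_def using h by blast
              from tendsto_diff[OF this tendsto_const[of "\<Phi>' (x + k * t) * k"]]
              show ?thesis by (simp add: w_def field_simps)
            qed
            have "(\<lambda>n. (LINT x|lebesgue_on ?I. (w n x)\<^sup>2)) \<longlonglongrightarrow> 0"
              by (rule L2_tendsto_0[OF ab _ wb]) (use bw wl in \<open>auto simp: bdd_meas_def\<close>)
            from tendsto_real_sqrt[OF this] show "(\<lambda>n. H_norm 0 ?I (w n)) \<longlonglongrightarrow> 0"
              by (simp add: H_norm_0)
          qed
          ultimately have "(\<lambda>n. (l (?u (t + h n)) - l (?u t)) / h n - l (?v t)) \<longlonglongrightarrow> 0" by simp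
          then show "(\<lambda>n. (l (?u (t + h n)) - l (?u t)) / h n) \<longlonglongrightarrow> l (?v t)"
            by (simp add: LIM_zero_iff)
        qed
        then show "\<And>t. t \<in> {0<..<T} \<Longrightarrow> t \<notin> {} \<Longrightarrow> ((\<lambda>t. l (?u t)) has_real_derivative l (?v t)) (at t)" by simp
        show "continuous_on {0<..<T} (\<lambda>t. l (?u t))"
          using d DERIV_isCont by (intro continuous_at_imp_continuous_on) blast
        show "locally_integrable {0<..<T} (\<lambda>t. l (?v t))"
        proof (intro locally_integrable_continuous continuous_onI_sequentially_real)
          fix t \<tau> assume t: "t \<in> {0<..<T}" "\<And>n. \<tau> n \<in> {0<..<T}" "\<tau> \<longlonglongrightarrow> t"
          have X: "(\<lambda>x. k * \<Phi>' (x + k * t) - k * \<Phi>' (x + k * \<tau> n)) \<in> H 0 ?I" for n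
            by (rule H0[OF bdd_meas_diff[OF bv bv]])
          have "l (?v t) - l (?v (\<tau> n)) = l (\<lambda>x. k * \<Phi>' (x + k * t) - k * \<Phi>' (x + k * \<tau> n))" for n
            by (rule dual_space_diff[OF l H0[OF bv] X])
          moreover have "(\<lambda>n. l (\<lambda>x. k * \<Phi>' (x + k * t) - k * \<Phi>' (x + k * \<tau> n))) \<longlonglongrightarrow> 0"
            by (rule dual_space_tendsto[where w = "\<lambda>n x. k * \<Phi>' (x + k * t) - k * \<Phi>' (x + k * \<tau> n)", OF l X],
                rule tt(4)[where T = T, OF ab])
              (use t in \<open>auto simp: less_imp_le\<close>)
          ultimately show "(\<lambda>n. l (?v t) - l (?v (\<tau> n))) \<longlonglongrightarrow> 0" by simp
        qed
      qed simp_all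
      then show "(LINT t|lebesgue_on {0<..<T}. deriv \<psi> t * l (?u t)) = - (LINT t|lebesgue_on {0<..<T}. \<psi> t * l (?v t))"
        using t unfolding has_weak_deriv_def by (simp add: mult.commute)
    qed
  qed
qed

section \<open>Orbits of the profile equation\<close>

text \<open>Integrating the weight gains the factor \<open>1 / (2 * L)\<close>. With
  \<open>C\<close> equal to \<open>L\<close> times a distance, this is where the contraction
  constant \<open>1/2\<close> comes from.\<close>

lemma norm_integral_exp_bound:
  fixes h :: "real \<Rightarrow> 'a::banach"
  assumes h: "continuous_on {0..} h" and C: "\<And>s. s \<ge> 0 \<Longrightarrow> norm (h s) \<le> C * exp (2 * L * s)"
    and L: "L > 0" and x: "x \<ge> 0"
  shows "norm (integral {0..x} h) \<le> C / (2 * L) * exp (2 * L * x)"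
proof -
  have C0: "C \<ge> 0" using C[of 0] norm_ge_zero[of "h 0"] by (simp del: norm_ge_zero)
  have "((\<lambda>s. C / (2 * L) * exp (2 * L * s)) has_real_derivative C * exp (2 * L * s)) (at s)" for s
    using L by (auto intro!: derivative_eq_intros simp: field_simps)
  then have I: "((\<lambda>s. C * exp (2 * L * s)) has_integral (C / (2 * L) * exp (2 * L * x) - C / (2 * L) * exp (2 * L * 0))) {0..x}"
    using x by (intro fundamental_theorem_of_calculus)
      (auto simp: has_real_derivative_iff_has_vector_derivative[symmetric] intro: has_field_derivative_at_within)
  have hc: "continuous_on {0..x} h" by (rule continuous_on_subset[OF h]) auto
  have "norm (integral {0..x} h) \<le> integral {0..x} (\<lambda>s. C * exp (2 * L * s))"
    by (rule integral_norm_bound_integral) (use hc C in \<open>auto intro!: integrable_continuous_real continuous_intros\<close>)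
  also have "\<dots> = C / (2 * L) * exp (2 * L * x) - C / (2 * L)" using integral_unique[OF I] by simp
  also have "\<dots> \<le> C / (2 * L) * exp (2 * L * x)" using C0 L by simp
  finally show ?thesis .
qed

text \<open>The substitution \<open>U x = exp (2 * L * x) *\<^sub>R w x\<close> makes the Picard operator a contraction for the
  supremum norm on the whole half-line.\<close>

lemma picard_global:
  fixes F :: "'a::banach \<Rightarrow> 'a"
  assumes lip: "\<And>u v. norm (F u - F v) \<le> L * norm (u - v)" and L: "L > 0"
  obtains U where "U 0 = u0" "continuous_on {0..} U" "\<And>x. x > 0 \<Longrightarrow> (U has_vector_derivative F (U x)) (at x)"
proof -
  have "L-lipschitz_on UNIV F" by (rule lipschitz_onI) (use lip L in \<open>auto simp: dist_norm\<close>)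
  then have Fc: "continuous_on UNIV F" by (rule lipschitz_on_continuous_on)
  have growth: "norm (F u) \<le> norm (F 0) + L * norm u" for u
    using lip[of u 0] norm_triangle_ineq2[of "F u" "F 0"] by simp
  define h where "h w s = F (exp (2 * L * s) *\<^sub>R w s)" for w s
  define J where "J w x = integral {0..x} (h w)" for w x
  \<comment> \<open>With \<open>max 0 x\<close> the operator acts on functions of the whole line, as
    the type of bounded continuous functions requires; to the left of 0 its values are constantly
    \<open>u0\<close>.\<close>
  define G where "G w x = exp (- 2 * L * max 0 x) *\<^sub>R (u0 + J w (max 0 x))" for w x
  have hcont: "continuous_on X (h w)" if "continuous_on UNIV w" for X w
    unfolding h_def using that by (intro continuous_on_compose2[OF Fc] continuous_intros) (auto intro: continuous_on_subset)
  have Jcont: "continuous_on {0..} (J w)" if w: "continuous_on UNIV w" for w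
  proof (subst continuous_on_eq_continuous_within, intro ballI)
    fix x :: real assume "x \<in> {0..}"
    have "continuous_on {0..x+1} (J w)" unfolding J_def
      by (rule indefinite_integral_continuous_1) (intro integrable_continuous_real hcont w)
    then have "continuous (at x within {0..x+1}) (J w)" using \<open>x \<in> {0..}\<close> by (simp add: continuous_on_eq_continuous_within)
    moreover have "at x within {0..x+1} = at x within {0..}"
    proof (rule at_within_nhd[of _ "{..<x+1}"])
    qed auto
    ultimately show "continuous (at x within {0..}) (J w)" by simp
  qed
  have Gcont: "continuous_on UNIV (G w)" if w: "continuous_on UNIV w" for w
    unfolding G_def
    by (intro continuous_intros continuous_on_compose2[OF Jcont[OF w]]) auto
  have hbound: "norm (h w s) \<le> (norm (F 0) + L * B) * exp (2 * L * s)" if "norm (w s) \<le> B" "s \<ge> 0" for w s B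
  proof -
    have e1: "1 \<le> exp (2 * L * s)" using L that by simp
    have "norm (h w s) \<le> norm (F 0) + L * (exp (2 * L * s) * norm (w s))"
      unfolding h_def using growth[of "exp (2 * L * s) *\<^sub>R w s"] by simp
    also have "\<dots> \<le> norm (F 0) * exp (2 * L * s) + L * (exp (2 * L * s) * B)"
      using e1 that L mult_left_mono[OF e1 norm_ge_zero[of "F 0"]] by (intro add_mono mult_left_mono) auto
    finally show ?thesis by (simp add: algebra_simps)
  qed
  have Gbound: "norm (G w x) \<le> norm u0 + (norm (F 0) + L * B) / (2 * L)"
    if w: "continuous_on UNIV w" "\<And>s. norm (w s) \<le> B" for w x B
  proof -
    let ?y = "max 0 x"
    have J: "norm (J w ?y) \<le> (norm (F 0) + L * B) / (2 * L) * exp (2 * L * ?y)"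
      unfolding J_def by (rule norm_integral_exp_bound[OF hcont[OF w(1)] hbound[OF w(2)] L]) auto
    have "norm (G w x) \<le> exp (- 2 * L * ?y) * (norm u0 + norm (J w ?y))"
      unfolding G_def using norm_triangle_ineq[of u0 "J w ?y"] by simp
    also have "\<dots> \<le> exp (- 2 * L * ?y) * (norm u0 + (norm (F 0) + L * B) / (2 * L) * exp (2 * L * ?y))"
      using J by simp
    also have "\<dots> = exp (- 2 * L * ?y) * norm u0 + (norm (F 0) + L * B) / (2 * L) * (exp (- 2 * L * ?y) * exp (2 * L * ?y))"
      by (simp add: algebra_simps)
    also have "exp (- 2 * L * ?y) * exp (2 * L * ?y) = 1" by (simp add: exp_add[symmetric])
    also have "exp (- 2 * L * ?y) * norm u0 \<le> 1 * norm u0"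
      by (rule mult_right_mono) (use L in auto)
    finally show ?thesis by simp
  qed
  define \<T> where "\<T> w = Bcontfun (G (apply_bcontfun w))" for w :: "real \<Rightarrow>\<^sub>C 'a"
  have ap: "apply_bcontfun (\<T> w) = G (apply_bcontfun w)" for w
  proof -
    have "G (apply_bcontfun w) \<in> bcontfun"
      by (rule bcontfun_normI[OF Gcont Gbound[of _ "norm w"]]) (auto simp: norm_bounded)
    then show ?thesis unfolding \<T>_def by (rule Bcontfun_inverse)
  qed
  have contr: "dist (\<T> w) (\<T> w') \<le> 1/2 * dist w w'" for w w'
  proof (rule dist_bound)
    fix x :: real
    let ?y = "max 0 x" and ?w = "apply_bcontfun w" and ?w' = "apply_bcontfun w'"
    have c: "continuous_on UNIV ?w" "continuous_on UNIV ?w'" by auto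
    have hd: "norm (h ?w s - h ?w' s) \<le> (L * dist w w') * exp (2 * L * s)" if "s \<ge> 0" for s
    proof -
      have "norm (h ?w s - h ?w' s) \<le> L * (exp (2 * L * s) * norm (?w s - ?w' s))"
        unfolding h_def using lip[of "exp (2 * L * s) *\<^sub>R ?w s" "exp (2 * L * s) *\<^sub>R ?w' s"]
        by (simp add: scaleR_diff_right[symmetric])
      also have "\<dots> \<le> L * (exp (2 * L * s) * dist w w')"
        using dist_bounded[of w s w'] L by (simp add: dist_norm)
      finally show ?thesis by (simp add: algebra_simps)
    qed
    have "J ?w ?y - J ?w' ?y = integral {0..?y} (\<lambda>s. h ?w s - h ?w' s)"
      unfolding J_def by (rule integral_diff[symmetric]) (intro integrable_continuous_real hcont c)+
    then have Jd: "norm (J ?w ?y - J ?w' ?y) \<le> (L * dist w w') / (2 * L) * exp (2 * L * ?y)"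
      using norm_integral_exp_bound[OF continuous_on_diff[OF hcont[OF c(1)] hcont[OF c(2)]] hd L, of ?y] by simp
    have "dist (G ?w x) (G ?w' x) = exp (- 2 * L * ?y) * norm (J ?w ?y - J ?w' ?y)"
      unfolding G_def dist_norm scaleR_diff_right[symmetric] by simp
    also have "\<dots> \<le> exp (- 2 * L * ?y) * ((L * dist w w') / (2 * L) * exp (2 * L * ?y))"
      using Jd by simp
    also have "\<dots> = 1/2 * dist w w' * (exp (- 2 * L * ?y) * exp (2 * L * ?y))" using L by simp
    also have "exp (- 2 * L * ?y) * exp (2 * L * ?y) = 1" by (simp add: exp_add[symmetric])
    finally show "dist (apply_bcontfun (\<T> w) x) (apply_bcontfun (\<T> w') x) \<le> 1/2 * dist w w'"
      by (simp add: ap)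
  qed
  obtain w where w: "\<T> w = w" using banach_fix_type[of "1/2" \<T>] contr by auto
  define v where "v = apply_bcontfun w"
  have v: "G v = v" using ap[of w] w by (simp add: v_def)
  have vc: "continuous_on UNIV v" by (simp add: v_def)
  define U where "U x = exp (2 * L * x) *\<^sub>R v x" for x
  have hU: "h v = (\<lambda>s. F (U s))" by (simp add: h_def U_def fun_eq_iff)
  have Uc: "continuous_on X U" for X unfolding U_def using vc by (intro continuous_intros) (auto intro: continuous_on_subset)
  have FUc: "continuous_on X (\<lambda>s. F (U s))" for X by (rule continuous_on_compose2[OF Fc Uc]) auto
  have UJ: "U x = u0 + integral {0..x} (\<lambda>s. F (U s))" if "x \<ge> 0" for x
  proof -
    have "U x = exp (2 * L * x) *\<^sub>R G v x" using v by (simp add: U_def)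
    also have "\<dots> = (exp (2 * L * x) * exp (- 2 * L * x)) *\<^sub>R (u0 + J v x)" using that by (simp add: G_def)
    also have "exp (2 * L * x) * exp (- 2 * L * x) = 1" by (simp add: exp_add[symmetric])
    finally show ?thesis by (simp add: J_def hU)
  qed
  show ?thesis
  proof
    show "U 0 = u0" using UJ[of 0] by simp
    show "continuous_on {0..} U" by (rule Uc)
    fix x :: real assume x: "x > 0"
    have "((\<lambda>y. integral {0..y} (\<lambda>s. F (U s))) has_vector_derivative F (U x)) (at x within {0..x+1})"
      by (rule integral_has_vector_derivative[OF FUc]) (use x in auto)
    then have "((\<lambda>y. integral {0..y} (\<lambda>s. F (U s))) has_vector_derivative F (U x)) (at x)"
      using x at_within_interior[of x "{0..x+1}"] by simp
    then have "((\<lambda>y. u0 + integral {0..y} (\<lambda>s. F (U s))) has_vector_derivative F (U x)) (at x)"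
      by (auto intro!: derivative_eq_intros)
    then show "(U has_vector_derivative F (U x)) (at x)"
      by (rule has_vector_derivative_transform_within_open[of _ _ _ "{0<..}"]) (use x UJ in auto)
  qed
qed

section \<open>First crossings and monotonicity on intervals\<close>

lemma first_hit:
  fixes h :: "real \<Rightarrow> real"
  assumes "continuous_on {a..b} h" "a \<le> b" "h a < c" "c \<le> h b"
  obtains x where "a < x" "x \<le> b" "h x = c" "\<And>s. a \<le> s \<Longrightarrow> s < x \<Longrightarrow> h s < c"
proof -
  let ?S = "{s \<in> {a..b}. c \<le> h s}"
  have eq: "?S = {a..b} \<inter> (h -` {c..} \<inter> {a..b})" by auto
  have "closed (h -` {c..} \<inter> {a..b})"
    using continuous_on_closed_vimage[OF closed_atLeastAtMost[of a b], of h] assms(1) by simp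
  then have "compact ?S" unfolding eq by (intro compact_Int_closed) simp_all
  moreover have "b \<in> ?S" using assms by auto
  ultimately obtain x where x: "x \<in> ?S" "\<And>s. s \<in> ?S \<Longrightarrow> x \<le> s"
    using compact_attains_inf[of ?S] by blast
  have lt: "h s < c" if "a \<le> s" "s < x" for s
    using x(2)[of s] x(1) that by (cases "h s < c") auto
  have ax: "a < x" using x(1) assms(3) by (cases "a = x") auto
  obtain y where y: "a \<le> y" "y \<le> x" "h y = c"
    using IVT'[of h a c x] x(1) assms continuous_on_subset[OF assms(1), of "{a..x}"] by auto
  then have "y = x" using lt[of y] by force
  then show ?thesis using that ax x(1) y lt by auto
qed

lemma linear_growth:
  fixes h :: "real \<Rightarrow> real"
  assumes c: "continuous_on {a..} h" and d: "\<And>x. x > a \<Longrightarrow> (h has_real_derivative h' x) (at x)"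
    and m: "\<And>x. x > a \<Longrightarrow> m \<le> h' x" and x: "a \<le> x"
  shows "h a + m * (x - a) \<le> h x"
proof (cases "a = x")
  case False
  have "h a - m * a \<le> h x - m * x"
  proof (rule DERIV_nonneg_imp_increasing_open[of a x "\<lambda>x. h x - m * x"])
    show "a \<le> x" by fact
    fix s assume s: "a < s" "s < x"
    have "((\<lambda>x. h x - m * x) has_real_derivative (h' s - m)) (at s)"
      by (auto intro!: derivative_eq_intros d s)
    then show "\<exists>y. ((\<lambda>x. h x - m * x) has_real_derivative y) (at s) \<and> 0 \<le> y"
      using m[OF s(1)] by (intro exI[of _ "h' s - m"]) auto
  next
    show "continuous_on {a..x} (\<lambda>x. h x - m * x)"
      by (intro continuous_intros continuous_on_subset[OF c]) auto
  qed
  then show ?thesis by (simp add: algebra_simps)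
qed simp

lemma mono_open:
  fixes h :: "real \<Rightarrow> real"
  assumes c: "continuous_on {a..b} h" and d: "\<And>x. a < x \<Longrightarrow> x < b \<Longrightarrow> (h has_real_derivative h' x) (at x)"
    and m: "\<And>x. a < x \<Longrightarrow> x < b \<Longrightarrow> 0 \<le> h' x" and "a \<le> s" "s \<le> t" "t \<le> b"
  shows "h s \<le> h t"
proof (rule DERIV_nonneg_imp_increasing_open[OF \<open>s \<le> t\<close>])
  show "continuous_on {s..t} h" by (rule continuous_on_subset[OF c]) (use assms in auto)
  fix x assume "s < x" "x < t"
  then show "\<exists>y. (h has_real_derivative y) (at x) \<and> 0 \<le> y"
    using d[of x] m[of x] assms by (intro exI[of _ "h' x"]) simp
qed

text \<open>\<open>\<psi>\<close> with slope \<open>p\<close> is the profile, to the right of its contact point \<open>0\<close> with the obstacle \<open>\<beta>\<close>, of a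
  wave with speed \<open>- k\<close>.\<close>

definition orbit :: "(real \<Rightarrow> real) \<Rightarrow> real \<Rightarrow> real \<Rightarrow> (real \<Rightarrow> real) \<Rightarrow> (real \<Rightarrow> real) \<Rightarrow> bool" where
  "orbit g k \<beta> \<psi> p \<longleftrightarrow> \<psi> 0 = \<beta> \<and> p 0 = 0 \<and> continuous_on {0..} \<psi> \<and> continuous_on {0..} p \<and>
     (\<forall>x>0. (\<psi> has_real_derivative p x) (at x) \<and> (p has_real_derivative (k * p x + g (\<psi> x))) (at x))"

lemma orbitD:
  assumes "orbit g k \<beta> \<psi> p"
  shows "\<psi> 0 = \<beta>" "p 0 = 0" "continuous_on {0..} \<psi>" "continuous_on {0..} p"
    "\<And>x. x > 0 \<Longrightarrow> (\<psi> has_real_derivative p x) (at x)"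
    "\<And>x. x > 0 \<Longrightarrow> (p has_real_derivative (k * p x + g (\<psi> x))) (at x)"
    "\<And>a b. 0 \<le> a \<Longrightarrow> continuous_on {a..b} \<psi>" "\<And>a b. 0 \<le> a \<Longrightarrow> continuous_on {a..b} p"
proof -
  show "continuous_on {0..} \<psi>" "continuous_on {0..} p" using assms by (auto simp: orbit_def)
  then show "continuous_on {a..b} \<psi>" "continuous_on {a..b} p" if "0 \<le> a" for a b
    using that by (auto elim: continuous_on_subset)
qed (use assms in \<open>auto simp: orbit_def\<close>)

lemma orbit_exists:
  fixes g :: "real \<Rightarrow> real"
  assumes lip: "\<And>x y. \<bar>g x - g y\<bar> \<le> M * \<bar>x - y\<bar>"
  shows "\<exists>\<psi> p. orbit g k \<beta> \<psi> p"
proof -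
  define F where "F u = (snd u, k * snd u + g (fst u))" for u :: "real \<times> real"
  have M: "M \<ge> 0" using lip[of 1 0] by auto
  \<comment> \<open>A Lipschitz constant of the first-order system for the pair of height and slope:
    1 from the first component, \<open>\<bar>k\<bar> + M\<close> from the second.\<close>
  define L where "L = 1 + \<bar>k\<bar> + M"
  have LF: "norm (F u - F v) \<le> L * norm (u - v)" for u v
  proof -
    have s: "\<bar>snd u - snd v\<bar> \<le> norm (u - v)" and f: "\<bar>fst u - fst v\<bar> \<le> norm (u - v)"
      using norm_snd_le[of "snd u - snd v" "fst u - fst v"] norm_fst_le[of "fst u - fst v" "snd u - snd v"]
      by (simp_all add: minus_prod_def)
    have "norm (F u - F v) \<le> \<bar>snd u - snd v\<bar> + \<bar>(k * snd u + g (fst u)) - (k * snd v + g (fst v))\<bar>"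
      using norm_Pair_le[of "snd u - snd v" "(k * snd u + g (fst u)) - (k * snd v + g (fst v))"]
      by (simp add: F_def)
    also have "(k * snd u + g (fst u)) - (k * snd v + g (fst v)) = k * (snd u - snd v) + (g (fst u) - g (fst v))"
      by (simp add: algebra_simps)
    also have "\<bar>k * (snd u - snd v) + (g (fst u) - g (fst v))\<bar> \<le> \<bar>k\<bar> * \<bar>snd u - snd v\<bar> + M * \<bar>fst u - fst v\<bar>"
      using abs_triangle_ineq[of "k * (snd u - snd v)" "g (fst u) - g (fst v)"] lip[of "fst u" "fst v"]
      by (simp add: abs_mult)
    also have "\<bar>snd u - snd v\<bar> + (\<bar>k\<bar> * \<bar>snd u - snd v\<bar> + M * \<bar>fst u - fst v\<bar>) \<le> norm (u - v) + (\<bar>k\<bar> * norm (u - v) + M * norm (u - v))"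
      using s f M by (intro add_mono mult_left_mono) auto
    finally show ?thesis by (simp add: L_def algebra_simps)
  qed
  have "L > 0" using M by (simp add: L_def)
  then obtain U where U: "U 0 = (\<beta>, 0)" "continuous_on {0..} U" "\<And>x. x > 0 \<Longrightarrow> (U has_vector_derivative F (U x)) (at x)"
    by (rule picard_global[where ?u0.0 = "(\<beta>, 0)", OF LF]) blast
  have "((\<lambda>x. fst (U x)) has_vector_derivative fst (F (U x))) (at x)" "((\<lambda>x. snd (U x)) has_vector_derivative snd (F (U x))) (at x)" if "x > 0" for x
    using bounded_linear.has_vector_derivative[OF bounded_linear_fst U(3)[OF that]]
      bounded_linear.has_vector_derivative[OF bounded_linear_snd U(3)[OF that]] by auto
  then have "orbit g k \<beta> (\<lambda>x. fst (U x)) (\<lambda>x. snd (U x))"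
    unfolding orbit_def has_real_derivative_iff_has_vector_derivative
    using U(1,2) by (auto simp: F_def intro!: continuous_intros)
  then show ?thesis by blast
qed


text \<open>A Gronwall estimate for the squared distance of the two orbits in the phase plane. The
  constant \<open>d\<^sup>2 * P\<^sup>2\<close> added to it absorbs the error caused by different
  speeds, so that one differential inequality covers changes of \<open>k\<close> and of
  \<beta>.\<close>

lemma orbit_dependence:
  fixes g :: "real \<Rightarrow> real"
  assumes lip: "\<And>x y. \<bar>g x - g y\<bar> \<le> M * \<bar>x - y\<bar>"
    and o0: "orbit g k0 \<beta>0 \<psi>0 p0" and e: "e > 0"
  shows "\<exists>d>0. \<forall>k \<beta> \<psi> p. orbit g k \<beta> \<psi> p \<longrightarrow> \<bar>k - k0\<bar> < d \<longrightarrow> \<bar>\<beta> - \<beta>0\<bar> < d \<longrightarrow>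
     (\<forall>x\<in>{0..X}. \<bar>\<psi> x - \<psi>0 x\<bar> < e \<and> \<bar>p x - p0 x\<bar> < e)"
proof (cases "X \<ge> 0")
  case False
  then show ?thesis by (intro exI[of _ 1]) auto
next
  case X: True
  have M: "M \<ge> 0" using lip[of 1 0] by auto
  note O = orbitD[OF o0]
  have "compact (p0 ` {0..X})" by (intro compact_continuous_image O) auto
  then obtain P where P: "\<And>x. x \<in> {0..X} \<Longrightarrow> \<bar>p0 x\<bar> \<le> P"
    using compact_imp_bounded bounded_iff by (metis imageI real_norm_def)
  \<comment> \<open>The coefficient that \<open>(v s)\<^sup>2\<close> collects from the four
    estimates of \<open>R'\<close> below.\<close>
  define C where "C = 2 + 2 * (\<bar>k0\<bar> + 1) + M"
  have C: "C \<ge> 1" using M by (simp add: C_def)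
  define Q where "Q = (1 + P\<^sup>2) * exp (C * X)"
  have Q: "Q \<ge> 1" unfolding Q_def using C X mult_mono[of 1 "1 + P\<^sup>2" 1 "exp (C * X)"] by simp
  \<comment> \<open>Gronwall gives \<open>R x \<le> d\<^sup>2 * Q\<close>, which this choice makes
    smaller than \<open>e\<^sup>2\<close>; the bound 1 ensures
    \<open>\<bar>k\<bar> \<le> \<bar>k0\<bar> + 1\<close>.\<close>
  define d where "d = min 1 (e / (2 * Q))"
  have d: "d > 0" "d \<le> 1" using e Q by (auto simp: d_def)
  have dQ: "d\<^sup>2 * Q < e\<^sup>2"
  proof -
    have "d * (2 * Q) \<le> e / (2 * Q) * (2 * Q)" by (rule mult_right_mono) (use Q in \<open>auto simp: d_def\<close>)
    then have "d * (2 * Q) \<le> e" using Q by simp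
    moreover have "d * 1 \<le> d * Q" "0 < d * Q" using d Q by (auto intro!: mult_left_mono)
    moreover have "d * (2 * Q) = 2 * (d * Q)" by simp
    ultimately have "d < e" "d * Q < e" using d by linarith+
    then have "d * (d * Q) < e * e" using d Q by (intro mult_strict_mono) auto
    then show ?thesis by (simp add: power2_eq_square mult.assoc)
  qed
  show ?thesis
  proof (intro exI[of _ d] conjI d allI impI ballI)
    fix k \<beta> \<psi> p x
    assume o: "orbit g k \<beta> \<psi> p" and k: "\<bar>k - k0\<bar> < d" and b: "\<bar>\<beta> - \<beta>0\<bar> < d" and x: "x \<in> {0..X}"
    note O' = orbitD[OF o]
    define u where "u s = \<psi> s - \<psi>0 s" for s
    define v where "v s = p s - p0 s" for s
    define R where "R s = (u s)\<^sup>2 + (v s)\<^sup>2 + d\<^sup>2 * P\<^sup>2" for s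
    define R' where "R' s = 2 * u s * v s + 2 * v s * ((k * p s + g (\<psi> s)) - (k0 * p0 s + g (\<psi>0 s)))" for s
    have dR: "(R has_real_derivative R' s) (at s)" if "s > 0" for s
      unfolding R_def R'_def u_def v_def
      by (auto intro!: derivative_eq_intros O O' that simp: algebra_simps)
    have R0: "R s \<ge> 0" for s by (simp add: R_def)
    have est: "R' s \<le> C * R s" if s: "0 < s" "s < x" for s
    proof -
      have P': "\<bar>p0 s\<bar> \<le> P" using P s x by auto
      have k': "\<bar>k\<bar> \<le> \<bar>k0\<bar> + 1" using k d by linarith
      have 1: "2 * u s * v s \<le> (u s)\<^sup>2 + (v s)\<^sup>2" by (rule sum_squares_bound)
      have 2: "2 * v s * (k * v s) \<le> 2 * (\<bar>k0\<bar> + 1) * (v s)\<^sup>2"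
      proof -
        have "k * (v s)\<^sup>2 \<le> (\<bar>k0\<bar> + 1) * (v s)\<^sup>2" using k' by (intro mult_right_mono) auto
        then show ?thesis by (simp add: power2_eq_square algebra_simps)
      qed
      have 3: "2 * v s * ((k - k0) * p0 s) \<le> (v s)\<^sup>2 + d\<^sup>2 * P\<^sup>2"
      proof -
        have "\<bar>(k - k0) * p0 s\<bar> \<le> d * P" unfolding abs_mult using k P' d by (intro mult_mono) auto
        then have "\<bar>(k - k0) * p0 s\<bar>\<^sup>2 \<le> (d * P)\<^sup>2" by (rule power_mono) simp
        then have "((k - k0) * p0 s)\<^sup>2 \<le> d\<^sup>2 * P\<^sup>2" by (simp add: power_mult_distrib)
        then show ?thesis using sum_squares_bound[of "v s" "(k - k0) * p0 s"] by linarith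
      qed
      have 4: "2 * v s * (g (\<psi> s) - g (\<psi>0 s)) \<le> M * ((u s)\<^sup>2 + (v s)\<^sup>2)"
      proof -
        have "v s * (g (\<psi> s) - g (\<psi>0 s)) \<le> \<bar>v s\<bar> * (M * \<bar>u s\<bar>)"
          using lip[of "\<psi> s" "\<psi>0 s"] abs_ge_self[of "v s * (g (\<psi> s) - g (\<psi>0 s))"]
            mult_left_mono[of "\<bar>g (\<psi> s) - g (\<psi>0 s)\<bar>" "M * \<bar>u s\<bar>" "\<bar>v s\<bar>"]
          by (simp add: abs_mult u_def)
        moreover have "M * (2 * \<bar>u s\<bar> * \<bar>v s\<bar>) \<le> M * ((u s)\<^sup>2 + (v s)\<^sup>2)"
          using sum_squares_bound[of "\<bar>u s\<bar>" "\<bar>v s\<bar>"] M by (intro mult_left_mono) auto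
        ultimately show ?thesis by (simp add: algebra_simps)
      qed
      have "R' s = 2 * u s * v s + 2 * v s * (k * v s) + 2 * v s * ((k - k0) * p0 s) + 2 * v s * (g (\<psi> s) - g (\<psi>0 s))"
        by (simp add: R'_def v_def algebra_simps)
      also have "\<dots> \<le> ((u s)\<^sup>2 + (v s)\<^sup>2) + 2 * (\<bar>k0\<bar> + 1) * (v s)\<^sup>2 + ((v s)\<^sup>2 + d\<^sup>2 * P\<^sup>2) + M * ((u s)\<^sup>2 + (v s)\<^sup>2)"
        using 1 2 3 4 by linarith
      also have "\<dots> \<le> C * R s"
      proof -
        have "C * R s - (((u s)\<^sup>2 + (v s)\<^sup>2) + 2 * (\<bar>k0\<bar> + 1) * (v s)\<^sup>2 + ((v s)\<^sup>2 + d\<^sup>2 * P\<^sup>2) + M * ((u s)\<^sup>2 + (v s)\<^sup>2))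
          = (1 + 2 * (\<bar>k0\<bar> + 1)) * (u s)\<^sup>2 + (C - 1) * (d\<^sup>2 * P\<^sup>2)"
          by (simp add: C_def R_def algebra_simps)
        also have "\<dots> \<ge> 0" using C by (intro add_nonneg_nonneg mult_nonneg_nonneg) auto
        finally show ?thesis by linarith
      qed
      finally show ?thesis .
    qed
    have "- (R 0 * exp (- C * 0)) \<le> - (R x * exp (- C * x))"
    proof (rule mono_open[of 0 x "\<lambda>s. - (R s * exp (- C * s))" "\<lambda>s. (C * R s - R' s) * exp (- C * s)"])
      show "continuous_on {0..x} (\<lambda>s. - (R s * exp (- C * s)))"
        unfolding R_def u_def v_def by (intro continuous_intros O O') auto
      show "((\<lambda>s. - (R s * exp (- C * s))) has_real_derivative (C * R s - R' s) * exp (- C * s)) (at s)" if "0 < s" for s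
        by (auto intro!: derivative_eq_intros dR that simp: algebra_simps)
    qed (use est x in auto)
    then have "R x * exp (- C * x) \<le> R 0" by simp
    then have "R x * exp (- C * x) * exp (C * x) \<le> R 0 * exp (C * x)" by (intro mult_right_mono) auto
    then have "R x \<le> R 0 * exp (C * x)" by (simp add: mult.assoc exp_add[symmetric])
    also have "\<dots> \<le> R 0 * exp (C * X)" using x C R0 by (intro mult_left_mono) auto
    also have "R 0 \<le> d\<^sup>2 * (1 + P\<^sup>2)"
    proof -
      have "\<bar>\<beta> - \<beta>0\<bar>\<^sup>2 \<le> d\<^sup>2" using b by (intro power_mono) auto
      then show ?thesis unfolding R_def u_def v_def by (simp add: O O' algebra_simps)
    qed
    then have "R 0 * exp (C * X) \<le> d\<^sup>2 * Q" unfolding Q_def mult.assoc[symmetric] by (intro mult_right_mono) auto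
    finally have Re: "R x < e\<^sup>2" using dQ by linarith
    have "0 \<le> (u x)\<^sup>2" "0 \<le> (v x)\<^sup>2" "0 \<le> d\<^sup>2 * P\<^sup>2" by auto
    then have "\<bar>u x\<bar>\<^sup>2 < e\<^sup>2" "\<bar>v x\<bar>\<^sup>2 < e\<^sup>2" using Re unfolding R_def power2_abs by linarith+
    then have "\<bar>u x\<bar> < e" "\<bar>v x\<bar> < e" using e by (auto intro: power2_less_imp_less)
    then show "\<bar>\<psi> x - \<psi>0 x\<bar> < e" "\<bar>p x - p0 x\<bar> < e" by (simp_all add: u_def v_def)
  qed
qed

text \<open>Backward uniqueness: the squared distance \<open>R\<close> to the equilibrium satisfies
  \<open>R' \<ge> - C * R\<close>, so \<open>R s * exp (C * s)\<close> is nondecreasing. Being zero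
  at \<open>x\<close>, it is zero at 0, and the orbit already started at that equilibrium.\<close>

lemma orbit_equilibrium:
  fixes g :: "real \<Rightarrow> real"
  assumes lip: "\<And>x y. \<bar>g x - g y\<bar> \<le> M * \<bar>x - y\<bar>"
    and o: "orbit g k \<beta> \<psi> p" and x: "x > 0" "p x = 0" "g (\<psi> x) = 0"
  shows "g \<beta> = 0"
proof -
  note O = orbitD[OF o]
  have M: "M \<ge> 0" using lip[of 1 0] by auto
  define u where "u s = \<psi> s - \<psi> x" for s
  define R where "R s = (u s)\<^sup>2 + (p s)\<^sup>2" for s
  define R' where "R' s = 2 * u s * p s + 2 * p s * (k * p s + g (\<psi> s))" for s
  define C where "C = 1 + 2 * \<bar>k\<bar> + M"
  have dR: "(R has_real_derivative R' s) (at s)" if "s > 0" for s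
    unfolding R_def R'_def u_def
    by (auto intro!: derivative_eq_intros O that simp: algebra_simps)
  have est: "0 \<le> R' s + C * R s" for s
  proof -
    have 1: "- (2 * u s * p s) \<le> (u s)\<^sup>2 + (p s)\<^sup>2"
      using sum_squares_bound[of "- u s" "p s"] by simp
    have 2: "- (2 * p s * (k * p s)) \<le> 2 * \<bar>k\<bar> * (p s)\<^sup>2"
    proof -
      have "- k * (p s)\<^sup>2 \<le> \<bar>k\<bar> * (p s)\<^sup>2" by (intro mult_right_mono) auto
      then show ?thesis by (simp add: power2_eq_square algebra_simps)
    qed
    have 4: "- (2 * p s * g (\<psi> s)) \<le> M * ((u s)\<^sup>2 + (p s)\<^sup>2)"
    proof -
      have "\<bar>p s * g (\<psi> s)\<bar> \<le> \<bar>p s\<bar> * (M * \<bar>u s\<bar>)"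
        unfolding abs_mult using lip[of "\<psi> s" "\<psi> x"] x(3) by (intro mult_left_mono) (auto simp: u_def)
      moreover have "M * (2 * \<bar>u s\<bar> * \<bar>p s\<bar>) \<le> M * ((u s)\<^sup>2 + (p s)\<^sup>2)"
        using sum_squares_bound[of "\<bar>u s\<bar>" "\<bar>p s\<bar>"] M by (intro mult_left_mono) auto
      ultimately show ?thesis by (simp add: algebra_simps)
    qed
    have "2 * p s * (k * p s + g (\<psi> s)) = 2 * p s * (k * p s) + 2 * p s * g (\<psi> s)" by (simp add: algebra_simps)
    moreover have "C * R s = ((u s)\<^sup>2 + (p s)\<^sup>2) + 2 * \<bar>k\<bar> * (u s)\<^sup>2 + 2 * \<bar>k\<bar> * (p s)\<^sup>2 + M * ((u s)\<^sup>2 + (p s)\<^sup>2)"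
      by (simp add: C_def R_def algebra_simps)
    moreover have "0 \<le> 2 * \<bar>k\<bar> * (u s)\<^sup>2" by simp
    ultimately show ?thesis unfolding R'_def using 1 2 4 by linarith
  qed
  have "R 0 * exp (C * 0) \<le> R x * exp (C * x)"
  proof (rule mono_open[of 0 x "\<lambda>s. R s * exp (C * s)" "\<lambda>s. (R' s + C * R s) * exp (C * s)"])
    show "continuous_on {0..x} (\<lambda>s. R s * exp (C * s))"
      unfolding R_def u_def by (intro continuous_intros O) auto
    show "((\<lambda>s. R s * exp (C * s)) has_real_derivative (R' s + C * R s) * exp (C * s)) (at s)" if "0 < s" for s
      by (auto intro!: derivative_eq_intros dR that simp: algebra_simps)
  qed (use est x in auto)
  moreover have "R x = 0" using x by (simp add: R_def u_def)
  ultimately have "R 0 \<le> 0" by simp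
  then have "u 0 = 0" unfolding R_def by (simp add: sum_power2_le_zero_iff)
  then show ?thesis using x O(1) by (simp add: u_def)
qed

section \<open>Shooting\<close>

text \<open>Only strict inequalities on a compact interval occur, so the property survives small
  perturbations of the orbit.\<close>

definition turns_back :: "real \<Rightarrow> (real \<Rightarrow> real) \<Rightarrow> (real \<Rightarrow> real) \<Rightarrow> bool" where
  "turns_back b \<psi> p \<longleftrightarrow> (\<exists>x\<ge>0. p x < 0 \<and> (\<forall>s\<in>{0..x}. \<psi> s < b))"

text \<open>Positivity of the slope alone would fail at time 0, where orbits have slope zero. The
  alternative \<open>\<psi> s < a\<close>, used with \<open>a = a0\<close>, covers the start while
  keeping every inequality strict.\<close>

definition overshoots :: "real \<Rightarrow> real \<Rightarrow> (real \<Rightarrow> real) \<Rightarrow> (real \<Rightarrow> real) \<Rightarrow> bool" where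
  "overshoots a b \<psi> p \<longleftrightarrow> (\<exists>x\<ge>0. \<psi> x > b \<and> (\<forall>s\<in>{0..x}. p s > 0 \<or> \<psi> s < a))"

text \<open>Condition \<open>gnn\<close> extends the sign of \<open>g\<close> below
  \<open>am\<close>; the slope can then be controlled under the sole condition that the height stays
  at most \<open>a0\<close>.\<close>

locale bistable =
  fixes g :: "real \<Rightarrow> real" and am a0 ap M :: real
  assumes order: "am < a0" "a0 < ap"
    and lip: "\<And>x y. \<bar>g x - g y\<bar> \<le> M * \<bar>x - y\<bar>"
    and gpos: "\<And>z. am < z \<Longrightarrow> z < a0 \<Longrightarrow> g z > 0"
    and gneg: "\<And>z. a0 < z \<Longrightarrow> z < ap \<Longrightarrow> g z < 0"
    and gap: "g ap = 0" and ga0: "g a0 = 0"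
    and gnn: "\<And>z. z \<le> a0 \<Longrightarrow> g z \<ge> 0"
begin

lemma g_cont: "continuous_on X g"
proof -
  have "M \<ge> 0" using lip[of 1 0] by auto
  then have "M-lipschitz_on UNIV g" by (intro lipschitz_onI) (use lip in \<open>auto simp: dist_real_def\<close>)
  then show ?thesis using lipschitz_on_continuous_on continuous_on_subset by blast
qed

context
  fixes k \<beta> \<psi> p
  assumes o: "orbit g k \<beta> \<psi> p" and \<beta>: "am < \<beta>" "\<beta> < a0"
begin

lemmas O = orbitD[OF o]

lemma no_equilibrium: "x > 0 \<Longrightarrow> p x = 0 \<Longrightarrow> g (\<psi> x) \<noteq> 0"
  using orbit_equilibrium[OF lip o, of x] gpos[OF \<beta>] by auto

text \<open>The integrating factor removes the damping term: the derivative of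
  \<open>p s * exp (- k * s)\<close> is \<open>g (\<psi> s) * exp (- k * s)\<close>, which is
  nonnegative below \<open>a0\<close>.\<close>

lemma scaled_slope_mono:
  assumes "\<And>s. 0 < s \<Longrightarrow> s < x \<Longrightarrow> \<psi> s \<le> a0" "0 \<le> s" "s \<le> t" "t \<le> x"
  shows "p s * exp (- k * s) \<le> p t * exp (- k * t)"
proof (rule mono_open[of 0 x "\<lambda>s. p s * exp (- k * s)" "\<lambda>s. g (\<psi> s) * exp (- k * s)"])
  show "continuous_on {0..x} (\<lambda>s. p s * exp (- k * s))" by (intro continuous_intros O) auto
  show "((\<lambda>s. p s * exp (- k * s)) has_real_derivative g (\<psi> s) * exp (- k * s)) (at s)" if "0 < s" for s
    by (auto intro!: derivative_eq_intros O that simp: algebra_simps)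
  show "0 \<le> g (\<psi> s) * exp (- k * s)" if "0 < s" "s < x" for s
    using gnn[OF assms(1)[OF that]] by simp
qed (use assms in auto)

text \<open>The scaled slope increases from 0. If it were still 0 at \<open>x\<close>, the orbit
  would rest at \<beta> up to \<open>x\<close>, which is impossible as \<open>g \<beta>\<close> is
  positive.\<close>

lemma slope_pos_below:
  assumes x: "x > 0" and le: "\<And>s. 0 < s \<Longrightarrow> s < x \<Longrightarrow> \<psi> s \<le> a0"
  shows "p x > 0"
proof (rule ccontr)
  assume n: "\<not> p x > 0"
  have V: "0 \<le> p s * exp (- k * s)" "p s * exp (- k * s) \<le> p x * exp (- k * x)" if "0 \<le> s" "s \<le> x" for s
    using scaled_slope_mono[OF le, where s = 0 and t = s] scaled_slope_mono[OF le, where s = s and t = x] that O(2) by auto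
  have "p x * exp (- k * x) \<le> 0" using n by (simp add: mult_nonpos_nonneg)
  then have p0: "p s = 0" if "0 \<le> s" "s \<le> x" for s
  proof -
    have "p s * exp (- k * s) = 0" using V[OF that] \<open>p x * exp (- k * x) \<le> 0\<close> by linarith
    then show ?thesis by simp
  qed
  have d0: "(\<psi> has_real_derivative 0) (at s)" if "0 < s" "s < x" for s
    using O(5)[of s] p0[of s] that by simp
  have "\<psi> 0 \<le> \<psi> (x/2)"
    by (rule mono_open[of 0 x \<psi> "\<lambda>_. 0"]) (use x O d0 in auto)
  moreover have "- \<psi> 0 \<le> - \<psi> (x/2)"
    by (rule mono_open[of 0 x "\<lambda>s. - \<psi> s" "\<lambda>_. 0"])
      (use x DERIV_minus[OF d0] in \<open>auto intro!: continuous_on_minus O\<close>)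
  ultimately have \<psi>: "\<psi> (x/2) = \<beta>" using O(1) by simp
  have "(p has_real_derivative 0) (at (x/2))"
    by (rule DERIV_zero_if_locally_constant[of "{0<..<x}"]) (use x p0 in auto)
  moreover have "(p has_real_derivative (k * p (x/2) + g (\<psi> (x/2)))) (at (x/2))" using O(6) x by simp
  ultimately have "g \<beta> = 0" using DERIV_unique p0[of "x/2"] x \<psi> by fastforce
  then show False using gpos[OF \<beta>] by simp
qed

text \<open>As long as the orbit stays below \<open>a0\<close>, its slope after time 1 is at least
  \<open>p 1 * exp (- k)\<close>, so the height grows linearly.\<close>

lemma reaches_a0:
  assumes k: "k \<ge> 0"
  shows "\<exists>x>0. \<psi> x > a0"
proof (rule ccontr)
  assume "\<not> ?thesis"
  then have le: "\<And>s. 0 < s \<Longrightarrow> \<psi> s \<le> a0" by force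
  have p1: "p 1 > 0" by (rule slope_pos_below) (use le in auto)
  define m where "m = p 1 * exp (- k * 1)"
  have m: "m > 0" using p1 by (simp add: m_def)
  have pm: "m \<le> p x" if "x > 1" for x
  proof -
    have "m \<le> p x * exp (- k * x)" unfolding m_def by (rule scaled_slope_mono[of x]) (use le that in auto)
    moreover have "0 < p x" by (rule slope_pos_below) (use le that in auto)
    then have "p x * exp (- k * x) \<le> p x * 1" using k that by (intro mult_left_mono) auto
    ultimately show ?thesis by simp
  qed
  define X where "X = 1 + (a0 + 1 - \<psi> 1) / m"
  have "(a0 + 1 - \<psi> 1) / m > 0" using le[of 1] m by simp
  then have X: "X > 1" by (simp add: X_def)
  have "\<psi> 1 + m * (X - 1) \<le> \<psi> X"
    by (rule linear_growth[of 1 \<psi> p]) (use O(3,5) pm X in \<open>auto elim: continuous_on_subset\<close>)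
  moreover have "m * (X - 1) = a0 + 1 - \<psi> 1" using m by (simp add: X_def)
  ultimately show False using le[of X] X by simp
qed

text \<open>Without turning back the slope is nonnegative below \<open>ap\<close>, so an interior
  zero would be a local minimum of \<open>p\<close>. There the derivative of \<open>p\<close>
  vanishes, hence so does \<open>g\<close>, and the orbit would sit at an equilibrium.\<close>

lemma slope_pos_no_turn:
  assumes nt: "\<not> turns_back ap \<psi> p" and lt: "\<And>s. 0 \<le> s \<Longrightarrow> s < x \<Longrightarrow> \<psi> s < ap" and s: "0 < s" "s < x"
  shows "p s > 0"
proof -
  have nn: "p t \<ge> 0" if "0 \<le> t" "t < x" for t
    using nt lt that unfolding turns_back_def by (metis atLeastAtMost_iff le_less_trans not_le)
  have "p s \<noteq> 0"
  proof
    assume z: "p s = 0"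
    have "k * p s + g (\<psi> s) = 0"
    proof (rule DERIV_local_min[OF O(6)[OF s(1)]])
      show "0 < min s (x - s)" using s by simp
      show "\<forall>y. \<bar>s - y\<bar> < min s (x - s) \<longrightarrow> p s \<le> p y"
      proof (intro allI impI)
        fix y assume "\<bar>s - y\<bar> < min s (x - s)"
        then have "0 \<le> y" "y < x" by (auto simp: abs_if split: if_splits)
        then show "p s \<le> p y" using nn z by simp
      qed
    qed
    then show False using no_equilibrium[OF s(1) z] z by simp
  qed
  then show ?thesis using nn[of s] s by simp
qed

text \<open>At the first time at height \<open>ap\<close> the slope is nonnegative by continuity. It
  is not zero, because \<open>ap\<close> with slope zero is an equilibrium; the orbit thus crosses
  \<open>ap\<close> and exceeds it a little later with positive slope.\<close>

lemma overshoots_if_hits: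
  assumes nt: "\<not> turns_back ap \<psi> p" and hit: "x \<ge> 0" "\<psi> x \<ge> ap"
  shows "overshoots a0 ap \<psi> p"
proof -
  obtain y where y: "0 < y" "\<psi> y = ap" "\<And>s. 0 \<le> s \<Longrightarrow> s < y \<Longrightarrow> \<psi> s < ap"
    by (rule first_hit[of 0 x \<psi> ap]) (use O hit order \<beta> in auto)
  have pos: "p s > 0" if "0 < s" "s < y" for s by (rule slope_pos_no_turn[OF nt y(3) that])
  have "p y \<noteq> 0" using no_equilibrium[OF y(1)] y(2) gap by auto
  moreover have "p y \<ge> 0"
  proof (rule ccontr)
    assume "\<not> p y \<ge> 0"
    then have "p y < 0" by simp
    have "isCont p y" using O(6)[OF y(1)] DERIV_isCont by blast
    then have "\<forall>\<^sub>F s in at y. p s < 0" using \<open>p y < 0\<close> by (simp add: isCont_def order_tendstoD)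
    then obtain d where d: "d > 0" "\<And>s. s \<noteq> y \<Longrightarrow> \<bar>s - y\<bar> < d \<Longrightarrow> p s < 0"
      unfolding eventually_at by (auto simp: dist_real_def)
    define s where "s = y - min d y / 2"
    have "s \<noteq> y" "\<bar>s - y\<bar> < d" "0 < s" "s < y" using d y by (auto simp: s_def min_def)
    then show False using d(2)[of s] pos[of s] by simp
  qed
  ultimately have py: "p y > 0" by simp
  have "isCont p y" using O(6)[OF y(1)] DERIV_isCont by blast
  then have "\<forall>\<^sub>F s in at y. p s > 0" using py by (simp add: isCont_def order_tendstoD)
  then obtain d where d: "d > 0" "\<And>s. s \<noteq> y \<Longrightarrow> \<bar>s - y\<bar> < d \<Longrightarrow> p s > 0"
    unfolding eventually_at by (auto simp: dist_real_def)
  define z where "z = y + d / 2"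
  have pos': "p s > 0" if "y \<le> s" "s \<le> z" for s
    using d(2)[of s] that py d(1) by (cases "s = y") (auto simp: z_def abs_if)
  have "\<psi> y < \<psi> z"
  proof (rule DERIV_pos_imp_increasing[of y z \<psi>])
    show "y < z" using d by (simp add: z_def)
    show "\<exists>D. (\<psi> has_real_derivative D) (at s) \<and> 0 < D" if "y \<le> s" "s \<le> z" for s
      using O(5)[of s] pos'[OF that] that y(1) by (intro exI[of _ "p s"]) auto
  qed
  moreover have "p s > 0 \<or> \<psi> s < a0" if "s \<in> {0..z}" for s
    using that pos[of s] pos'[of s] O(1) \<beta> by (cases "s = 0"; cases "s < y") auto
  ultimately show ?thesis unfolding overshoots_def using y d by (intro exI[of _ z]) (auto simp: z_def)
qed

text \<open>The orbit increases to a limit \<open>z\<close> in \<open>(a0, ap]\<close>. If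
  \<open>z\<close> were below \<open>ap\<close>, then \<open>g\<close> would be eventually bounded
  away from 0 along the orbit, and \<open>k * \<psi> - p\<close>, whose derivative is
  \<open>- g\<close>, would grow without bound although it stays below
  \<open>k * ap\<close>.\<close>

lemma tendsto_ap:
  assumes nt: "\<not> turns_back ap \<psi> p" and lt: "\<And>s. 0 \<le> s \<Longrightarrow> \<psi> s < ap" and k: "k > 0"
  shows "(\<psi> \<longlongrightarrow> ap) at_top"
proof -
  have pos: "p s > 0" if "s > 0" for s
    by (rule slope_pos_no_turn[OF nt, of "s + 1"]) (use lt that in auto)
  have mono: "\<psi> s \<le> \<psi> t" if "0 \<le> s" "s \<le> t" for s t
    by (rule mono_open[of 0 t \<psi> p]) (use O pos that in \<open>auto intro: less_imp_le\<close>)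
  define z where "z = Sup (\<psi> ` {0..})"
  have bdd: "bdd_above (\<psi> ` {0..})" using lt by (intro bdd_aboveI[of _ ap]) (auto intro: less_imp_le)
  have up: "\<psi> s \<le> z" if "s \<ge> 0" for s unfolding z_def by (rule cSup_upper) (use that bdd in auto)
  have lim: "(\<psi> \<longlongrightarrow> z) at_top"
  proof (rule increasing_tendsto)
    show "\<forall>\<^sub>F n in at_top. \<psi> n \<le> z" unfolding eventually_at_top_linorder using up by blast
    fix w assume "w < z"
    then obtain s where s: "s \<ge> 0" "w < \<psi> s" unfolding z_def using less_cSup_iff[of "\<psi> ` {0..}" w] bdd by auto
    then show "\<forall>\<^sub>F n in at_top. w < \<psi> n" unfolding eventually_at_top_linorder
      using mono[of s] by (intro exI[of _ s]) force
  qed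
  have zle: "z \<le> ap" unfolding z_def by (rule cSup_least) (use lt in \<open>auto intro: less_imp_le\<close>)
  have za: "z > a0" using reaches_a0 k up by (metis less_eq_real_def order.strict_trans1 order_less_imp_le less_le_trans)
  have "z = ap"
  proof (rule ccontr)
    assume "z \<noteq> ap"
    then have gz: "g z < 0" using gneg[OF za] zle by simp
    have "isCont g z" using g_cont[of UNIV] by (simp add: continuous_on_eq_continuous_at)
    then have "((\<lambda>x. g (\<psi> x)) \<longlongrightarrow> g z) at_top" by (rule isCont_tendsto_compose[OF _ lim])
    then have "\<forall>\<^sub>F x in at_top. g (\<psi> x) < g z / 2" using gz by (intro order_tendstoD(2)[of _ "g z"]) auto
    then obtain X0 where X0: "\<And>x. x \<ge> X0 \<Longrightarrow> g (\<psi> x) < g z / 2" unfolding eventually_at_top_linorder by blast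
    define X where "X = max X0 1"
    define W where "W x = k * \<psi> x - p x" for x
    have growth: "W X + (- g z / 2) * (x - X) \<le> W x" if "x \<ge> X" for x
    proof (rule linear_growth[of X W "\<lambda>x. - g (\<psi> x)"])
      show "continuous_on {X..} W" unfolding W_def
        by (intro continuous_intros continuous_on_subset[OF O(3)] continuous_on_subset[OF O(4)]) (auto simp: X_def)
      show "(W has_real_derivative - g (\<psi> x)) (at x)" if "x > X" for x
      proof -
        have "x > 0" using that by (simp add: X_def)
        from DERIV_diff[OF DERIV_cmult[OF O(5)[OF this], of k] O(6)[OF this]] show ?thesis
          unfolding W_def by simp
      qed
      show "- g z / 2 \<le> - g (\<psi> x)" if "x > X" for x using X0[of x] that by (auto simp: X_def)
    qed fact
    \<comment> \<open>The time by which the linear lower bound has pushed \<open>W\<close> up to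
      \<open>k * ap + 1\<close>.\<close>
    define x where "x = X + max 0 ((k * ap + 1 - W X) / (- g z / 2))"
    have "x \<ge> X" by (simp add: x_def)
    have "(- g z / 2) * ((k * ap + 1 - W X) / (- g z / 2)) \<le> (- g z / 2) * (x - X)"
      using gz by (intro mult_left_mono) (auto simp: x_def)
    then have "k * ap + 1 - W X \<le> (- g z / 2) * (x - X)" using gz by simp
    then have "k * ap + 1 \<le> W x" using growth[OF \<open>x \<ge> X\<close>] by linarith
    moreover have "x > 0" using \<open>x \<ge> X\<close> by (simp add: X_def)
    then have "k * \<psi> x \<le> k * ap" "p x > 0" using lt[of x] k pos by (auto intro: less_imp_le)
    ultimately show False by (simp add: W_def)
  qed
  then show ?thesis using lim by simp
qed

text \<open>The time of turning precedes the time of overshooting, so a negative slope there is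
  allowed only below \<open>a0\<close>. The orbit has been above \<open>a0\<close> before, hence it
  came down through \<open>a0\<close>; but overshooting demands a positive slope at that
  height.\<close>

lemma not_overshoots_and_turns_back:
  assumes A: "overshoots a0 ap \<psi> p" and B: "turns_back ap \<psi> p"
  shows False
proof -
  obtain xA where xA: "xA \<ge> 0" "\<psi> xA > ap" "\<And>s. s \<in> {0..xA} \<Longrightarrow> p s > 0 \<or> \<psi> s < a0"
    using A by (auto simp: overshoots_def)
  obtain xB where xB: "xB \<ge> 0" "p xB < 0" "\<And>s. s \<in> {0..xB} \<Longrightarrow> \<psi> s < ap"
    using B by (auto simp: turns_back_def)
  have "xB < xA" using xB(3)[of xA] xA by (cases "xB < xA") auto
  then have lt: "\<psi> xB < a0" using xA(3)[of xB] xB by auto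
  have "xB > 0" using xB O(2) by (cases "xB = 0") auto
  have "\<exists>s. 0 < s \<and> s < xB \<and> \<psi> s > a0"
  proof (rule ccontr)
    assume "\<not> ?thesis"
    then have "p xB > 0" by (intro slope_pos_below[OF \<open>xB > 0\<close>]) force
    then show False using xB by simp
  qed
  then obtain s where s: "0 < s" "s < xB" "\<psi> s > a0" by blast
  text \<open>Going backwards from \<open>xB\<close>, consider the last time at which \<open>\<psi> = a0\<close>.\<close>
  have "continuous_on {- xB..- s} (\<lambda>t. \<psi> (- t))"
    by (rule continuous_on_compose2[OF O(7)[of s xB]]) (use s in \<open>auto intro!: continuous_intros\<close>)
  then obtain t where t: "- xB < t" "t \<le> - s" "\<psi> (- t) = a0" "\<And>r. - xB \<le> r \<Longrightarrow> r < t \<Longrightarrow> \<psi> (- r) < a0"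
    by (rule first_hit[of "- xB" "- s" "\<lambda>t. \<psi> (- t)" a0]) (use s lt in auto)
  have "p (- t) > 0" using xA(3)[of "- t"] t s \<open>xB < xA\<close> by auto
  from DERIV_pos_inc_right[OF O(5) this] t s
  obtain d where d: "d > 0" "\<And>h. 0 < h \<Longrightarrow> h < d \<Longrightarrow> \<psi> (- t) < \<psi> (- t + h)" by auto
  define h where "h = min d (xB + t) / 2"
  have h: "0 < h" "h < d" "h < xB + t" using d t by (auto simp: h_def min_def)
  have "\<psi> (- (t - h)) < a0" by (rule t(4)) (use h in auto)
  then show False using d(2)[OF h(1,2)] t(3) by (simp add: algebra_simps)
qed

end

end

section \<open>Stability of the two alternatives under perturbation\<close>

context bistable
begin

text \<open>The disjunction in the definition says that the continuous function
  \<open>max (p0 s) (a0 - \<psi>0 s)\<close> is positive. Its minimum over the compact interval is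
  the available margin, together with the excess of \<open>\<psi>0 x\<close> over
  \<open>ap\<close>.\<close>

lemma overshoots_open:
  assumes o: "orbit g k0 \<beta>0 \<psi>0 p0" and A: "overshoots a0 ap \<psi>0 p0"
  shows "\<exists>d>0. \<forall>k \<beta> \<psi> p. orbit g k \<beta> \<psi> p \<longrightarrow> \<bar>k - k0\<bar> < d \<longrightarrow> \<bar>\<beta> - \<beta>0\<bar> < d \<longrightarrow> overshoots a0 ap \<psi> p"
proof -
  obtain x where x: "x \<ge> 0" "\<psi>0 x > ap" "\<And>s. s \<in> {0..x} \<Longrightarrow> p0 s > 0 \<or> \<psi>0 s < a0"
    using A by (auto simp: overshoots_def)
  have "continuous_on {0..x} (\<lambda>s. max (p0 s) (a0 - \<psi>0 s))"
    by (intro continuous_intros orbitD[OF o]) auto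
  then obtain s0 where s0: "s0 \<in> {0..x}" "\<And>s. s \<in> {0..x} \<Longrightarrow> max (p0 s0) (a0 - \<psi>0 s0) \<le> max (p0 s) (a0 - \<psi>0 s)"
    using continuous_attains_inf[of "{0..x}" "\<lambda>s. max (p0 s) (a0 - \<psi>0 s)"] x(1) by auto
  define e where "e = min (max (p0 s0) (a0 - \<psi>0 s0)) (\<psi>0 x - ap)"
  have e: "e > 0" using x(2) x(3)[OF s0(1)] by (auto simp: e_def less_max_iff_disj)
  obtain d where d: "d > 0" "\<forall>k \<beta> \<psi> p. orbit g k \<beta> \<psi> p \<longrightarrow> \<bar>k - k0\<bar> < d \<longrightarrow> \<bar>\<beta> - \<beta>0\<bar> < d \<longrightarrow>
     (\<forall>s\<in>{0..x}. \<bar>\<psi> s - \<psi>0 s\<bar> < e \<and> \<bar>p s - p0 s\<bar> < e)"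
    using orbit_dependence[OF lip o e] by blast
  show ?thesis
  proof (intro exI[of _ d] conjI allI impI d(1))
    fix k \<beta> \<psi> p assume "orbit g k \<beta> \<psi> p" "\<bar>k - k0\<bar> < d" "\<bar>\<beta> - \<beta>0\<bar> < d"
    then have c: "\<bar>\<psi> s - \<psi>0 s\<bar> < e" "\<bar>p s - p0 s\<bar> < e" if "s \<in> {0..x}" for s using d(2) that by blast+
    show "overshoots a0 ap \<psi> p" unfolding overshoots_def
    proof (intro exI[of _ x] conjI ballI x(1))
      have "e \<le> \<psi>0 x - ap" by (simp add: e_def)
      then show "ap < \<psi> x" using c(1)[of x] x(1) by simp
      fix s assume s: "s \<in> {0..x}"
      have "e \<le> max (p0 s0) (a0 - \<psi>0 s0)" unfolding e_def by (rule min.cobounded1)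
      then have "e \<le> max (p0 s) (a0 - \<psi>0 s)" using s0(2)[OF s] by (rule order_trans)
      then consider "e \<le> p0 s" | "e \<le> a0 - \<psi>0 s" by (auto simp: le_max_iff_disj)
      then show "p s > 0 \<or> \<psi> s < a0" using c[OF s] by cases linarith+
    qed
  qed
qed

lemma turns_back_open:
  assumes o: "orbit g k0 \<beta>0 \<psi>0 p0" and B: "turns_back ap \<psi>0 p0"
  shows "\<exists>d>0. \<forall>k \<beta> \<psi> p. orbit g k \<beta> \<psi> p \<longrightarrow> \<bar>k - k0\<bar> < d \<longrightarrow> \<bar>\<beta> - \<beta>0\<bar> < d \<longrightarrow> turns_back ap \<psi> p"
proof -
  obtain x where x: "x \<ge> 0" "p0 x < 0" "\<And>s. s \<in> {0..x} \<Longrightarrow> \<psi>0 s < ap"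
    using B by (auto simp: turns_back_def)
  have "continuous_on {0..x} \<psi>0" by (intro orbitD[OF o]) auto
  then obtain s0 where s0: "s0 \<in> {0..x}" "\<And>s. s \<in> {0..x} \<Longrightarrow> \<psi>0 s \<le> \<psi>0 s0"
    using continuous_attains_sup[of "{0..x}" \<psi>0] x(1) by auto
  define e where "e = min (- p0 x) (ap - \<psi>0 s0)"
  have e: "e > 0" using x(2) x(3)[OF s0(1)] by (auto simp: e_def)
  obtain d where d: "d > 0" "\<forall>k \<beta> \<psi> p. orbit g k \<beta> \<psi> p \<longrightarrow> \<bar>k - k0\<bar> < d \<longrightarrow> \<bar>\<beta> - \<beta>0\<bar> < d \<longrightarrow>
     (\<forall>s\<in>{0..x}. \<bar>\<psi> s - \<psi>0 s\<bar> < e \<and> \<bar>p s - p0 s\<bar> < e)"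
    using orbit_dependence[OF lip o e] by blast
  show ?thesis
  proof (intro exI[of _ d] conjI allI impI d(1))
    fix k \<beta> \<psi> p assume "orbit g k \<beta> \<psi> p" "\<bar>k - k0\<bar> < d" "\<bar>\<beta> - \<beta>0\<bar> < d"
    then have c: "\<bar>\<psi> s - \<psi>0 s\<bar> < e" "\<bar>p s - p0 s\<bar> < e" if "s \<in> {0..x}" for s using d(2) that by blast+
    have e': "e \<le> - p0 x" "e \<le> ap - \<psi>0 s0" by (auto simp: e_def)
    show "turns_back ap \<psi> p" unfolding turns_back_def
    proof (intro exI[of _ x] conjI ballI x(1))
      show "p x < 0" using c(2)[of x] x(1) e' by simp
      fix s assume s: "s \<in> {0..x}"
      then show "\<psi> s < ap" using c(1)[OF s] s0(2)[OF s] e' by linarith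
    qed
  qed
qed

end

section \<open>The reference wave as a curve in the phase plane\<close>

locale reference_wave = bistable +
  fixes k \<alpha> :: real and \<phi> p0 :: "real \<Rightarrow> real"
  assumes o0: "orbit g k \<alpha> \<phi> p0" and \<alpha>: "am < \<alpha>" "\<alpha> < a0" and k: "k > 0"
    and p0_nn: "\<And>x. x \<ge> 0 \<Longrightarrow> p0 x \<ge> 0"
    and \<phi>_lim: "(\<phi> \<longlongrightarrow> ap) at_top" and p0_lim: "(p0 \<longlongrightarrow> 0) at_top"
begin

lemmas O0 = orbitD[OF o0]

lemma ref_mono: "0 \<le> s \<Longrightarrow> s \<le> t \<Longrightarrow> \<phi> s \<le> \<phi> t"
  by (rule mono_open[of 0 t \<phi> p0]) (use O0 p0_nn in auto)

lemma ref_no_turn: "\<not> turns_back ap \<phi> p0"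
  using p0_nn by (force simp: turns_back_def)

lemma ref_le: "x \<ge> 0 \<Longrightarrow> \<phi> x \<le> ap"
  by (rule tendsto_lowerbound[OF \<phi>_lim]) (use ref_mono in \<open>auto simp: eventually_at_top_linorder\<close>)

lemma ref_lt: "x \<ge> 0 \<Longrightarrow> \<phi> x < ap"
proof (rule ccontr)
  assume x: "x \<ge> 0" "\<not> \<phi> x < ap"
  then have "overshoots a0 ap \<phi> p0"
    by (intro overshoots_if_hits[OF o0 \<alpha> ref_no_turn, of x]) auto
  then show False using ref_le unfolding overshoots_def by fastforce
qed

lemma ref_pos: "x > 0 \<Longrightarrow> p0 x > 0"
  by (rule slope_pos_no_turn[OF o0 \<alpha> ref_no_turn, of "x + 1"]) (use ref_lt in auto)

lemma ref_strict_mono: "0 \<le> s \<Longrightarrow> s < t \<Longrightarrow> \<phi> s < \<phi> t"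
  by (rule DERIV_pos_imp_increasing_open[of s t \<phi>]) (use O0(5,7) ref_pos in \<open>auto, meson le_less_trans\<close>)

lemma ref_ge: "x \<ge> 0 \<Longrightarrow> \<alpha> \<le> \<phi> x"
  using ref_mono[of 0 x] O0(1) by simp

lemma ref_exceeds: "z < ap \<Longrightarrow> \<exists>x\<ge>0. z < \<phi> x"
proof -
  assume "z < ap"
  then have "\<forall>\<^sub>F x in at_top. z < \<phi> x \<and> x \<ge> 0"
    by (intro eventually_conj order_tendstoD(1)[OF \<phi>_lim] eventually_ge_at_top)
  then show ?thesis using eventually_happens'[OF trivial_limit_at_top_linorder] by blast
qed

text \<open>The inverse of the profile, that is, position as a function of height; it is meaningful
  for heights in \<open>{\<alpha>..<ap}\<close>.\<close>

definition \<sigma> :: "real \<Rightarrow> real" where "\<sigma> z = (THE s. s \<ge> 0 \<and> \<phi> s = z)"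

lemma \<sigma>_\<phi>: "s \<ge> 0 \<Longrightarrow> \<sigma> (\<phi> s) = s"
  unfolding \<sigma>_def
  by (rule the_equality) (use ref_strict_mono in \<open>auto, metis linorder_neqE_linordered_idom order_less_irrefl\<close>)

lemma \<phi>_surj: "\<alpha> \<le> z \<Longrightarrow> z \<le> \<phi> X \<Longrightarrow> X \<ge> 0 \<Longrightarrow> \<exists>s\<in>{0..X}. \<phi> s = z"
  using IVT'[of \<phi> 0 z X] O0 by auto

lemma \<sigma>: assumes "\<alpha> \<le> z" "z < ap" shows "\<sigma> z \<ge> 0" "\<phi> (\<sigma> z) = z"
proof -
  obtain X where "X \<ge> 0" "z < \<phi> X" using ref_exceeds assms by blast
  then obtain s where "s \<ge> 0" "\<phi> s = z" using \<phi>_surj[of z X] assms by auto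
  then show "\<sigma> z \<ge> 0" "\<phi> (\<sigma> z) = z" using \<sigma>_\<phi> by auto
qed

lemma \<sigma>_pos: assumes "\<alpha> < z" "z < ap" shows "\<sigma> z > 0"
  using \<sigma>[of z] assms O0(1) by (cases "\<sigma> z = 0") auto

text \<open>The inverse of a continuous injection on a compact set is continuous. Near a given
  height only a compact piece \<open>{0..X}\<close> of the half-line is involved.\<close>

lemma \<sigma>_cont: "continuous_on {\<alpha>..<ap} \<sigma>"
proof (subst continuous_on_eq_continuous_within, intro ballI)
  fix z assume z: "z \<in> {\<alpha>..<ap}"
  obtain X where X: "X \<ge> 0" "z < \<phi> X" using ref_exceeds z by auto
  have im: "\<phi> ` {0..X} = {\<alpha>..\<phi> X}" using ref_ge ref_mono X \<phi>_surj by (auto, metis atLeastAtMost_iff imageI)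
  have "continuous_on (\<phi> ` {0..X}) \<sigma>"
    by (rule continuous_on_inv) (use O0 \<sigma>_\<phi> in auto)
  then have "continuous (at z within {\<alpha>..\<phi> X}) \<sigma>"
    using im z X by (simp add: continuous_on_eq_continuous_within)
  moreover have "at z within {\<alpha>..\<phi> X} = at z within {\<alpha>..<ap}"
    by (rule at_within_nhd[of _ "{..<\<phi> X}"]) (use z X ref_lt[of X] in auto)
  ultimately show "continuous (at z within {\<alpha>..<ap}) \<sigma>" by simp
qed

definition y :: "real \<Rightarrow> real" where "y z = (p0 (\<sigma> z))\<^sup>2"

lemma y_\<alpha>: "y \<alpha> = 0"
  using \<sigma>_\<phi>[of 0] O0(1,2) by (simp add: y_def)

lemma y_pos: "\<alpha> < z \<Longrightarrow> z < ap \<Longrightarrow> y z > 0"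
  unfolding y_def by (intro zero_less_power ref_pos \<sigma>_pos)

lemma y_cont: "continuous_on {\<alpha>..<ap} y"
  unfolding y_def
  by (intro continuous_intros continuous_on_compose2[OF O0(4) \<sigma>_cont]) (use \<sigma> in auto)

text \<open>Differentiating with respect to height divides by the slope; for the squared slope this
  factor cancels and leaves a formula without the singularity at slope zero.\<close>

lemma DERIV_y:
  assumes z: "\<alpha> < z" "z < ap"
  shows "(y has_real_derivative 2 * (k * p0 (\<sigma> z) + g z)) (at z)"
proof -
  have sp: "\<sigma> z > 0" by (rule \<sigma>_pos[OF z])
  have pp: "p0 (\<sigma> z) > 0" by (rule ref_pos[OF sp])
  have "continuous_on {\<alpha><..<ap} \<sigma>" by (rule continuous_on_subset[OF \<sigma>_cont]) auto
  then have "isCont \<sigma> z" using z by (simp add: continuous_on_eq_continuous_at)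
  then have ds: "(\<sigma> has_real_derivative inverse (p0 (\<sigma> z))) (at z)"
    by (intro DERIV_inverse_function[where f = \<phi> and g = \<sigma> and x = z, OF O0(5)[OF sp] _ z]) (use pp \<sigma> in auto)
  from DERIV_chain2[OF O0(6)[OF sp] ds]
  have dp: "((\<lambda>z. p0 (\<sigma> z)) has_real_derivative (k * p0 (\<sigma> z) + g z) * inverse (p0 (\<sigma> z))) (at z)"
    using \<sigma>[of z] z by simp
  have "((\<lambda>z. (p0 (\<sigma> z))\<^sup>2) has_real_derivative 2 * p0 (\<sigma> z) * ((k * p0 (\<sigma> z) + g z) * inverse (p0 (\<sigma> z)))) (at z)"
    by (auto intro!: derivative_eq_intros dp)
  moreover have "2 * p0 (\<sigma> z) * ((k * p0 (\<sigma> z) + g z) * inverse (p0 (\<sigma> z))) = 2 * (k * p0 (\<sigma> z) + g z)"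
    using pp by (simp add: field_simps)
  ultimately show ?thesis unfolding y_def[abs_def] by (rule DERIV_cong)
qed

lemma y_small:
  assumes e: "e > 0"
  obtains z0 where "\<alpha> \<le> z0" "z0 < ap" "\<And>z. z0 \<le> z \<Longrightarrow> z < ap \<Longrightarrow> y z < e"
proof -
  have "((\<lambda>x. (p0 x)\<^sup>2) \<longlongrightarrow> 0) at_top" using tendsto_power[OF p0_lim, of 2] by simp
  then have "\<forall>\<^sub>F x in at_top. (p0 x)\<^sup>2 < e" using e by (rule order_tendstoD(2))
  then obtain X where X: "\<And>x. x \<ge> X \<Longrightarrow> (p0 x)\<^sup>2 < e" unfolding eventually_at_top_linorder by blast
  define x0 where "x0 = max X 0"
  show ?thesis
  proof (rule that[of "\<phi> x0"])
    show "\<alpha> \<le> \<phi> x0" "\<phi> x0 < ap" using ref_ge ref_lt by (auto simp: x0_def)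
    fix z assume z: "\<phi> x0 \<le> z" "z < ap"
    then have z': "\<alpha> \<le> z" using \<open>\<alpha> \<le> \<phi> x0\<close> by simp
    have "\<sigma> z \<ge> x0"
    proof (rule ccontr)
      assume "\<not> \<sigma> z \<ge> x0"
      then have "\<phi> (\<sigma> z) < \<phi> x0" using ref_strict_mono[of "\<sigma> z" x0] \<sigma>[OF z' z(2)] by simp
      then show False using \<sigma>(2)[OF z' z(2)] z by simp
    qed
    then show "y z < e" using X[of "\<sigma> z"] by (simp add: y_def x0_def)
  qed
qed

section \<open>Comparison with orbits of the same speed\<close>

context
  fixes \<beta> \<psi> p
  assumes o: "orbit g k \<beta> \<psi> p" and \<beta>: "am < \<beta>" "\<beta> < a0"
begin

lemmas O' = orbitD[OF o]

text \<open>In the phase plane, \<open>E\<close> compares the orbit with the reference orbit, which is the curve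
  \<open>p\<^sup>2 = y\<close>. Both satisfy \<open>(p\<^sup>2)' = 2 (k p + g)\<close> as functions of the first coordinate, so that
  \<open>E' = 2 k (p - sqrt y)\<close> there has the sign of \<open>E\<close>, and orbits with the same speed separate.\<close>

definition E :: "real \<Rightarrow> real" where "E x = (p x)\<^sup>2 - y (\<psi> x)"

lemma E_cont:
  assumes "0 \<le> x1" "\<And>x. x1 \<le> x \<Longrightarrow> x \<le> x2 \<Longrightarrow> \<alpha> \<le> \<psi> x \<and> \<psi> x < ap"
  shows "continuous_on {x1..x2} E"
  unfolding E_def
  by (intro continuous_intros O' continuous_on_compose2[OF y_cont]) (use assms in auto)

lemma E_sq_mono:
  assumes x: "0 \<le> x1" "x1 \<le> x2" and r: "\<And>x. x1 \<le> x \<Longrightarrow> x \<le> x2 \<Longrightarrow> \<alpha> \<le> \<psi> x \<and> \<psi> x < ap"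
    and i: "\<And>x. x1 < x \<Longrightarrow> x < x2 \<Longrightarrow> \<alpha> < \<psi> x \<and> 0 \<le> p x"
  shows "(E x1)\<^sup>2 \<le> (E x2)\<^sup>2"
proof (rule mono_open[of x1 x2 "\<lambda>x. (E x)\<^sup>2" "\<lambda>x. 4 * k * p x * (p x - p0 (\<sigma> (\<psi> x)))\<^sup>2 * (p x + p0 (\<sigma> (\<psi> x)))"])
  show "continuous_on {x1..x2} (\<lambda>x. (E x)\<^sup>2)" by (intro continuous_intros E_cont x r)
  fix s assume s: "x1 < s" "s < x2"
  let ?P = "p0 (\<sigma> (\<psi> s))"
  have s0: "s > 0" using s x by simp
  have rr: "\<alpha> < \<psi> s" "\<psi> s < ap" using r[of s] i[OF s] s by auto
  have "((\<lambda>x. y (\<psi> x)) has_real_derivative 2 * (k * ?P + g (\<psi> s)) * p s) (at s)"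
    by (rule DERIV_chain2[OF DERIV_y[OF rr] O'(5)[OF s0]])
  moreover have "((\<lambda>x. (p x)\<^sup>2) has_real_derivative 2 * p s * (k * p s + g (\<psi> s))) (at s)"
    by (auto intro!: derivative_eq_intros O'(6)[OF s0])
  ultimately have "(E has_real_derivative 2 * p s * (k * p s + g (\<psi> s)) - 2 * (k * ?P + g (\<psi> s)) * p s) (at s)"
    unfolding E_def[abs_def] by (intro DERIV_diff)
  then have dE: "((\<lambda>x. (E x)\<^sup>2) has_real_derivative 2 * E s * (2 * p s * (k * p s + g (\<psi> s)) - 2 * (k * ?P + g (\<psi> s)) * p s)) (at s)"
    by (auto intro!: derivative_eq_intros)
  have eq: "2 * E s * (2 * p s * (k * p s + g (\<psi> s)) - 2 * (k * ?P + g (\<psi> s)) * p s)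
      = 4 * k * p s * (p s - ?P)\<^sup>2 * (p s + ?P)"
    unfolding E_def y_def by (simp add: power2_eq_square algebra_simps)
  show "((\<lambda>x. (E x)\<^sup>2) has_real_derivative 4 * k * p s * (p s - ?P)\<^sup>2 * (p s + ?P)) (at s)"
    by (rule DERIV_cong[OF dE eq])
  have "?P \<ge> 0" using p0_nn \<sigma>(1)[of "\<psi> s"] rr by simp
  then show "0 \<le> 4 * k * p s * (p s - ?P)\<^sup>2 * (p s + ?P)" using i[OF s] k by simp
qed (use x in auto)

text \<open>A sign change would produce a zero of \<open>E\<close>, contradicting that its square
  does not decrease from a positive value. With the sign fixed, monotonicity of the square is
  monotonicity of \<open>E\<close> away from 0.\<close>

lemma E_sign:
  assumes x: "0 \<le> x1" "x1 \<le> x2" and r: "\<And>x. x1 \<le> x \<Longrightarrow> x \<le> x2 \<Longrightarrow> \<alpha> \<le> \<psi> x \<and> \<psi> x < ap"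
    and i: "\<And>x. x1 < x \<Longrightarrow> x < x2 \<Longrightarrow> \<alpha> < \<psi> x \<and> 0 \<le> p x"
  shows "E x1 > 0 \<Longrightarrow> E x1 \<le> E x2" "E x1 < 0 \<Longrightarrow> E x2 \<le> E x1"
proof -
  have sq: "(E x1)\<^sup>2 \<le> (E x)\<^sup>2" if "x1 \<le> x" "x \<le> x2" for x
    by (rule E_sq_mono) (use x r i that in auto)
  have c: "continuous_on {x1..x2} E" by (rule E_cont) (use x r in auto)
  show "E x1 \<le> E x2" if pos: "E x1 > 0"
  proof -
    have "E x2 > 0"
    proof (rule ccontr)
      assume "\<not> E x2 > 0"
      then obtain s where "x1 \<le> s" "s \<le> x2" "E s = 0" using IVT2'[of E x2 0 x1] pos x c by auto
      then show False using sq[of s] pos by simp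
    qed
    then show ?thesis using sq[of x2] x power2_le_imp_le[of "E x1" "E x2"] by simp
  qed
  show "E x2 \<le> E x1" if neg: "E x1 < 0"
  proof -
    have "E x2 < 0"
    proof (rule ccontr)
      assume "\<not> E x2 < 0"
      then obtain s where "x1 \<le> s" "s \<le> x2" "E s = 0" using IVT'[of E x1 0 x2] neg x c by auto
      then show False using sq[of s] neg by simp
    qed
    then show ?thesis using sq[of x2] x power2_le_imp_le[of "- E x1" "- E x2"] by simp
  qed
qed

text \<open>On passing height \<alpha> the orbit has positive slope while the reference wave has
  slope zero, so \<open>E\<close> starts positive and does not decrease. It cannot turn back, since
  \<open>E\<close> is at most 0 where the slope vanishes; and since its slope stays at least
  \<open>p x1\<close>, it cannot remain below \<open>ap\<close>.\<close>

lemma overshoots_if_less: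
  assumes less: "\<beta> < \<alpha>"
  shows "overshoots a0 ap \<psi> p"
proof -
  obtain xa where xa: "xa > 0" "\<psi> xa > a0" using reaches_a0[OF o \<beta>] k by auto
  obtain xb where xb: "0 < xb" "\<psi> xb = a0" "\<And>s. 0 \<le> s \<Longrightarrow> s < xb \<Longrightarrow> \<psi> s < a0"
    by (rule first_hit[of 0 xa \<psi> a0]) (use O' xa \<beta> in auto)
  obtain x1 where x1: "0 < x1" "x1 \<le> xb" "\<psi> x1 = \<alpha>" "\<And>s. 0 \<le> s \<Longrightarrow> s < x1 \<Longrightarrow> \<psi> s < \<alpha>"
    by (rule first_hit[of 0 xb \<psi> \<alpha>]) (use O' xb less \<alpha> in auto)
  have x1b: "x1 < xb" using x1 xb \<alpha> by (cases "x1 = xb") auto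
  have pb: "p s > 0" if "0 < s" "s \<le> xb" for s
    by (rule slope_pos_below[OF o \<beta> that(1)]) (use xb that in \<open>auto intro: less_imp_le\<close>)
  have E1: "E x1 = (p x1)\<^sup>2" using x1 y_\<alpha> by (simp add: E_def)
  have p1: "p x1 > 0" using pb x1 by simp
  have E1p: "E x1 > 0" using E1 p1 by simp
  have strict: "\<alpha> < \<psi> x" if "x1 < x" "\<And>s. 0 < s \<Longrightarrow> s < x \<Longrightarrow> p s > 0" for x
  proof -
    have "\<psi> x1 < \<psi> x"
    proof (rule DERIV_pos_imp_increasing_open[OF \<open>x1 < x\<close>])
      show "\<exists>y. (\<psi> has_real_derivative y) (at s) \<and> 0 < y" if "x1 < s" "s < x" for s
        using O'(5)[of s] \<open>\<And>s. 0 < s \<Longrightarrow> s < x \<Longrightarrow> p s > 0\<close>[of s] that x1(1) by (intro exI[of _ "p s"]) auto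
    qed (use O' x1 in auto)
    then show ?thesis using x1 by simp
  qed
  have nt: "\<not> turns_back ap \<psi> p"
  proof
    assume "turns_back ap \<psi> p"
    then obtain x2 where x2: "x2 \<ge> 0" "p x2 < 0" "\<And>s. s \<in> {0..x2} \<Longrightarrow> \<psi> s < ap" by (auto simp: turns_back_def)
    have b2: "xb < x2"
    proof (rule ccontr)
      assume "\<not> xb < x2"
      then show False using pb[of x2] x2 O'(2) by (cases "x2 = 0") auto
    qed
    have "continuous_on {xb..x2} (\<lambda>s. - p s)" using O'(8)[of xb x2] xb by (intro continuous_intros) auto
    then obtain x0 where x0: "xb < x0" "x0 \<le> x2" "- p x0 = 0" "\<And>s. xb \<le> s \<Longrightarrow> s < x0 \<Longrightarrow> - p s < 0"
      by (rule first_hit[of xb x2 "\<lambda>s. - p s" 0]) (use b2 x2 pb[of xb] xb in auto)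
    have pp: "p s > 0" if "0 < s" "s < x0" for s using pb[of s] x0(4)[of s] that by (cases "s \<le> xb") auto
    have ps: "\<alpha> < \<psi> s" if "x1 < s" "s \<le> x0" for s by (rule strict) (use pp that in auto)
    have "E x1 \<le> E x0"
    proof (rule E_sign(1)[OF _ _ _ _ E1p])
      show "\<alpha> \<le> \<psi> x \<and> \<psi> x < ap" if "x1 \<le> x" "x \<le> x0" for x
        using that ps[of x] x1 x2(3)[of x] x0 by (cases "x = x1") auto
      show "\<alpha> < \<psi> x \<and> 0 \<le> p x" if "x1 < x" "x < x0" for x using that ps[of x] pp[of x] x1 by auto
    qed (use x1 x1b x0 in auto)
    moreover have "E x0 \<le> 0" using x0(3) by (simp add: E_def y_def)
    ultimately show False using E1p by simp
  qed
  have "\<exists>x\<ge>0. \<psi> x \<ge> ap"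
  proof (rule ccontr)
    assume "\<not> ?thesis"
    then have lt: "\<And>x. x \<ge> 0 \<Longrightarrow> \<psi> x < ap" by force
    have pp: "p s > 0" if "0 < s" for s
      by (rule slope_pos_no_turn[OF o \<beta> nt, of "s + 1"]) (use lt that in auto)
    have pge: "p x1 \<le> p x" if "x > x1" for x
    proof -
      have "E x1 \<le> E x"
      proof (rule E_sign(1)[OF _ _ _ _ E1p])
        show "\<alpha> \<le> \<psi> s \<and> \<psi> s < ap" if "x1 \<le> s" "s \<le> x" for s
          using that strict[of s] pp lt[of s] x1 by (cases "s = x1") auto
        show "\<alpha> < \<psi> s \<and> 0 \<le> p s" if "x1 < s" "s < x" for s using that strict[of s] pp x1 by (auto intro: less_imp_le)
      qed (use x1 that in auto)
      then have "(p x1)\<^sup>2 \<le> (p x)\<^sup>2" using E1 zero_le_power2[of "p0 (\<sigma> (\<psi> x))"] unfolding E_def[of x] y_def by linarith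
      then show ?thesis using power2_le_imp_le[of "p x1" "p x"] pp[of x] x1 that by simp
    qed
    \<comment> \<open>The time by which constant slope \<open>p x1\<close> would lift the orbit from
      \<alpha> to \<open>ap\<close>.\<close>
    define X where "X = x1 + (ap - \<alpha>) / p x1"
    have X: "x1 \<le> X" using p1 \<alpha> order by (simp add: X_def)
    have "\<psi> x1 + p x1 * (X - x1) \<le> \<psi> X"
      by (rule linear_growth[of x1 \<psi> p]) (use O'(3,5) pge X x1 in \<open>auto elim: continuous_on_subset\<close>)
    then have "ap \<le> \<psi> X" using x1 p1 by (simp add: X_def)
    then show False using lt[of X] X x1 by simp
  qed
  then show ?thesis using overshoots_if_hits[OF o \<beta> nt] by blast
qed

text \<open>The orbit starts with \<open>E = - y \<beta>\<close>, and \<open>E\<close> does not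
  increase. Without turning back it would climb to a height \<open>z0\<close> near \<open>ap\<close>
  where \<open>y\<close> is smaller than \<open>y \<beta>\<close>, and the squared slope there,
  \<open>E + y z0\<close>, would be negative.\<close>

lemma turns_back_if_greater:
  assumes gr: "\<alpha> < \<beta>"
  shows "turns_back ap \<psi> p"
proof (rule ccontr)
  assume nt: "\<not> turns_back ap \<psi> p"
  have yb: "y \<beta> > 0" by (rule y_pos) (use gr \<beta> order in auto)
  then obtain z0 where z0: "\<alpha> \<le> z0" "z0 < ap" "\<And>z. z0 \<le> z \<Longrightarrow> z < ap \<Longrightarrow> y z < y \<beta>"
    by (rule y_small) blast
  have bz: "\<beta> < z0" using z0(3)[of \<beta>] \<beta> order by force
  have "\<exists>t\<ge>0. z0 \<le> \<psi> t"
  proof (cases "\<exists>x\<ge>0. \<psi> x \<ge> ap")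
    case True
    then show ?thesis using z0 by force
  next
    case False
    then have "(\<psi> \<longlongrightarrow> ap) at_top" by (intro tendsto_ap[OF o \<beta> nt _ k]) force
    then have "\<forall>\<^sub>F x in at_top. z0 < \<psi> x \<and> x \<ge> 0"
      using z0 by (intro eventually_conj order_tendstoD(1) eventually_ge_at_top)
    from eventually_happens'[OF trivial_limit_at_top_linorder this] obtain t where "z0 < \<psi> t \<and> t \<ge> 0" by blast
    then show ?thesis by (intro exI[of _ t]) auto
  qed
  then obtain t where "t \<ge> 0" "z0 \<le> \<psi> t" by blast
  then obtain x where x: "0 < x" "\<psi> x = z0" "\<And>s. 0 \<le> s \<Longrightarrow> s < x \<Longrightarrow> \<psi> s < z0"
    by (rule_tac first_hit[of 0 t \<psi> z0]) (use O' bz in auto)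
  have pp: "p s > 0" if "0 < s" "s < x" for s
    by (rule slope_pos_no_turn[OF o \<beta> nt _ that]) (use x z0 in force)
  have pn: "0 \<le> p s" if "0 < s" "s < x" for s using pp[OF that] by simp
  have mono: "\<beta> \<le> \<psi> s" if "0 \<le> s" "s \<le> x" for s
  proof -
    have "\<psi> 0 \<le> \<psi> s" by (rule mono_open[of 0 x \<psi> p]) (use O' pn that in auto)
    then show ?thesis using O'(1) by simp
  qed
  have E0: "E 0 = - y \<beta>" using O' by (simp add: E_def)
  have "E x \<le> E 0"
  proof (rule E_sign(2))
    show "\<alpha> \<le> \<psi> s \<and> \<psi> s < ap" if "0 \<le> s" "s \<le> x" for s
      using mono[OF that] x(2) x(3)[of s] gr z0 that by (cases "s = x") auto
    show "\<alpha> < \<psi> s \<and> 0 \<le> p s" if "0 < s" "s < x" for s using mono[of s] gr pp[OF that] that by auto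
  qed (use x yb E0 in auto)
  moreover have "E x = (p x)\<^sup>2 - y z0" by (simp add: E_def x(2))
  ultimately have "y \<beta> \<le> y z0" using E0 zero_le_power2[of "p x"] by linarith
  moreover have "y z0 < y \<beta>" by (rule z0(3)[OF order_refl z0(2)])
  ultimately show False by simp
qed

end

section \<open>A faster wave close to the reference wave\<close>

lemma nearby_faster_wave:
  assumes \<delta>: "\<delta> > 0"
  shows "\<exists>k' \<beta> \<psi> p. k < k' \<and> am < \<beta> \<and> \<beta> < a0 \<and> orbit g k' \<beta> \<psi> p \<and> (\<forall>x\<ge>0. 0 \<le> p x) \<and> (\<forall>x\<ge>0. \<psi> x < ap) \<and>
    (\<psi> \<longlongrightarrow> ap) at_top \<and> \<bar>\<beta> - \<alpha>\<bar> < \<delta> \<and> (\<forall>x\<ge>0. \<bar>\<psi> x - \<phi> x\<bar> < \<delta>)"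
proof -
  \<comment> \<open>Beyond \<open>X\<close> only monotonicity is used. Closeness up to \<delta>/2 at
    \<open>X\<close> puts the new profile above \<open>ap - \<delta>\<close> from there on, and both
    profiles stay below \<open>ap\<close>.\<close>
  obtain X where X: "X \<ge> 0" "ap - \<delta> / 2 < \<phi> X" using ref_exceeds[of "ap - \<delta> / 2"] \<delta> by auto
  obtain d where d: "d > 0" "\<forall>k' \<beta> \<psi> p. orbit g k' \<beta> \<psi> p \<longrightarrow> \<bar>k' - k\<bar> < d \<longrightarrow> \<bar>\<beta> - \<alpha>\<bar> < d \<longrightarrow>
     (\<forall>x\<in>{0..X}. \<bar>\<psi> x - \<phi> x\<bar> < \<delta> / 2 \<and> \<bar>p x - p0 x\<bar> < \<delta> / 2)"
    using orbit_dependence[OF lip o0, of "\<delta> / 2" X] \<delta> by auto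
  have "\<forall>k \<beta>. \<exists>\<psi>p. orbit g k \<beta> (fst \<psi>p) (snd \<psi>p)" using orbit_exists[OF lip] by simp
  \<comment> \<open>One orbit is selected for each speed and level. The selection need not be
    continuous, since the perturbation lemmas speak about all orbits with nearby data.\<close>
  then obtain S where S: "\<And>k \<beta>. orbit g k \<beta> (fst (S k \<beta>)) (snd (S k \<beta>))" by metis
  \<comment> \<open>The half-width of the shooting interval: within the tolerance of continuous
    dependence, below \<delta>, and small enough to keep all levels between \<open>am\<close> and
    \<open>a0\<close>.\<close>
  define \<eta> where "\<eta> = min (min d \<delta>) (min (\<alpha> - am) (a0 - \<alpha>)) / 2"
  have \<eta>: "0 < \<eta>" "\<eta> < d" "\<eta> < \<delta>" "am < \<alpha> - \<eta>" "\<alpha> + \<eta> < a0"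
  proof -
    define m where "m = min (min d \<delta>) (min (\<alpha> - am) (a0 - \<alpha>))"
    have "0 < m" "m \<le> d" "m \<le> \<delta>" "m \<le> \<alpha> - am" "m \<le> a0 - \<alpha>" using d(1) \<delta> \<alpha> by (auto simp: m_def)
    moreover have "\<eta> = m / 2" by (simp add: \<eta>_def m_def)
    ultimately show "0 < \<eta>" "\<eta> < d" "\<eta> < \<delta>" "am < \<alpha> - \<eta>" "\<alpha> + \<eta> < a0" by linarith+
  qed
  have "overshoots a0 ap (fst (S k (\<alpha> - \<eta>))) (snd (S k (\<alpha> - \<eta>)))"
    by (rule overshoots_if_less[OF S]) (use \<eta> \<alpha> in auto)
  from overshoots_open[OF S this] obtain dA where dA: "dA > 0"
    "\<forall>k' \<beta> \<psi> p. orbit g k' \<beta> \<psi> p \<longrightarrow> \<bar>k' - k\<bar> < dA \<longrightarrow> \<bar>\<beta> - (\<alpha> - \<eta>)\<bar> < dA \<longrightarrow> overshoots a0 ap \<psi> p" by blast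
  have "turns_back ap (fst (S k (\<alpha> + \<eta>))) (snd (S k (\<alpha> + \<eta>)))"
    by (rule turns_back_if_greater[OF S]) (use \<eta> \<alpha> in auto)
  from turns_back_open[OF S this] obtain dB where dB: "dB > 0"
    "\<forall>k' \<beta> \<psi> p. orbit g k' \<beta> \<psi> p \<longrightarrow> \<bar>k' - k\<bar> < dB \<longrightarrow> \<bar>\<beta> - (\<alpha> + \<eta>)\<bar> < dB \<longrightarrow> turns_back ap \<psi> p" by blast
  \<comment> \<open>A single increase of the speed must respect three tolerances: closeness on
    \<open>{0..X}\<close>, overshooting at the left endpoint of the interval of levels, and turning
    back at the right one.\<close>
  define k' where "k' = k + min d (min dA dB) / 2"
  have k': "k < k'" "\<bar>k' - k\<bar> < d" "\<bar>k' - k\<bar> < dA" "\<bar>k' - k\<bar> < dB" using d(1) dA(1) dB(1) by (auto simp: k'_def min_def)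
  let ?J = "{\<alpha> - \<eta>..\<alpha> + \<eta>}"
  define UA where "UA = {\<beta>. overshoots a0 ap (fst (S k' \<beta>)) (snd (S k' \<beta>))}"
  define UB where "UB = {\<beta>. turns_back ap (fst (S k' \<beta>)) (snd (S k' \<beta>))}"
  have "open UA" unfolding open_dist dist_real_def
  proof
    fix \<beta> assume "\<beta> \<in> UA"
    then have "overshoots a0 ap (fst (S k' \<beta>)) (snd (S k' \<beta>))" by (simp add: UA_def)
    from overshoots_open[OF S this] show "\<exists>e>0. \<forall>\<gamma>. \<bar>\<gamma> - \<beta>\<bar> < e \<longrightarrow> \<gamma> \<in> UA"
      using S unfolding UA_def by (metis (no_types, lifting) abs_zero diff_self mem_Collect_eq)
  qed
  moreover have "open UB" unfolding open_dist dist_real_def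
  proof
    fix \<beta> assume "\<beta> \<in> UB"
    then have "turns_back ap (fst (S k' \<beta>)) (snd (S k' \<beta>))" by (simp add: UB_def)
    from turns_back_open[OF S this] show "\<exists>e>0. \<forall>\<gamma>. \<bar>\<gamma> - \<beta>\<bar> < e \<longrightarrow> \<gamma> \<in> UB"
      using S unfolding UB_def by (metis (no_types, lifting) abs_zero diff_self mem_Collect_eq)
  qed
  moreover have "UA \<inter> UB \<inter> ?J = {}"
    using not_overshoots_and_turns_back[OF S] \<eta> by (fastforce simp: UA_def UB_def)
  moreover have "\<alpha> - \<eta> \<in> UA" unfolding UA_def using dA(2)[rule_format, OF S k'(3)] dA(1) by simp
  moreover have "\<alpha> + \<eta> \<in> UB" unfolding UB_def using dB(2)[rule_format, OF S k'(4)] dB(1) by simp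
  moreover have "\<alpha> - \<eta> \<in> ?J" "\<alpha> + \<eta> \<in> ?J" using \<eta>(1) by auto
  ultimately have "\<not> ?J \<subseteq> UA \<union> UB"
    using connectedD[OF connected_Icc, of UA UB "\<alpha> - \<eta>" "\<alpha> + \<eta>"] by blast
  then obtain \<beta> where \<beta>: "\<beta> \<in> ?J" "\<beta> \<notin> UA" "\<beta> \<notin> UB" by blast
  define \<psi> where "\<psi> = fst (S k' \<beta>)"
  define p where "p = snd (S k' \<beta>)"
  have o: "orbit g k' \<beta> \<psi> p" unfolding \<psi>_def p_def by (rule S)
  have nA: "\<not> overshoots a0 ap \<psi> p" and nt: "\<not> turns_back ap \<psi> p"
    using \<beta> by (auto simp: UA_def UB_def \<psi>_def p_def)
  have b: "am < \<beta>" "\<beta> < a0" using \<beta> \<eta> by auto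
  have lt: "\<psi> x < ap" if "x \<ge> 0" for x using overshoots_if_hits[OF o b nt that] nA by force
  have lim: "(\<psi> \<longlongrightarrow> ap) at_top" by (rule tendsto_ap[OF o b nt lt]) (use k k' in auto)
  have pp: "p x > 0" if "x > 0" for x
    by (rule slope_pos_no_turn[OF o b nt, of "x + 1"]) (use lt that in auto)
  then have pn: "p x \<ge> 0" if "x \<ge> 0" for x using orbitD(2)[OF o] that by (cases "x = 0") (auto intro: less_imp_le)
  have mono: "\<psi> s \<le> \<psi> t" if "0 \<le> s" "s \<le> t" for s t
    by (rule mono_open[of 0 t \<psi> p]) (use orbitD[OF o] pn that in auto)
  have "\<bar>\<beta> - \<alpha>\<bar> \<le> \<eta>" using \<beta>(1) by auto
  then have close: "\<bar>\<psi> x - \<phi> x\<bar> < \<delta> / 2" if "x \<in> {0..X}" for x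
    using d(2)[rule_format, OF o k'(2)] \<eta>(2) that by auto
  have "\<bar>\<psi> x - \<phi> x\<bar> < \<delta>" if x: "x \<ge> 0" for x
  proof (cases "x \<le> X")
    case True
    then show ?thesis using close[of x] x \<delta> by auto
  next
    case False
    then have "\<psi> X \<le> \<psi> x" "\<phi> X \<le> \<phi> x" using mono ref_mono X(1) by auto
    moreover have "\<phi> X - \<delta> / 2 < \<psi> X" using abs_less_iff[THEN iffD1, OF close[of X]] X(1) by simp
    ultimately show ?thesis using lt[OF x] ref_lt[OF x] X(2) \<delta> unfolding abs_less_iff by (intro conjI) linarith+
  qed
  then show ?thesis using k'(1) b o pn lt lim \<open>\<bar>\<beta> - \<alpha>\<bar> \<le> \<eta>\<close> \<eta>(3) by (intro exI[of _ k'] exI[of _ \<beta>] exI[of _ \<psi>] exI[of _ p]) auto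
qed

end

section \<open>Instability\<close>

text \<open>By the fundamental theorem with finitely many exceptions, \<open>v\<close> is a
  primitive of the continuous function \<open>w\<close>, hence differentiable at the exceptional
  points too.\<close>

lemma DERIV_if_punctured:
  fixes v w :: "real \<Rightarrow> real"
  assumes F: "finite F" and v: "continuous_on UNIV v" and w: "continuous_on UNIV w"
    and d: "\<And>x. x \<notin> F \<Longrightarrow> (v has_real_derivative w x) (at x)"
  shows "(v has_real_derivative w x) (at x)"
proof -
  have wi: "w integrable_on {x - 1..y}" for y
    by (intro integrable_continuous_real continuous_on_subset[OF w]) auto
  have eq: "v y = v (x - 1) + integral {x - 1..y} w" if "y \<ge> x - 1" for y
  proof -
    have "(w has_integral (v y - v (x - 1))) {x - 1..y}"
      by (rule fundamental_theorem_of_calculus_interior_strong[OF F that])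
        (use d v in \<open>auto simp: has_real_derivative_iff_has_vector_derivative[symmetric] elim: continuous_on_subset\<close>)
    then show ?thesis by (simp add: integral_unique)
  qed
  have "((\<lambda>y. integral {x - 1..y} w) has_real_derivative w x) (at x within {x - 1..x + 1})"
    by (rule integral_has_real_derivative) (auto intro: continuous_on_subset[OF w])
  then have "((\<lambda>y. integral {x - 1..y} w) has_real_derivative w x) (at x)"
    using at_within_interior[of x "{x - 1..x + 1}"] by simp
  then have "((\<lambda>y. v (x - 1) + integral {x - 1..y} w) has_real_derivative w x) (at x)"
    by (auto intro!: derivative_eq_intros)
  then show ?thesis
  proof (rule has_field_derivative_transform_within_open[of _ _ _ "{x - 1<..}"])
    show "v (x - 1) + integral {x - 1..y} w = v y" if "y \<in> {x - 1<..}" for y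
      using eq[of y] that by simp
  qed auto
qed

lemma C1_lipschitz_on_interval:
  fixes f :: "real \<Rightarrow> real"
  assumes "f C1_differentiable_on UNIV"
  obtains M where "\<And>x y. x \<in> {a..b} \<Longrightarrow> y \<in> {a..b} \<Longrightarrow> \<bar>f x - f y\<bar> \<le> M * \<bar>x - y\<bar>"
proof -
  obtain D where D: "\<And>x. (f has_real_derivative D x) (at x)" "continuous_on UNIV D"
    using assms unfolding C1_differentiable_on_def by (auto simp: has_real_derivative_iff_has_vector_derivative)
  have "compact (D ` {a..b})" by (intro compact_continuous_image continuous_on_subset[OF D(2)]) auto
  then obtain M where M: "\<And>x. x \<in> {a..b} \<Longrightarrow> \<bar>D x\<bar> \<le> M"
    using compact_imp_bounded bounded_iff by (metis imageI real_norm_def)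
  have "norm (f x - f y) \<le> M * norm (x - y)" if "x \<in> {a..b}" "y \<in> {a..b}" for x y
    by (rule field_differentiable_bound[of "{a..b}" f D]) (use that M D(1) in \<open>auto intro: has_field_derivative_at_within\<close>)
  then show ?thesis using that by (metis real_norm_def)
qed

section \<open>Classical regularity of the given wave\<close>

lemma weak_second_derivative_classical:
  fixes v h :: "real \<Rightarrow> real"
  assumes W: "has_weak_deriv UNIV v w" and v: "continuous_on UNIV v" and h: "continuous_on UNIV h"
    and ae: "AE x in lebesgue. x > 0 \<longrightarrow> w x = h x" and x: "x > 0"
  shows "(v has_real_derivative h x) (at x)"
proof -
  \<comment> \<open>Increments of \<open>v\<close> are integrals of its weak derivative, which
    agrees a.e. with the continuous function \<open>h\<close> on the positive half-line;
    \<open>v\<close> is therefore a primitive of \<open>h\<close> there.\<close>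
  have FTC: "integral {c..d} h = v d - v c" if cd: "0 < c" "c < d" for c d
  proof -
    have lw: "w absolutely_integrable_on {c..d}" using W by (simp add: has_weak_deriv_def locally_integrable_def)
    have lh: "h absolutely_integrable_on {c..d}"
      by (rule continuous_imp_absolutely_integrable_compact[OF continuous_on_subset[OF h]]) auto
    have "(LINT x:{c..d}|lebesgue. w x) = (LINT x:{c..d}|lebesgue. h x)"
      unfolding set_lebesgue_integral_def
    proof (rule integral_cong_AE)
      show "AE x in lebesgue. indicat_real {c..d} x *\<^sub>R w x = indicat_real {c..d} x *\<^sub>R h x"
        using ae by (rule eventually_mono) (use cd in \<open>auto simp: indicator_def\<close>)
    qed (use lw lh in \<open>auto simp: set_integrable_def\<close>)
    then show ?thesis
      using weak_deriv_FTC[OF open_UNIV W v cd(2)] set_lebesgue_integral_eq_integral(2)[OF lh] by simp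
  qed
  have "((\<lambda>y. integral {x/2..y} h) has_real_derivative h x) (at x within {x/2..x + 1})"
    by (rule integral_has_real_derivative) (use x in \<open>auto intro: continuous_on_subset[OF h]\<close>)
  then have "((\<lambda>y. integral {x/2..y} h) has_real_derivative h x) (at x)"
    using at_within_interior[of x "{x/2..x + 1}"] x by simp
  then have "((\<lambda>y. v (x/2) + integral {x/2..y} h) has_real_derivative h x) (at x)"
    by (auto intro!: derivative_eq_intros)
  then show ?thesis
    by (rule has_field_derivative_transform_within_open[of _ _ _ "{x/2<..}"]) (use FTC x in auto)
qed

text \<open>To the right of the contact point the profile lies above the obstacle, where the
  subdifferential is \<open>{0}\<close>, so the inclusion is an equation with continuous right-hand
  side. At 0 the slope vanishes because it is continuous and zero on the left.\<close>

lemma traveling_wave_classical: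
  assumes f: "f C1_differentiable_on UNIV" and tw: "traveling_wave f ap \<alpha> c \<phi>"
  shows "\<And>x. (\<phi> has_real_derivative deriv \<phi> x) (at x)" "continuous_on UNIV (deriv \<phi>)"
    "\<And>x. x > 0 \<Longrightarrow> (deriv \<phi> has_real_derivative (- c * deriv \<phi> x + f (\<phi> x))) (at x)"
    "\<phi> 0 = \<alpha>" "deriv \<phi> 0 = 0"
proof -
  note T = tw[unfolded traveling_wave_def]
  obtain D where D: "\<And>x. (\<phi> has_real_derivative D x) (at x)" "continuous_on UNIV D"
    using T unfolding C1_differentiable_on_def by (auto simp: has_real_derivative_iff_has_vector_derivative)
  then have e: "deriv \<phi> = D" by (auto intro: DERIV_imp_deriv)
  show d: "\<And>x. (\<phi> has_real_derivative deriv \<phi> x) (at x)" and dc: "continuous_on UNIV (deriv \<phi>)"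
    using D e by auto
  have \<phi>c: "continuous_on UNIV \<phi>" using d by (meson DERIV_isCont continuous_at_imp_continuous_on)
  have fc: "continuous_on UNIV f" by (rule differentiable_imp_continuous_on[OF C1_diff_imp_diff[OF f]])
  show "\<phi> 0 = \<alpha>" using T by auto
  have "deriv \<phi> x = 0" if "x < 0" for x
  proof -
    have "(\<phi> has_real_derivative 0) (at x)"
      by (rule DERIV_zero_if_locally_constant[of "{..<0}"]) (use that T in auto)
    then show ?thesis by (rule DERIV_imp_deriv)
  qed
  then have "\<forall>\<^sub>F x in at_left 0. deriv \<phi> x = 0" by (auto simp: eventually_at_filter)
  moreover have "(deriv \<phi> \<longlongrightarrow> deriv \<phi> 0) (at_left 0)"
    using dc by (auto simp: continuous_on_def intro: tendsto_within_subset)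
  ultimately have "((\<lambda>_. 0) \<longlongrightarrow> deriv \<phi> 0) (at_left (0::real))" by (rule Lim_transform_eventually[rotated])
  then show "deriv \<phi> 0 = 0" using tendsto_unique[OF trivial_limit_at_left_real _ tendsto_const] by metis
  obtain w w2 where w: "has_weak_deriv UNIV \<phi> w" "has_weak_deriv UNIV w w2"
    using T by (auto simp: W_inf_def numeral_2_eq_2)
  have "has_weak_deriv UNIV \<phi> (deriv \<phi>)"
    by (rule has_weak_derivI[of _ "{}"]) (use \<phi>c d dc locally_integrable_continuous in auto)
  from weak_deriv_unique[OF open_UNIV \<phi>c w(1) this]
  have ae1: "AE x in lebesgue. x \<in> UNIV \<longrightarrow> w x = deriv \<phi> x" .
  have "has_weak_deriv UNIV (deriv \<phi>) w2"
    by (rule has_weak_deriv_cong_AE[OF open_UNIV w(2) _ _ ae1])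
      (use dc locally_integrable_continuous w(2) in \<open>auto simp: has_weak_deriv_def\<close>)
  then have W: "has_weak_deriv UNIV (deriv \<phi>) (weak_deriv UNIV (deriv \<phi>))" by (rule has_weak_deriv_weak_deriv)
  have ae: "AE x in lebesgue. x > 0 \<longrightarrow> weak_deriv UNIV (deriv \<phi>) x = - c * deriv \<phi> x + f (\<phi> x)"
  proof -
    let ?S = "\<lambda>x. {- c * deriv \<phi> x - weak_deriv UNIV (deriv \<phi>) x + \<xi> + f (\<phi> x) |\<xi>.
                                \<xi> \<in> subdiff_indicator \<alpha> (\<phi> x)}"
    have "AE x in lebesgue. 0 \<in> ?S x" using T by blast
    then show ?thesis
    proof (rule eventually_mono, intro impI)
      fix x :: real assume a: "0 \<in> ?S x" and x: "x > 0"
      have "\<phi> x > \<alpha>" using T x by blast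
      then show "weak_deriv UNIV (deriv \<phi>) x = - c * deriv \<phi> x + f (\<phi> x)"
        using a by (auto simp: subdiff_indicator_def)
    qed
  qed
  show "(deriv \<phi> has_real_derivative (- c * deriv \<phi> x + f (\<phi> x))) (at x)" if "x > 0" for x
    by (rule weak_second_derivative_classical[OF W dc _ ae that])
      (intro continuous_intros dc continuous_on_compose2[OF fc \<phi>c], auto)
qed

text \<open>Multiplying the profile equation by \<open>deriv \<phi>\<close> and integrating gives \<open>c * \<integral> (deriv \<phi>)\<^sup>2 = \<integral> f\<close>.\<close>

lemma traveling_wave_speed_negative:
  assumes f: "f C1_differentiable_on UNIV" and tw: "traveling_wave f ap \<alpha> c \<phi>" and ap: "\<alpha> < ap"
    and int: "integral {\<alpha>..ap} f < 0"
  shows "c < 0"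
proof (rule ccontr)
  assume "\<not> c < 0"
  then have c: "c \<ge> 0" by simp
  note T = tw[unfolded traveling_wave_def] and C = traveling_wave_classical[OF f tw]
  have fc: "continuous_on UNIV f" by (rule differentiable_imp_continuous_on[OF C1_diff_imp_diff[OF f]])
  have \<phi>c: "continuous_on X \<phi>" for X using C(1) by (meson DERIV_isCont continuous_at_imp_continuous_on)
  have dc: "continuous_on X (deriv \<phi>)" for X using C(2) continuous_on_subset by blast
  define G where "G z = integral {\<alpha>..z} f" for z
  have dG: "(G has_real_derivative f z) (at z)" if "z > \<alpha>" for z
  proof -
    have "(G has_real_derivative f z) (at z within {\<alpha>..z + 1})" unfolding G_def
      by (rule integral_has_real_derivative) (use that in \<open>auto intro: continuous_on_subset[OF fc]\<close>)
    then show ?thesis using at_within_interior[of z "{\<alpha>..z + 1}"] that by simp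
  qed
  have Gc: "continuous_on {\<alpha>..b} G" for b unfolding G_def
    by (rule indefinite_integral_continuous_1) (intro integrable_continuous_real continuous_on_subset[OF fc], auto)
  have ge: "\<phi> x \<ge> \<alpha>" for x using T by (cases "x \<le> 0") (auto intro: less_imp_le)
  \<comment> \<open>For nonnegative \<open>c\<close> the energy
    \<open>G (\<phi> x) - (deriv \<phi> x)\<^sup>2 / 2\<close> is nondecreasing and starts at 0.
    Arguing on finite intervals and letting \<open>X\<close> grow avoids integrals over the
    half-line.\<close>
  have nonneg: "0 \<le> G (\<phi> X)" if "X \<ge> 0" for X
  proof -
    have "compact (\<phi> ` {0..X})" by (intro compact_continuous_image \<phi>c) auto
    then obtain B where B: "\<And>x. x \<in> {0..X} \<Longrightarrow> \<bar>\<phi> x\<bar> \<le> B"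
      using compact_imp_bounded bounded_iff by (metis imageI real_norm_def)
    have "G (\<phi> 0) - (deriv \<phi> 0)\<^sup>2 / 2 \<le> G (\<phi> X) - (deriv \<phi> X)\<^sup>2 / 2"
    proof (rule mono_open[of 0 X "\<lambda>x. G (\<phi> x) - (deriv \<phi> x)\<^sup>2 / 2" "\<lambda>x. c * (deriv \<phi> x)\<^sup>2"])
      show "continuous_on {0..X} (\<lambda>x. G (\<phi> x) - (deriv \<phi> x)\<^sup>2 / 2)"
        by (intro continuous_intros dc continuous_on_compose2[OF Gc[of B] \<phi>c]) (use ge B in \<open>fastforce+\<close>)
      fix x assume x: "0 < x" "x < X"
      have "\<phi> x > \<alpha>" using T x by blast
      from DERIV_chain2[OF dG[OF this] C(1)]
      have "((\<lambda>x. G (\<phi> x)) has_real_derivative f (\<phi> x) * deriv \<phi> x) (at x)" .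
      moreover have "((\<lambda>x. (deriv \<phi> x)\<^sup>2 / 2) has_real_derivative deriv \<phi> x * (- c * deriv \<phi> x + f (\<phi> x))) (at x)"
        by (auto intro!: derivative_eq_intros C(3)[OF x(1)])
      ultimately have "((\<lambda>x. G (\<phi> x) - (deriv \<phi> x)\<^sup>2 / 2) has_real_derivative
          f (\<phi> x) * deriv \<phi> x - deriv \<phi> x * (- c * deriv \<phi> x + f (\<phi> x))) (at x)" by (rule DERIV_diff)
      then show "((\<lambda>x. G (\<phi> x) - (deriv \<phi> x)\<^sup>2 / 2) has_real_derivative c * (deriv \<phi> x)\<^sup>2) (at x)"
        by (rule DERIV_cong) (simp add: power2_eq_square algebra_simps)
    qed (use c that in auto)
    then have "0 \<le> G (\<phi> X) - (deriv \<phi> X)\<^sup>2 / 2" using C(4,5) by (simp add: G_def)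
    moreover have "0 \<le> (deriv \<phi> X)\<^sup>2 / 2" by simp
    ultimately show ?thesis by linarith
  qed
  have "isCont G ap" using dG[OF ap] DERIV_isCont by blast
  moreover have "(\<phi> \<longlongrightarrow> ap) at_top" using T by blast
  ultimately have "((\<lambda>x. G (\<phi> x)) \<longlongrightarrow> G ap) at_top" by (rule isCont_tendsto_compose)
  then have "0 \<le> G ap"
    by (rule tendsto_lowerbound) (use nonneg in \<open>auto simp: eventually_at_top_linorder\<close>)
  then show False using int by (simp add: G_def)
qed

text \<open>The nonlinearity outside of \<open>[am, ap]\<close> is irrelevant; truncating it there makes it globally Lipschitz.\<close>

lemma bistable_truncation:
  assumes f: "f C1_differentiable_on UNIV" and o: "am < a0" "a0 < ap" and z: "f am = 0" "f a0 = 0" "f ap = 0"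
    and pos: "\<forall>z\<in>{am<..<a0}. f z > 0" and neg: "\<forall>z\<in>{a0<..<ap}. f z < 0"
  shows "\<exists>M. bistable (\<lambda>z. f (max am (min ap z))) am a0 ap M"
proof -
  obtain M where M: "\<And>x y. x \<in> {am..ap} \<Longrightarrow> y \<in> {am..ap} \<Longrightarrow> \<bar>f x - f y\<bar> \<le> M * \<bar>x - y\<bar>"
    using C1_lipschitz_on_interval[OF f] by blast
  have "0 \<le> M * \<bar>am - ap\<bar>" using order_trans[OF abs_ge_zero M[of am ap]] o by simp
  \<comment> \<open>Nonnegativity of \<open>M\<close> is needed below, because clamping to
    \<open>[am, ap]\<close> only shrinks distances.\<close>
  then have M0: "M \<ge> 0" using o by (simp add: zero_le_mult_iff)
  have "bistable (\<lambda>z. f (max am (min ap z))) am a0 ap M"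
  proof
    fix x y :: real
    have "\<bar>f (max am (min ap x)) - f (max am (min ap y))\<bar> \<le> M * \<bar>max am (min ap x) - max am (min ap y)\<bar>"
      by (rule M) (use o in auto)
    also have "\<dots> \<le> M * \<bar>x - y\<bar>" by (rule mult_left_mono[OF _ M0]) (auto simp: max_def min_def)
    finally show "\<bar>f (max am (min ap x)) - f (max am (min ap y))\<bar> \<le> M * \<bar>x - y\<bar>" .
  next
    fix z assume "z \<le> a0"
    then have "max am (min ap z) = am \<or> max am (min ap z) = a0 \<or> max am (min ap z) \<in> {am<..<a0}"
      using o by (auto simp: max_def min_def)
    then show "0 \<le> f (max am (min ap z))" using assms(4,5) pos by (auto intro: less_imp_le)
  qed (use assms in \<open>auto simp: max_def min_def\<close>)
  then show ?thesis by blast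
qed

text \<open>The orbit is glued to the constant \<beta>. Since its initial slope is zero, the result
  is C1. On the left the equation holds because \<open>f \<beta>\<close> is nonnegative; on the
  right \<open>q - f (\<Phi> x)\<close> equals \<open>k * p x\<close>, which is nonnegative, so the
  positive part changes nothing.\<close>

lemma wave_solution:
  assumes g: "continuous_on UNIV g" and o: "orbit g k \<beta> \<psi> p" and k: "k \<ge> 0"
    and p: "\<And>x. x \<ge> 0 \<Longrightarrow> p x \<ge> 0" and f\<beta>: "f \<beta> \<ge> 0" and fg: "\<And>x. x > 0 \<Longrightarrow> f (\<psi> x) = g (\<psi> x)"
  shows "solution f (\<lambda>t x. if x + k * t \<le> 0 then \<beta> else \<psi> (x + k * t))"
proof -
  note O = orbitD[OF o]
  define \<Phi> where "\<Phi> x = (if x \<le> 0 then \<beta> else \<psi> x)" for x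
  define \<Phi>' where "\<Phi>' x = (if x \<le> 0 then 0 else p x)" for x
  \<comment> \<open>The second derivative away from 0. It has limit \<open>g \<beta>\<close> from
    the right and 0 from the left, so 0 is put into the exceptional set.\<close>
  define q where "q x = (if x \<le> 0 then 0 else k * \<Phi>' x + g (\<Phi> x))" for x
  have U: "UNIV = {..0} \<union> {0::real..}" by auto
  have c0: "continuous_on UNIV \<Phi>" "continuous_on UNIV c1" if "c1 = \<Phi>'" for c1
    unfolding that \<Phi>_def \<Phi>'_def U by (rule continuous_on_cases; use O in auto)+
  then have c: "continuous_on UNIV \<Phi>" "continuous_on UNIV \<Phi>'" by auto
  have dneg: "(r has_real_derivative 0) (at x)" if "x < 0" "\<And>y. y < 0 \<Longrightarrow> r y = z" for r x z
    by (rule DERIV_zero_if_locally_constant[of "{..<0}"]) (use that in auto)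
  have dpos: "(r has_real_derivative D) (at x)" if "x > 0" "\<And>y. y > 0 \<Longrightarrow> r y = s y" "(s has_real_derivative D) (at x)" for r s x D
    by (rule has_field_derivative_transform_within_open[OF that(3), of "{0<..}"]) (use that in auto)
  have d1': "(\<Phi> has_real_derivative \<Phi>' x) (at x)" if "x \<notin> {0}" for x
  proof (cases "x < 0")
    case True
    then show ?thesis using dneg[OF True, of \<Phi> \<beta>] by (simp add: \<Phi>_def \<Phi>'_def)
  next
    case False
    then show ?thesis using dpos[of x \<Phi> \<psi> "p x"] O(5)[of x] that by (simp add: \<Phi>_def \<Phi>'_def)
  qed
  have d1: "(\<Phi> has_real_derivative \<Phi>' x) (at x)" for x
    by (rule DERIV_if_punctured[where F = "{0}", OF _ c d1']) auto
  have d2: "(\<Phi>' has_real_derivative q x) (at x)" if "x \<notin> {0}" for x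
  proof (cases "x < 0")
    case True
    then show ?thesis using dneg[OF True, of \<Phi>' 0] by (simp add: q_def \<Phi>'_def)
  next
    case False
    then show ?thesis using dpos[of x \<Phi>' p "k * p x + g (\<psi> x)"] O(6)[of x] that
      by (simp add: \<Phi>_def \<Phi>'_def q_def)
  qed
  have rc: "continuous_on UNIV (\<lambda>x. k * \<Phi>' x + g (\<Phi> x))"
    by (intro continuous_intros c continuous_on_compose2[OF g c(1)]) auto
  have qb: "loc_bdd q"
    unfolding loc_bdd_def
  proof (intro conjI allI)
    have "(\<lambda>x. k * \<Phi>' x + g (\<Phi> x)) \<in> borel_measurable borel" by (rule borel_measurable_continuous_onI[OF rc])
    then show "q \<in> borel_measurable borel" unfolding q_def[abs_def] by measurable
    fix a b :: real
    have "bounded ((\<lambda>x. k * \<Phi>' x + g (\<Phi> x)) ` {a..b})" using continuous_loc_bdd[OF rc] by (simp add: loc_bdd_def)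
    then have "bounded (insert 0 ((\<lambda>x. k * \<Phi>' x + g (\<Phi> x)) ` {a..b}))" by simp
    then show "bounded (q ` {a..b})" by (rule bounded_subset) (auto simp: q_def)
  qed
  have qc: "isCont q x" if "x \<notin> {0}" for x
  proof (cases "x < 0")
    case True
    have "(q has_real_derivative 0) (at x)" by (rule dneg[OF True, of _ 0]) (simp add: q_def)
    then show ?thesis by (rule DERIV_isCont)
  next
    case False
    have "isCont (\<lambda>x. k * \<Phi>' x + g (\<Phi> x)) x" using rc by (simp add: continuous_on_eq_continuous_at)
    moreover have "\<forall>\<^sub>F y in nhds x. q y = k * \<Phi>' y + g (\<Phi> y)"
      by (rule eventually_nhds_in_open[THEN eventually_mono, of "{0<..}"]) (use False that in \<open>auto simp: q_def\<close>)
    ultimately show ?thesis using isCont_cong[of q "\<lambda>x. k * \<Phi>' x + g (\<Phi> x)" x] by simp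
  qed
  have eq: "k * \<Phi>' x = max (q x - f (\<Phi> x)) 0" if "x \<notin> {0}" for x
  proof (cases "x < 0")
    case True
    then show ?thesis using f\<beta> by (simp add: \<Phi>_def \<Phi>'_def q_def)
  next
    case False
    then have "0 \<le> k * p x" using p[of x] k by simp
    then show ?thesis using False that fg[of x] by (simp add: \<Phi>_def \<Phi>'_def q_def)
  qed
  have "solution f (\<lambda>t x. \<Phi> (x + k * t))"
    by (rule solution_translate[OF d1 c(2), of "{0}" q]) (use d2 qb qc eq in auto)
  then show ?thesis by (simp add: \<Phi>_def)
qed

text \<open>A nondegenerate interval has positive measure, so a pointwise lower bound on it is seen
  by the essential supremum.\<close>

lemma Linf_norm_ge_on_interval:
  assumes "a < b" and ge: "\<And>x. x \<in> {a..b} \<Longrightarrow> \<epsilon> \<le> \<bar>v x\<bar>"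
  shows "Linf_norm v \<ge> ereal \<epsilon>"
proof (rule ccontr)
  assume "\<not> Linf_norm v \<ge> ereal \<epsilon>"
  then have lt: "Linf_norm v < ereal \<epsilon>" by simp
  have "AE x in lebesgue. ereal \<bar>v x\<bar> \<le> Linf_norm v" unfolding Linf_norm_def by (rule esssup_AE)
  then have "AE x in lebesgue. x \<notin> {a..b}"
  proof (rule eventually_mono)
    fix x assume "ereal \<bar>v x\<bar> \<le> Linf_norm v"
    then have "ereal \<bar>v x\<bar> < ereal \<epsilon>" using lt by (rule order.strict_trans1)
    then show "x \<notin> {a..b}" using ge[of x] by auto
  qed
  then have "emeasure lebesgue {x \<in> space lebesgue. x \<in> {a..b}} = 0" by (rule emeasure_eq_0_AE)
  moreover have "{x \<in> space lebesgue. x \<in> {a..b}} = {a..b}" by auto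
  ultimately have "emeasure lebesgue {a..b} = 0" by simp
  then show False using assms(1) by simp
qed

theorem proposition1p6:
  fixes f \<phi> :: "real \<Rightarrow> real" and a\<^sub>m a\<^sub>0 a\<^sub>p \<alpha> c :: real
  assumes "f C1_differentiable_on UNIV"
    and "a\<^sub>m < a\<^sub>0" and "a\<^sub>0 < a\<^sub>p"
    and "f a\<^sub>m = 0" and "f a\<^sub>0 = 0" and "f a\<^sub>p = 0"
    and "deriv f a\<^sub>m > 0" and "deriv f a\<^sub>p > 0"
    and "\<forall>z\<in>{a\<^sub>m<..<a\<^sub>0}. f z > 0"
    and "\<forall>z\<in>{a\<^sub>0<..<a\<^sub>p}. f z < 0"
    and "\<alpha> \<in> {a\<^sub>m<..<a\<^sub>0}"
    and "integral {\<alpha>..a\<^sub>p} f < 0"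
    and "traveling_wave f a\<^sub>p \<alpha> c \<phi>"
  shows "unstable_Linf f (\<lambda>t x. \<phi> (x - c * t))"
proof -
  note f = assms(1) and tw = assms(13)
  note T = tw[unfolded traveling_wave_def] and C = traveling_wave_classical[OF f tw]
  define g where "g z = f (max a\<^sub>m (min a\<^sub>p z))" for z
  have gf: "g z = f z" if "a\<^sub>m \<le> z" "z \<le> a\<^sub>p" for z using that by (simp add: g_def max_def min_def)
  obtain M where bi: "bistable g a\<^sub>m a\<^sub>0 a\<^sub>p M"
    using bistable_truncation[OF f assms(2-6,9,10)] unfolding g_def by blast
  have \<alpha>: "a\<^sub>m < \<alpha>" "\<alpha> < a\<^sub>0" using assms(11) by auto
  have c: "c < 0" by (rule traveling_wave_speed_negative[OF f tw _ assms(12)]) (use \<alpha> assms(3) in simp)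
  have lim: "(\<phi> \<longlongrightarrow> a\<^sub>p) at_top" using T by blast
  have \<phi>c: "continuous_on X \<phi>" for X using C(1) by (meson DERIV_isCont continuous_at_imp_continuous_on)
  have mono: "\<phi> s \<le> \<phi> t" if "s \<le> t" for s t
    by (rule mono_open[of s t \<phi> "deriv \<phi>"]) (use C(1) T \<phi>c that in auto)
  have le: "\<phi> x \<le> a\<^sub>p" for x
    by (rule tendsto_lowerbound[OF lim]) (use mono in \<open>auto simp: eventually_at_top_linorder\<close>)
  have ge: "\<alpha> \<le> \<phi> x" for x using T by (cases "x \<le> 0") (auto intro: less_imp_le)
  have o: "orbit g (- c) \<alpha> \<phi> (deriv \<phi>)"
    unfolding orbit_def
  proof (intro conjI allI impI)
    show "continuous_on {0..} (deriv \<phi>)" using C(2) continuous_on_subset by blast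
    fix x :: real assume x: "x > 0"
    have "g (\<phi> x) = f (\<phi> x)" by (rule gf) (use ge[of x] le[of x] \<alpha> in auto)
    then show "(deriv \<phi> has_real_derivative - c * deriv \<phi> x + g (\<phi> x)) (at x)" using C(3)[OF x] by simp
  qed (use C \<phi>c in auto)
  interpret bistable g a\<^sub>m a\<^sub>0 a\<^sub>p M by (rule bi)
  interpret reference_wave g a\<^sub>m a\<^sub>0 a\<^sub>p M "- c" \<alpha> \<phi> "deriv \<phi>"
    by unfold_locales (use o \<alpha> c T lim in auto)
  \<comment> \<open>Behind the slower front the reference wave is at \<alpha> and the faster one
    approaches \<open>a\<^sub>p\<close>; half of this gap is attained after finite time.\<close>
  define \<epsilon> where "\<epsilon> = (a\<^sub>p - \<alpha>) / 2"
  have \<epsilon>: "\<epsilon> > 0" using \<alpha> assms(3) by (simp add: \<epsilon>_def)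
  show ?thesis unfolding unstable_Linf_def
  proof (intro exI[of _ \<epsilon>] conjI \<epsilon> allI impI)
    fix \<delta> :: real assume \<delta>: "\<delta> > 0"
    \<comment> \<open>Closeness is requested up to \<delta>/2, since a pointwise strict bound gives
      only a non-strict bound for the essential supremum.\<close>
    obtain k \<beta> \<psi> p where w: "- c < k" "a\<^sub>m < \<beta>" "\<beta> < a\<^sub>0" "orbit g k \<beta> \<psi> p"
      "\<And>x. x \<ge> 0 \<Longrightarrow> 0 \<le> p x" "\<And>x. x \<ge> 0 \<Longrightarrow> \<psi> x < a\<^sub>p" "(\<psi> \<longlongrightarrow> a\<^sub>p) at_top"
      "\<bar>\<beta> - \<alpha>\<bar> < \<delta> / 2" "\<And>x. x \<ge> 0 \<Longrightarrow> \<bar>\<psi> x - \<phi> x\<bar> < \<delta> / 2"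
      using nearby_faster_wave[of "\<delta> / 2"] \<delta> by auto
    have k: "k > 0" using w(1) c by simp
    note O = orbitD[OF w(4)]
    have \<psi>ge: "\<beta> \<le> \<psi> x" if "x \<ge> 0" for x
      using mono_open[of 0 x \<psi> p 0 x] O w(5) that by auto
    define u where "u t x = (if x + k * t \<le> 0 then \<beta> else \<psi> (x + k * t))" for t x
    have sol: "solution f u" unfolding u_def
    proof (rule wave_solution[OF g_cont w(4)])
      show "f (\<psi> x) = g (\<psi> x)" if "x > 0" for x
        by (rule gf[symmetric]) (use \<psi>ge[of x] w(2) w(6)[of x] that in auto)
    qed (use k w assms(9) in \<open>auto intro: less_imp_le\<close>)
    obtain Y where Y: "\<And>x. x \<ge> Y \<Longrightarrow> \<psi> x > \<alpha> + \<epsilon>"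
    proof -
      have "\<forall>\<^sub>F x in at_top. \<alpha> + \<epsilon> < \<psi> x" by (rule order_tendstoD(1)[OF w(7)]) (use \<epsilon> in \<open>simp add: \<epsilon>_def field_simps\<close>)
      then show ?thesis using that unfolding eventually_at_top_linorder by blast
    qed
    \<comment> \<open>The contact points move apart at rate \<open>k + c\<close>. At this time they
      are \<open>max Y 1 + 1\<close> apart: the summand 1 pays for the length of the interval
      \<open>{c * t - 1..c * t}\<close>, and the 1 inside the maximum keeps \<open>x + k * t\<close>
      positive there, so that \<open>u\<close> is given by \<psi>.\<close>
    define t where "t = (max Y 1 + 1) / (k + c)"
    have kc: "k + c > 0" using w(1) by simp
    have t: "t > 0" using kc by (simp add: t_def)
    have tY: "(k + c) * t = max Y 1 + 1" using kc by (simp add: t_def)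
    have small: "Linf_norm (\<lambda>x. u 0 x - \<phi> (x - c * 0)) < ereal \<delta>"
    proof -
      have u0: "u 0 x - \<phi> (x - c * 0) = (if x \<le> 0 then \<beta> - \<alpha> else \<psi> x - \<phi> x)" for x using T by (simp add: u_def)
      have "continuous_on (UNIV :: real set) (\<lambda>x. if x \<le> 0 then \<beta> - \<alpha> else \<psi> x - \<phi> x)"
      proof -
        have U: "UNIV = {..0} \<union> {0::real..}" by auto
        show ?thesis unfolding U
          by (rule continuous_on_cases) (use O(1,3) C(4) \<phi>c in \<open>auto intro!: continuous_intros\<close>)
      qed
      then have m: "(\<lambda>x. ereal \<bar>u 0 x - \<phi> (x - c * 0)\<bar>) \<in> borel_measurable lebesgue"
        unfolding u0 by (intro borel_measurable_ereal borel_measurable_abs)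
          (simp add: borel_measurable_continuous_onI measurable_completion)
      have "Linf_norm (\<lambda>x. u 0 x - \<phi> (x - c * 0)) \<le> ereal (\<delta> / 2)" unfolding Linf_norm_def
      proof (rule esssup_I[OF m], intro AE_I2)
        fix x
        show "ereal \<bar>u 0 x - \<phi> (x - c * 0)\<bar> \<le> ereal (\<delta> / 2)"
          using w(8) w(9)[of x] unfolding u0 by auto
      qed
      also have "\<dots> < ereal \<delta>" using \<delta> by simp
      finally show ?thesis .
    qed
    have big: "Linf_norm (\<lambda>x. u t x - \<phi> (x - c * t)) \<ge> ereal \<epsilon>"
    proof (rule Linf_norm_ge_on_interval)
      show "c * t - 1 < c * t" by simp
      fix x assume x: "x \<in> {c * t - 1..c * t}"
      have "\<phi> (x - c * t) = \<alpha>" using T x by auto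
      moreover have "x + k * t \<ge> max Y 1" using x tY unfolding distrib_right atLeastAtMost_iff by linarith
      then have "x + k * t > 0" "\<psi> (x + k * t) > \<alpha> + \<epsilon>" using Y[of "x + k * t"] by auto
      ultimately show "\<epsilon> \<le> \<bar>u t x - \<phi> (x - c * t)\<bar>" by (simp add: u_def)
    qed
    show "\<exists>u. solution f u \<and> (\<exists>t>0. Linf_norm (\<lambda>x. u 0 x - \<phi> (x - c * 0)) < ereal \<delta> \<and>
        ereal \<epsilon> \<le> Linf_norm (\<lambda>x. u t x - \<phi> (x - c * t)))"
      using sol t small big by blast
  qed
qed

end
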